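(* Let $\nu>-1$, let $1<p<+\infty$, and let $P_\nu$ be the weighted Bergman projection, i.e. the orthogonal projection of $L^2_\nu(\mathbb H)$ onto $A^2_\nu(\mathbb H)$, regarded as an operator densely defined on $L^2_\nu(\mathbb H)\cap L^p_\nu(\mathbb H)\subseteq L^p_\nu(\mathbb H)$. Then: (i) if $\nu>0$ and $\nu\neq 2n$ for every $n\in\mathbb N$, then $P_\nu$ extends to a bounded operator $P_\nu:L^p_\nu(\mathbb H)\to L^p_\nu(\mathbb H)$ if and only if $$p\in\Big(2-\frac{\nu-2\lfloor\nu/2\rfloor}{2+\nu-\lfloor\nu/2\rfloor},\ 2+\frac{\nu-2\lfloor\nu/2\rfloor}{2+\lfloor\nu/2\rfloor}\Big);$$ (ii) if $\nu=2n$ with $n\in\mathbb N_0=\{0,1,2,\dots\}$, then $P_\nu$ extends to a bounded operator $P_\nu:L^p_\nu(\mathbb H)\to L^p_\nu(\mathbb H)$ if and only if $$p\in\Big(2-\frac{2}{3+n},\ 2+\frac{2}{1+n}\Big);$$ (iii) if $-1<\nu<0$, then $P_\nu$ extends to a bounded operator $P_\nu:L^p_\nu(\mathbb H)\to L^p_\nu(\mathbb H)$ if and only if $$p\in\Big(2-\frac{2+\nu}{3+\nu},\ 4+\nu\Big).$$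
   Context: The Hartogs triangle is $\mathbb H=\{(z_1,z_2)\in\mathbb C^2:|z_1|<|z_2|<1\}$, and $dz$ denotes Lebesgue measure on $\mathbb C^2$. For $\nu>-1$ and $1<p<\infty$, $L^p_\nu(\mathbb H)$ is the space of measurable functions $f$ on $\mathbb H$ with $$\|f\|_{L^p_\nu}^p=\int_{\mathbb H}|f|^p\,d\mu_\nu<+\infty,\qquad d\mu_\nu(z)=c_\nu|z_2|^\nu\,(1-|z_1/z_2|^2)^\nu(1-|z_2|^2)^\nu\,dz,$$ where $c_\nu>0$ is the normalization constant making $\mu_\nu(\mathbb H)=1$. The space $A^p_\nu(\mathbb H)$ is the subspace of holomorphic functions in $L^p_\nu(\mathbb H)$; $A^2_\nu(\mathbb H)$ is a closed subspace of $L^2_\nu(\mathbb H)$. $\lfloor\cdot\rfloor$ is the floor function. *)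

theory Defs
  imports "HOL-Analysis.Analysis"
begin

definition hartogs :: "(complex \<times> complex) set" where
  "hartogs = {z. norm (fst z) < norm (snd z) \<and> norm (snd z) < 1}"

text \<open>Holomorphy in two complex variables: the real Frechet derivative exists and is
  \<open>\<complex>\<close>-linear.\<close>

definition holomorphic2_on :: "(complex \<times> complex \<Rightarrow> complex) \<Rightarrow> (complex \<times> complex) set \<Rightarrow> bool"
  where
  "holomorphic2_on f S \<longleftrightarrow>
     (\<forall>z\<in>S. \<exists>a b. (f has_derivative (\<lambda>h. a * fst h + b * snd h)) (at z within S))"

definition hartogs_weight :: "real \<Rightarrow> complex \<times> complex \<Rightarrow> real" where
  "hartogs_weight \<nu> z =
     norm (snd z) powr \<nu> * (1 - (norm (fst z / snd z))\<^sup>2) powr \<nu> * (1 - (norm (snd z))\<^sup>2) powr \<nu>"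

definition hartogs_const :: "real \<Rightarrow> real" where
  "hartogs_const \<nu> = 1 / (\<integral>z. hartogs_weight \<nu> z \<partial>lebesgue_on hartogs)"

definition hartogs_measure :: "real \<Rightarrow> (complex \<times> complex) measure" where
  "hartogs_measure \<nu> =
     density (lebesgue_on hartogs) (\<lambda>z. ennreal (hartogs_const \<nu> * hartogs_weight \<nu> z))"

text \<open>Elements of the \<open>L\<^sup>p\<close> spaces are represented by total functions; only their values on
  the Hartogs triangle (the space of the measure) matter, and equality in \<open>L\<^sup>p\<close> is equality
  almost everywhere with respect to the measure.\<close>

definition Lp :: "real \<Rightarrow> real \<Rightarrow> (complex \<times> complex \<Rightarrow> complex) set" where
  "Lp \<nu> p = {f \<in> borel_measurable (hartogs_measure \<nu>).
     integrable (hartogs_measure \<nu>) (\<lambda>z. norm (f z) powr p)}"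

definition Lp_norm :: "real \<Rightarrow> real \<Rightarrow> (complex \<times> complex \<Rightarrow> complex) \<Rightarrow> real" where
  "Lp_norm \<nu> p f = (\<integral>z. norm (f z) powr p \<partial>hartogs_measure \<nu>) powr (1 / p)"

definition Ap :: "real \<Rightarrow> real \<Rightarrow> (complex \<times> complex \<Rightarrow> complex) set" where
  "Ap \<nu> p = {f \<in> Lp \<nu> p. holomorphic2_on f hartogs}"

definition L2_inner ::
  "real \<Rightarrow> (complex \<times> complex \<Rightarrow> complex) \<Rightarrow> (complex \<times> complex \<Rightarrow> complex) \<Rightarrow> complex" where
  "L2_inner \<nu> f g = (\<integral>z. f z * cnj (g z) \<partial>hartogs_measure \<nu>)"

text \<open>For \<open>f\<close> in \<open>L\<^sup>2\<close> and \<open>\<nu> > -1\<close>, the orthogonal projection onto the closed subspace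
  \<open>A\<^sup>2\<close> exists, and the choice below is determined on the Hartogs triangle; only the irrelevant
  values off the triangle are left unspecified.\<close>

definition bergman_proj ::
  "real \<Rightarrow> (complex \<times> complex \<Rightarrow> complex) \<Rightarrow> (complex \<times> complex \<Rightarrow> complex)" where
  "bergman_proj \<nu> f =
     (SOME g. g \<in> Ap \<nu> 2 \<and> (\<forall>h\<in>Ap \<nu> 2. L2_inner \<nu> (\<lambda>z. f z - g z) h = 0))"

text \<open>Linearity is required modulo null sets; together with the norm bound it makes the operator
  well defined on equivalence classes.\<close>

definition Lp_bounded_operator ::
  "real \<Rightarrow> real \<Rightarrow> ((complex \<times> complex \<Rightarrow> complex) \<Rightarrow> (complex \<times> complex \<Rightarrow> complex)) \<Rightarrow> bool"
  where
  "Lp_bounded_operator \<nu> p T \<longleftrightarrow>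
     (\<forall>f\<in>Lp \<nu> p. T f \<in> Lp \<nu> p) \<and>
     (\<forall>f\<in>Lp \<nu> p. \<forall>g\<in>Lp \<nu> p. \<forall>a b. AE z in hartogs_measure \<nu>.
        T (\<lambda>w. a * f w + b * g w) z = a * T f z + b * T g z) \<and>
     (\<exists>C. \<forall>f\<in>Lp \<nu> p. Lp_norm \<nu> p (T f) \<le> C * Lp_norm \<nu> p f)"

definition extends_to_bounded_Lp ::
  "real \<Rightarrow> real \<Rightarrow> ((complex \<times> complex \<Rightarrow> complex) \<Rightarrow> (complex \<times> complex \<Rightarrow> complex)) \<Rightarrow> bool"
  where
  "extends_to_bounded_Lp \<nu> p P \<longleftrightarrow>
     (\<exists>T. Lp_bounded_operator \<nu> p T \<and>
          (\<forall>f\<in>Lp \<nu> 2 \<inter> Lp \<nu> p. AE z in hartogs_measure \<nu>. T f z = P f z))"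

end

theory Submission
  imports Defs "HOL-Complex_Analysis.Complex_Analysis" "HOL-Real_Asymp.Real_Asymp"
begin

text \<open>
  The substitution \<open>z\<^sub>1 = w\<^sub>1 w\<^sub>2\<close>, \<open>z\<^sub>2 = w\<^sub>2\<close> turns the Hartogs triangle into a product of punctured discs
  with the weights \<open>(1 - \<bar>w\<^sub>1\<bar>\<^sup>2) powr \<nu>\<close> and \<open>\<bar>w\<^sub>2\<bar> powr (\<nu> + 2) * (1 - \<bar>w\<^sub>2\<bar>\<^sup>2) powr \<nu>\<close>, so the Bergman kernel
  is a product of two one-variable kernels. If \<open>s\<close> is the largest integer below \<open>2 + \<nu> / 2\<close>, the second
  one is bounded by a multiple of \<open>\<bar>w u\<bar> powr (- s) * \<bar>1 - w cnj u\<bar> powr (- (2 + \<nu>))\<close>. A Schur test with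
  weights \<open>\<bar>u\<bar> powr (- l) * (1 - \<bar>u\<bar>\<^sup>2) powr (- e)\<close> gives boundedness as soon as \<open>s p < \<nu> + 4\<close> and
  \<open>s q < \<nu> + 4\<close>, where \<open>q\<close> is the conjugate exponent. Conversely, the projection maps the bounded
  function \<open>cnj z\<^sub>2 ^ s\<close> to a multiple of \<open>1 / z\<^sub>2 ^ s\<close>, which lies in \<open>L\<^sup>p\<close> only if \<open>s p < \<nu> + 4\<close>, and duality
  gives the condition on \<open>q\<close>.
\<close>

section \<open>Lebesgue measure on the complex plane\<close>

text \<open>The value of \<open>s\<close> decides everything. On the second factor the power
  \<open>w ^ (-s)\<close> is square integrable exactly when \<open>2 * s < \<nu> + 4\<close>. The
  inequality is strict, so \<open>\<nu> = 2 * n\<close> gives \<open>s = n + 1\<close>, one less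
  than the pattern \<open>\<lfloor>\<nu> / 2\<rfloor> + 2\<close> of the other positive weights;
  this drop makes even weights a case of their own. All three intervals are instances of the one
  from \<open>(\<nu> + 4) / (\<nu> + 4 - s)\<close> to \<open>(\<nu> + 4) / s\<close>. Only the
  origin of the second disc restricts \<open>p\<close>; the singularity at the boundary does not.
  The obstacle is the kernel bound. With \<open>a = 2 + \<nu> / 2 - s\<close> the kernel is a power
  of \<open>1 - x\<close> when \<open>a = 1\<close>, but a hypergeometric series in general, and its
  boundary growth is read off a first order differential equation. The projection is handled through
  the integral operator with this kernel: the Schur test at exponent 2 bounds it, Fubini makes it
  symmetric, its range is holomorphic, and it fixes \<open>A\<^sup>2\<close>. So it agrees with
  \<open>bergman_proj\<close> almost everywhere on \<open>L\<^sup>2\<close>, and both directions are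
  argued on it.\<close>

lemma lborel_complex_eq:
  "(lborel :: complex measure) = distr (lborel \<Otimes>\<^sub>M lborel) borel (\<lambda>(x, y). Complex x y)"
proof (rule lborel_eqI)
  fix l u :: complex
  assume le: "\<And>b. b \<in> Basis \<Longrightarrow> l \<bullet> b \<le> u \<bullet> b"
  have le': "Re l \<le> Re u" "Im l \<le> Im u"
    using le[of 1] le[of \<i>] by (auto simp: Basis_complex_def)
  have m: "(\<lambda>(x, y). Complex x y) \<in> borel_measurable (lborel \<Otimes>\<^sub>M lborel)"
    unfolding Complex_eq by measurable
  have *: "(\<lambda>(x, y). Complex x y) -` box l u \<inter> space (lborel \<Otimes>\<^sub>M lborel)
      = {Re l<..<Re u} \<times> {Im l<..<Im u}"
    by (auto simp: box_def Basis_complex_def space_pair_measure)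
  have "emeasure (distr (lborel \<Otimes>\<^sub>M lborel) borel (\<lambda>(x, y). Complex x y)) (box l u)
      = emeasure (lborel \<Otimes>\<^sub>M lborel) ({Re l<..<Re u} \<times> {Im l<..<Im u})"
    by (subst emeasure_distr[OF m]) (auto simp: *)
  also have "\<dots> = ennreal ((Re u - Re l) * (Im u - Im l))"
    using le' by (subst lborel.emeasure_pair_measure_Times) (auto simp: ennreal_mult)
  also have "(Re u - Re l) * (Im u - Im l) = (\<Prod>b\<in>Basis. (u - l) \<bullet> b)"
    by (simp add: Basis_complex_def)
  finally show "emeasure (distr (lborel \<Otimes>\<^sub>M lborel) borel (\<lambda>(x, y). Complex x y)) (box l u)
      = ennreal (\<Prod>b\<in>Basis. (u - l) \<bullet> b)" .
qed simp

text \<open>Both orders of integration are recorded because multiplication by a complex number is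
  treated below by changing one real coordinate at a time.\<close>

lemma nn_integral_complex_eq:
  fixes F :: "complex \<Rightarrow> ennreal"
  assumes [measurable]: "F \<in> borel_measurable borel"
  shows "(\<integral>\<^sup>+u. F u \<partial>lborel) = (\<integral>\<^sup>+x. \<integral>\<^sup>+y. F (Complex x y) \<partial>lborel \<partial>lborel)"
    and "(\<integral>\<^sup>+u. F u \<partial>lborel) = (\<integral>\<^sup>+y. \<integral>\<^sup>+x. F (Complex x y) \<partial>lborel \<partial>lborel)"
proof -
  have m: "(\<lambda>(x, y). Complex x y) \<in> borel_measurable (lborel \<Otimes>\<^sub>M lborel)"
    unfolding Complex_eq by measurable
  have m2: "(\<lambda>z. F (Complex (fst z) (snd z))) \<in> borel_measurable (lborel \<Otimes>\<^sub>M lborel)"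
    unfolding Complex_eq by measurable
  have "(\<integral>\<^sup>+u. F u \<partial>lborel) = (\<integral>\<^sup>+z. F (Complex (fst z) (snd z)) \<partial>(lborel \<Otimes>\<^sub>M lborel))"
    by (subst lborel_complex_eq, subst nn_integral_distr[OF m]) (auto simp: case_prod_beta)
  moreover have "\<dots> = (\<integral>\<^sup>+x. \<integral>\<^sup>+y. F (Complex x y) \<partial>lborel \<partial>lborel)"
    by (subst lborel.nn_integral_fst[symmetric, OF m2]) simp
  moreover have "\<dots> = (\<integral>\<^sup>+y. \<integral>\<^sup>+x. F (Complex x y) \<partial>lborel \<partial>lborel)"
    using lborel_pair.Fubini[OF m2] by simp
  ultimately show "(\<integral>\<^sup>+u. F u \<partial>lborel) = (\<integral>\<^sup>+x. \<integral>\<^sup>+y. F (Complex x y) \<partial>lborel \<partial>lborel)"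
    and "(\<integral>\<^sup>+u. F u \<partial>lborel) = (\<integral>\<^sup>+y. \<integral>\<^sup>+x. F (Complex x y) \<partial>lborel \<partial>lborel)"
    by auto
qed

text \<open>When \<open>Re c \<noteq> 0\<close>, multiplication by \<open>c\<close> splits into two
  affine changes of one real variable, with Fubini between them. A purely imaginary \<open>c\<close>
  is a product of two numbers with nonzero real part, so two applications of the first case
  suffice.\<close>

lemma nn_integral_complex_mult:
  fixes F :: "complex \<Rightarrow> ennreal"
  assumes F [measurable]: "F \<in> borel_measurable borel" and "c \<noteq> 0"
  shows "(\<integral>\<^sup>+u. F u \<partial>lborel) = ennreal ((norm c)\<^sup>2) * (\<integral>\<^sup>+u. F (c * u) \<partial>lborel)"
proof -
  have main: "(\<integral>\<^sup>+u. G u \<partial>lborel) = ennreal ((norm c)\<^sup>2) * (\<integral>\<^sup>+u. G (c * u) \<partial>lborel)"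
    if [measurable]: "G \<in> borel_measurable borel" and "Re c \<noteq> 0" for G :: "complex \<Rightarrow> ennreal" and c
  proof -
    define a b where "a = Re c" and "b = Im c"
    have c: "c = Complex a b" and a: "a \<noteq> 0" using that by (auto simp: a_def b_def)
    have [simp]: "(norm c)\<^sup>2 = a\<^sup>2 + b\<^sup>2" by (simp add: cmod_power2 a_def b_def)
    have pos: "a\<^sup>2 + b\<^sup>2 > 0" using a by (simp add: sum_power2_gt_zero_iff)
    \<comment> \<open>Eliminating \<open>x\<close> in favour of the first coordinate
      \<open>a * x - b * y\<close> of the product leaves \<open>e\<close> as the coefficient of
      \<open>y\<close> in the second coordinate; \<open>a * e\<close> is the Jacobian.\<close>
    define e where "e = (a\<^sup>2 + b\<^sup>2) / a"
    have e: "e \<noteq> 0" using pos a by (auto simp: e_def)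
    have "(\<integral>\<^sup>+u. G (c * u) \<partial>lborel)
        = (\<integral>\<^sup>+y. \<integral>\<^sup>+x. G (c * Complex x y) \<partial>lborel \<partial>lborel)"
      by (rule nn_integral_complex_eq(2)) simp
    also have "\<dots> = (\<integral>\<^sup>+y. ennreal (1 / \<bar>a\<bar>) * (\<integral>\<^sup>+x. G (Complex x ((b/a) * x + e * y)) \<partial>lborel) \<partial>lborel)"
    proof (rule nn_integral_cong, goal_cases)
      case (1 y)
      have [measurable]: "(\<lambda>x. G (c * Complex x y)) \<in> borel_measurable borel"
        unfolding Complex_eq by measurable
      have "(\<integral>\<^sup>+x. G (c * Complex x y) \<partial>lborel)
        = \<bar>1/a\<bar> * (\<integral>\<^sup>+x. G (c * Complex (b / a * y + 1/a * x) y) \<partial>lborel)"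
        using a by (intro nn_integral_real_affine) auto
      also have "(\<lambda>x. c * Complex (b / a * y + 1/a * x) y) = (\<lambda>x. Complex x ((b/a) * x + e * y))"
        using a by (auto simp: fun_eq_iff c complex_eq_iff e_def field_simps power2_eq_square)
      finally show ?case by (simp add: abs_div_pos)
    qed
    also have "\<dots> = ennreal (1 / \<bar>a\<bar>) * (\<integral>\<^sup>+y. \<integral>\<^sup>+x. G (Complex x ((b/a) * x + e * y)) \<partial>lborel \<partial>lborel)"
      unfolding Complex_eq by (intro nn_integral_cmult) measurable
    also have "(\<integral>\<^sup>+y. \<integral>\<^sup>+x. G (Complex x ((b/a) * x + e * y)) \<partial>lborel \<partial>lborel)
        = (\<integral>\<^sup>+x. \<integral>\<^sup>+y. G (Complex x ((b/a) * x + e * y)) \<partial>lborel \<partial>lborel)"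
      unfolding Complex_eq by (intro lborel_pair.Fubini') measurable
    also have "\<dots> = (\<integral>\<^sup>+x. ennreal (1 / \<bar>e\<bar>) * (\<integral>\<^sup>+y. G (Complex x y) \<partial>lborel) \<partial>lborel)"
    proof (rule nn_integral_cong, goal_cases)
      case (1 x)
      have [measurable]: "(\<lambda>y. G (Complex x y)) \<in> borel_measurable borel"
        unfolding Complex_eq by measurable
      have "(\<integral>\<^sup>+y. G (Complex x y) \<partial>lborel) = \<bar>e\<bar> * (\<integral>\<^sup>+y. G (Complex x ((b/a) * x + e * y)) \<partial>lborel)"
        using e by (intro nn_integral_real_affine) auto
      then have "ennreal (1 / \<bar>e\<bar>) * (\<integral>\<^sup>+y. G (Complex x y) \<partial>lborel)
         = ennreal (1 / \<bar>e\<bar> * \<bar>e\<bar>) * (\<integral>\<^sup>+y. G (Complex x ((b/a) * x + e * y)) \<partial>lborel)"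
        by (subst ennreal_mult) (auto simp: mult.assoc)
      then show ?case using e by simp
    qed
    also have "\<dots> = ennreal (1 / \<bar>e\<bar>) * (\<integral>\<^sup>+u. G u \<partial>lborel)"
      by (subst nn_integral_complex_eq(1)) (auto simp: Complex_eq intro!: nn_integral_cmult)
    also have "ennreal (1 / \<bar>a\<bar>) * (ennreal (1 / \<bar>e\<bar>) * (\<integral>\<^sup>+u. G u \<partial>lborel)) = ennreal (1 / (a\<^sup>2 + b\<^sup>2)) * (\<integral>\<^sup>+u. G u \<partial>lborel)"
      using a pos by (simp add: e_def mult.assoc[symmetric] ennreal_mult[symmetric] abs_div)
    finally have "(\<integral>\<^sup>+u. G (c * u) \<partial>lborel) = ennreal (1 / (a\<^sup>2 + b\<^sup>2)) * (\<integral>\<^sup>+u. G u \<partial>lborel)" .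
    then have "ennreal (a\<^sup>2 + b\<^sup>2) * (\<integral>\<^sup>+u. G (c * u) \<partial>lborel) = ennreal ((a\<^sup>2 + b\<^sup>2) * (1 / (a\<^sup>2 + b\<^sup>2))) * (\<integral>\<^sup>+u. G u \<partial>lborel)"
      using pos by (subst ennreal_mult) (auto simp: mult.assoc)
    moreover have "(a\<^sup>2 + b\<^sup>2) * (1 / (a\<^sup>2 + b\<^sup>2)) = 1" using pos a by simp
    ultimately show ?thesis by (simp only: ennreal_1 mult_1 \<open>(norm c)\<^sup>2 = a\<^sup>2 + b\<^sup>2\<close>)
  qed
  show ?thesis
  proof (cases "Re c = 0")
    case False
    then show ?thesis by (intro main F)
  next
    case True
    \<comment> \<open>Turning by an eighth of a circle moves an imaginary number off the imaginary
      axis.\<close>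
    define c1 c2 where "c1 = 1 + \<i>" and "c2 = c * (1 - \<i>) / 2"
    have "c1 * c2 = c * ((1 + \<i>) * (1 - \<i>)) / 2" by (simp add: c1_def c2_def mult_ac)
    also have "(1 + \<i>) * (1 - \<i>) = 2" by (simp add: algebra_simps)
    finally have c: "c = c1 * c2" by simp
    have "Im c \<noteq> 0" using True \<open>c \<noteq> 0\<close> by (auto simp: complex_eq_iff)
    then have r: "Re c1 \<noteq> 0" "Re c2 \<noteq> 0" using True by (auto simp: c1_def c2_def)
    have "(\<integral>\<^sup>+u. F u \<partial>lborel) = ennreal ((norm c1)\<^sup>2) * (\<integral>\<^sup>+u. F (c1 * u) \<partial>lborel)"
      using r by (intro main) auto
    also have "(\<integral>\<^sup>+u. F (c1 * u) \<partial>lborel) = ennreal ((norm c2)\<^sup>2) * (\<integral>\<^sup>+u. F (c1 * (c2 * u)) \<partial>lborel)"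
      using r by (intro main) auto
    finally show ?thesis
      by (simp add: c norm_mult power_mult_distrib ennreal_mult mult.assoc)
  qed
qed

lemma distr_lborel_complex_unit_mult:
  assumes "norm (c::complex) = 1"
  shows "distr lborel borel ((*) c) = lborel"
proof (rule measure_eqI)
  fix A :: "complex set" assume "A \<in> sets (distr lborel borel ((*) c))"
  then have [measurable]: "A \<in> sets borel" by simp
  have "emeasure lborel A = (\<integral>\<^sup>+u. indicator A u \<partial>lborel)" by simp
  also have "\<dots> = (\<integral>\<^sup>+u. indicator A (c * u) \<partial>lborel)"
    using assms by (subst nn_integral_complex_mult[of _ c]) auto
  also have "\<dots> = emeasure (distr lborel borel ((*) c)) A"
    by (subst nn_integral_indicator[symmetric], simp, subst nn_integral_distr) auto
  finally show "emeasure (distr lborel borel ((*) c)) A = emeasure lborel A" ..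
qed simp

text \<open>The disc where the squared norm is at most \<open>a\<close> has area
  \<open>pi * a\<close>, and the half-lines generate the Borel sets. Using the square of the norm
  makes the radial density constant.\<close>

lemma distr_lborel_norm_squared:
  "distr lborel borel (\<lambda>u::complex. (norm u)\<^sup>2) = density lborel (\<lambda>x::real. ennreal pi * indicator {0..} x)"
proof (rule measure_eqI_generator_eq[where E = "range (\<lambda>a. {..a::real})" and \<Omega> = UNIV and A = "\<lambda>i. {..real i}"])
  show "Int_stable (range (\<lambda>a. {..a::real}))"
    by (auto simp: Int_stable_def Int_atMost)
  show "sets (distr lborel borel (\<lambda>u::complex. (norm u)\<^sup>2)) = sigma_sets UNIV (range atMost)"
    and "sets (density lborel (\<lambda>x::real. ennreal pi * indicator {0..} x)) = sigma_sets UNIV (range atMost)"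
    by (auto simp: borel_eq_atMost)
  show "(\<Union>i. {..real i}) = UNIV" by (auto simp: real_arch_simple)
  have 1: "emeasure (distr lborel borel (\<lambda>u::complex. (norm u)\<^sup>2)) {..a} = (if a \<ge> 0 then ennreal (pi * a) else 0)" for a
  proof -
    have "(\<lambda>u::complex. (norm u)\<^sup>2) -` {..a} = (if a \<ge> 0 then cball 0 (sqrt a) else {})"
    proof (cases "a \<ge> 0")
      case True
      have "(norm u)\<^sup>2 \<le> a \<longleftrightarrow> norm u \<le> sqrt a" for u :: complex
        using abs_le_square_iff[of "norm u" "sqrt a"] True by simp
      then show ?thesis using True by auto
    next
      case False
      have "\<not> (norm u)\<^sup>2 \<le> a" for u :: complex
        using False zero_le_power2[of "norm u"] by linarith
      then show ?thesis using False by auto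
    qed
    then show ?thesis
      by (auto simp: emeasure_distr emeasure_cball eval_unit_ball_vol)
  qed
  have 2: "emeasure (density lborel (\<lambda>x::real. ennreal pi * indicator {0..} x)) {..a} = (if a \<ge> 0 then ennreal (pi * a) else 0)" for a :: real
  proof -
    have "emeasure (density lborel (\<lambda>x::real. ennreal pi * indicator {0..} x)) {..a} = (\<integral>\<^sup>+x. ennreal pi * indicator {0..a} x \<partial>lborel)"
      by (subst emeasure_density) (auto simp: indicator_def intro!: nn_integral_cong)
    also have "\<dots> = ennreal pi * emeasure lborel {0..a}"
      by (subst nn_integral_cmult_indicator) auto
    finally show ?thesis by (auto simp: ennreal_mult)
  qed
  show "emeasure (distr lborel borel (\<lambda>u::complex. (norm u)\<^sup>2)) X = emeasure (density lborel (\<lambda>x::real. ennreal pi * indicator {0..} x)) X"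
    if "X \<in> range atMost" for X using that 1 2 by auto
  show "emeasure (distr lborel borel (\<lambda>u::complex. (norm u)\<^sup>2)) {..real i} \<noteq> \<infinity>" for i
    unfolding 1 by auto
qed blast+

lemma nn_integral_complex_radial:
  fixes F :: "real \<Rightarrow> ennreal"
  assumes [measurable]: "F \<in> borel_measurable borel"
  shows "(\<integral>\<^sup>+u. F ((norm (u::complex))\<^sup>2) \<partial>lborel) = ennreal pi * (\<integral>\<^sup>+x\<in>{0<..}. F x \<partial>lborel)"
proof -
  have "(\<integral>\<^sup>+u. F ((norm (u::complex))\<^sup>2) \<partial>lborel) = (\<integral>\<^sup>+x. F x \<partial>distr lborel borel (\<lambda>u::complex. (norm u)\<^sup>2))"
    by (subst nn_integral_distr) auto
  also have "\<dots> = (\<integral>\<^sup>+x. ennreal pi * (F x * indicator {0..} x) \<partial>lborel)"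
    unfolding distr_lborel_norm_squared by (subst nn_integral_density) (auto simp: mult_ac)
  also have "\<dots> = ennreal pi * (\<integral>\<^sup>+x. F x * indicator {0..} x \<partial>lborel)"
    by (rule nn_integral_cmult) auto
  also have "(\<integral>\<^sup>+x. F x * indicator {0..} x \<partial>lborel) = (\<integral>\<^sup>+x. F x * indicator {0<..} x \<partial>lborel)"
    by (rule nn_integral_cong_AE, rule AE_mp[OF AE_lborel_singleton[of 0]]) (auto simp: indicator_def)
  finally show ?thesis .
qed

lemma borel_measurable_cnj [measurable (raw)]:
  "f \<in> borel_measurable M \<Longrightarrow> (\<lambda>x. cnj (f x)) \<in> borel_measurable M"
  by (rule borel_measurable_continuous_on[where f = cnj]) (auto intro!: continuous_intros)

section \<open>Weighted measures on the punctured disc\<close>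

text \<open>The null set \<open>{0}\<close> is excluded because \<open>0 powr b = 0\<close> even for \<open>b \<le> 0\<close>.\<close>

definition disc_weight :: "real \<Rightarrow> real \<Rightarrow> complex \<Rightarrow> real" where
  "disc_weight b \<nu> u =
     (if u \<noteq> 0 \<and> norm u < 1 then norm u powr b * (1 - (norm u)\<^sup>2) powr \<nu> else 0)"

definition disc_measure :: "real \<Rightarrow> real \<Rightarrow> complex measure" where
  "disc_measure b \<nu> = density lborel (\<lambda>u. ennreal (disc_weight b \<nu> u))"

lemma disc_weight_measurable [measurable]: "disc_weight b \<nu> \<in> borel_measurable borel"
  unfolding disc_weight_def[abs_def] by measurable

lemma disc_weight_nonneg [simp]: "disc_weight b \<nu> u \<ge> 0"
  by (simp add: disc_weight_def)

lemma disc_weight_mult: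
  assumes "u \<noteq> 0" "norm u < 1"
  shows "disc_weight b \<nu> u * (norm u powr c * (1 - (norm u)\<^sup>2) powr d) = disc_weight (b + c) (\<nu> + d) u"
  using assms by (simp add: disc_weight_def powr_add mult_ac)

lemma sets_disc_measure [measurable_cong, simp]: "sets (disc_measure b \<nu>) = sets borel"
  by (simp add: disc_measure_def)

lemma space_disc_measure [simp]: "space (disc_measure b \<nu>) = UNIV"
  by (simp add: disc_measure_def)

lemma AE_disc_measure: "AE u in disc_measure b \<nu>. u \<noteq> 0 \<and> norm u < 1"
  unfolding disc_measure_def
  by (subst AE_density) (auto simp: disc_weight_def intro!: AE_I2 split: if_splits)

lemma nn_integral_disc_measure:
  assumes [measurable]: "F \<in> borel_measurable borel"
  shows "(\<integral>\<^sup>+u. F u \<partial>disc_measure b \<nu>) = (\<integral>\<^sup>+u. ennreal (disc_weight b \<nu> u) * F u \<partial>lborel)"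
  unfolding disc_measure_def by (subst nn_integral_density) auto

text \<open>In the variable \<open>x = (norm u)\<^sup>2\<close> the integrand is
  \<open>x powr (b / 2) * (1 - x) powr \<nu>\<close>, which is the Beta integral; halving
  \<open>b\<close> turns the integrability condition into \<open>b > -2\<close>.\<close>

lemma nn_integral_disc_weight:
  assumes "b > -2" "\<nu> > -1"
  shows "(\<integral>\<^sup>+u. ennreal (disc_weight b \<nu> u) \<partial>lborel) = ennreal (pi * Beta (b / 2 + 1) (\<nu> + 1))"
proof -
  define F where "F x = indicator {0..1} x * (x powr (b / 2 + 1 - 1) * (1 - x) powr (\<nu> + 1 - 1))" for x :: real
  have [measurable]: "F \<in> borel_measurable borel" unfolding F_def by measurable
  have Beta: "Beta (b / 2 + 1) (\<nu> + 1) \<ge> 0"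
    using assms by (auto simp: Beta_def intro!: divide_nonneg_nonneg mult_nonneg_nonneg less_imp_le Gamma_real_pos)
  have *: "disc_weight b \<nu> u = F ((norm u)\<^sup>2)" for u
  proof (cases "u = 0 \<or> norm u \<ge> 1")
    case True
    then show ?thesis
    proof
      assume "u = 0" then show ?thesis by (simp add: disc_weight_def F_def)
    next
      assume u: "norm u \<ge> 1"
      then have "(norm u)\<^sup>2 \<ge> 1" by simp
      then have "(norm u)\<^sup>2 = 1 \<or> (norm u)\<^sup>2 > 1" by auto
      then show ?thesis using u by (auto simp: disc_weight_def F_def)
    qed
  next
    case False
    then have u: "norm u < 1" "norm u > 0" by auto
    then have "(norm u)\<^sup>2 < 1" by (simp add: abs_square_less_1)
    moreover have "((norm u)\<^sup>2) powr (b / 2) = norm u powr b"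
      using u by (simp add: powr_powr flip: powr_numeral)
    ultimately show ?thesis using u by (auto simp: disc_weight_def F_def)
  qed
  have "(\<integral>\<^sup>+u. ennreal (disc_weight b \<nu> u) \<partial>lborel) = ennreal pi * (\<integral>\<^sup>+x\<in>{0<..}. ennreal (F x) \<partial>lborel)"
    unfolding * by (rule nn_integral_complex_radial) simp
  also have "(\<integral>\<^sup>+x\<in>{0<..}. ennreal (F x) \<partial>lborel) = (\<integral>\<^sup>+x. ennreal (F x) \<partial>lborel)"
    by (rule nn_integral_cong) (auto simp: F_def indicator_def not_less)
  also have "\<dots> = ennreal (Beta (b / 2 + 1) (\<nu> + 1))"
    unfolding F_def using assms
    by (intro nn_integral_has_integral_lebesgue has_integral_Beta_real) auto
  finally show ?thesis using Beta by (simp add: ennreal_mult)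
qed

lemma nn_integral_disc_weight_finite:
  assumes "b > -2" "\<nu> > -1"
  shows "(\<integral>\<^sup>+u. ennreal (disc_weight b \<nu> u) \<partial>lborel) < \<infinity>"
  using nn_integral_disc_weight[OF assms] by simp

lemma finite_disc_measure:
  assumes "b > -2" "\<nu> > -1"
  shows "finite_measure (disc_measure b \<nu>)"
  using nn_integral_disc_weight[OF assms]
  by (intro finite_measureI) (simp add: disc_measure_def emeasure_density)

lemma sigma_finite_disc_measure: "sigma_finite_measure (disc_measure b \<nu>)"
  unfolding disc_measure_def
  by (subst sigma_finite_measure.sigma_finite_iff_density_finite[OF sigma_finite_lborel]) auto

lemma nn_integral_inverse_infinite:
  assumes "e > (0::real)"
  shows "(\<integral>\<^sup>+x\<in>{0<..<e}. ennreal (1 / x) \<partial>lborel) = \<infinity>"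
proof -
  have large: "ennreal r \<le> (\<integral>\<^sup>+x\<in>{0<..<e}. ennreal (1 / x) \<partial>lborel)" if "r \<ge> 0" for r
  proof -
    define d where "d = e / 2"
    \<comment> \<open>Chosen so that \<open>1 / x\<close> has integral exactly \<open>r\<close> over
      the segment from \<open>c\<close> to \<open>d\<close>.\<close>
    define c where "c = d * exp (- r)"
    have d: "d > 0" "d < e" using assms by (auto simp: d_def)
    have c: "0 < c" "c \<le> d" using d that by (auto simp: c_def)
    have "(\<integral>\<^sup>+x. ennreal (1 / x) * indicator {c..d} x \<partial>lborel) = ln d - ln c"
      using c by (intro nn_integral_FTC_Icc) (auto intro!: derivative_eq_intros)
    also have "ln d - ln c = r" using d by (simp add: c_def ln_mult)
    finally have "ennreal r = (\<integral>\<^sup>+x. ennreal (1 / x) * indicator {c..d} x \<partial>lborel)" ..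
    also have "\<dots> \<le> (\<integral>\<^sup>+x\<in>{0<..<e}. ennreal (1 / x) \<partial>lborel)"
      using c d by (intro nn_integral_mono) (auto simp: indicator_def)
    finally show ?thesis .
  qed
  show ?thesis
  proof (cases "\<integral>\<^sup>+x\<in>{0<..<e}. ennreal (1 / x) \<partial>lborel")
    case (real r)
    then show ?thesis using large[of "r + 1"] by (simp add: ennreal_le_iff)
  qed simp
qed

text \<open>Near the origin \<open>(1 - (norm u)\<^sup>2) powr \<nu>\<close> stays above a constant
  \<open>K\<close>, for either sign of \<nu>, and \<open>norm u powr b\<close> is at least the
  inverse square of the norm. In \<open>x = (norm u)\<^sup>2\<close> this is the divergent integral
  of \<open>1 / x\<close>. Including \<open>b = -2\<close> is what excludes the endpoints of the
  final intervals.\<close>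

lemma nn_integral_disc_weight_infinite:
  assumes "b \<le> -2" "0 < d" "d \<le> 1"
  shows "(\<integral>\<^sup>+u\<in>ball 0 d. ennreal (disc_weight b \<nu> u) \<partial>lborel) = \<infinity>"
proof -
  define e where "e = d / 2"
  have e: "0 < e" "e < d" "e < 1" using assms by (auto simp: e_def)
  define K where "K = min 1 ((1 - e\<^sup>2) powr \<nu>)"
  have e2: "e\<^sup>2 < 1" using e by (simp add: abs_square_less_1)
  then have K: "K > 0" by (simp add: K_def)
  define F where "F x = (ennreal (1 / x)) * indicator {0<..<e\<^sup>2} x" for x :: real
  have [measurable]: "F \<in> borel_measurable borel" unfolding F_def by measurable
  have le: "ennreal K * F ((norm u)\<^sup>2) \<le> ennreal (disc_weight b \<nu> u) * indicator (ball 0 d) u" for u :: complex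
  proof (cases "0 < (norm u)\<^sup>2 \<and> (norm u)\<^sup>2 < e\<^sup>2")
    case True
    then have u: "u \<noteq> 0" "norm u < e"
      using e by (auto dest: power2_less_imp_less)
    have "K \<le> (1 - (norm u)\<^sup>2) powr \<nu>"
    proof (cases "\<nu> \<ge> 0")
      case True
      then have "(1 - e\<^sup>2) powr \<nu> \<le> (1 - (norm u)\<^sup>2) powr \<nu>"
        using \<open>0 < (norm u)\<^sup>2 \<and> (norm u)\<^sup>2 < e\<^sup>2\<close> e2 by (intro powr_mono2) auto
      then show ?thesis by (simp add: K_def)
    next
      case False
      have "1 powr \<nu> \<le> (1 - (norm u)\<^sup>2) powr \<nu>"
        using \<open>0 < (norm u)\<^sup>2 \<and> (norm u)\<^sup>2 < e\<^sup>2\<close> e2 False by (intro powr_mono2') auto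
      then show ?thesis by (simp add: K_def)
    qed
    moreover have "1 / (norm u)\<^sup>2 \<le> norm u powr b"
    proof -
      have "1 / (norm u)\<^sup>2 = norm u powr (-2)"
        using u by (simp add: powr_minus divide_simps flip: powr_numeral)
      also have "\<dots> \<le> norm u powr b"
        using u e assms by (intro powr_mono') auto
      finally show ?thesis .
    qed
    ultimately have "K * (1 / (norm u)\<^sup>2) \<le> (1 - (norm u)\<^sup>2) powr \<nu> * norm u powr b"
      using K by (intro mult_mono) auto
    then show ?thesis using u e True K
      by (auto simp: F_def disc_weight_def mult_ac ennreal_mult[symmetric] intro!: ennreal_leI)
  qed (auto simp: F_def)
  have "\<infinity> = ennreal K * (ennreal pi * (\<integral>\<^sup>+x. F x * indicator {0<..} x \<partial>lborel))"
  proof -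
    have "(\<integral>\<^sup>+x. F x * indicator {0<..} x \<partial>lborel) = (\<integral>\<^sup>+x\<in>{0<..<e\<^sup>2}. ennreal (1 / x) \<partial>lborel)"
      by (rule nn_integral_cong) (auto simp: F_def indicator_def)
    then show ?thesis using nn_integral_inverse_infinite[of "e\<^sup>2"] e K by (simp add: ennreal_mult_top)
  qed
  also have "\<dots> = ennreal K * (\<integral>\<^sup>+u. F ((norm (u::complex))\<^sup>2) \<partial>lborel)"
    by (simp add: nn_integral_complex_radial)
  also have "\<dots> = (\<integral>\<^sup>+u. ennreal K * F ((norm (u::complex))\<^sup>2) \<partial>lborel)"
    by (rule nn_integral_cmult[symmetric]) measurable
  also have "\<dots> \<le> (\<integral>\<^sup>+u\<in>ball 0 d. ennreal (disc_weight b \<nu> u) \<partial>lborel)"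
    by (intro nn_integral_mono le)
  finally show ?thesis by (simp add: top_unique)
qed

section \<open>Power series integrated against rotation invariant measures\<close>

text \<open>Isolates the symmetry behind the orthogonality of monomials. It is applied to the
  weighted disc measures, to their truncations to smaller discs, and to plain area on a
  disc.\<close>

definition rotation_invariant :: "complex measure \<Rightarrow> bool" where
  "rotation_invariant N \<longleftrightarrow> sets N = sets borel \<and> (\<forall>c. norm c = 1 \<longrightarrow> distr N borel ((*) c) = N)"

lemma rotation_invariant_density:
  assumes [measurable]: "\<psi> \<in> borel_measurable borel" and "\<And>u c. norm c = 1 \<Longrightarrow> \<psi> (c * u) = \<psi> u"
  shows "rotation_invariant (density lborel \<psi>)"
  unfolding rotation_invariant_def
proof (intro conjI allI impI)
  fix c :: complex assume c: "norm c = 1"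
  have "distr (density lborel \<psi>) borel ((*) c) = distr (density lborel (\<lambda>u. \<psi> (c * u))) borel ((*) c)"
    using assms c by simp
  also have "\<dots> = density (distr lborel borel ((*) c)) \<psi>"
    by (subst density_distr) auto
  also have "\<dots> = density lborel \<psi>"
    using distr_lborel_complex_unit_mult[OF c] by simp
  finally show "distr (density lborel \<psi>) borel ((*) c) = density lborel \<psi>" .
qed simp

text \<open>The rotation by the angle \<open>\<pi> / (k - j)\<close> changes the sign of the integral.\<close>

lemma rotation_invariant_integral_monomials:
  assumes N: "rotation_invariant N" and "j \<noteq> k"
  shows "(\<integral>u. cnj u ^ j * u ^ k \<partial>N) = 0"
proof -
  have sets [measurable_cong]: "sets N = sets borel" using N by (simp add: rotation_invariant_def)
  define c where "c = cis (pi / (real k - real j))"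
  have c1: "norm c = 1" by (simp add: c_def)
  have "cnj c ^ j * c ^ k = cis (- (real j * (pi / (real k - real j))) + real k * (pi / (real k - real j)))"
    by (simp add: c_def cis_cnj Complex.DeMoivre cis_mult)
  also have "- (real j * (pi / (real k - real j))) + real k * (pi / (real k - real j)) = pi"
  proof -
    have "- (real j * (pi / (real k - real j))) + real k * (pi / (real k - real j)) = (real k - real j) * (pi / (real k - real j))"
      by (simp only: left_diff_distrib)
    then show ?thesis using \<open>j \<noteq> k\<close> by simp
  qed
  finally have c: "cnj c ^ j * c ^ k = -1" by simp
  have "(\<integral>u. cnj u ^ j * u ^ k \<partial>N) = (\<integral>u. cnj u ^ j * u ^ k \<partial>distr N borel ((*) c))"
    using N c1 by (simp add: rotation_invariant_def)
  also have "\<dots> = (\<integral>u. cnj (c * u) ^ j * (c * u) ^ k \<partial>N)"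
    by (subst integral_distr) auto
  also have "\<dots> = (\<integral>u. (cnj c ^ j * c ^ k) * (cnj u ^ j * u ^ k) \<partial>N)"
    by (simp add: power_mult_distrib mult_ac)
  also have "\<dots> = - (\<integral>u. cnj u ^ j * u ^ k \<partial>N)"
    by (simp add: c)
  finally show ?thesis by (simp add: eq_neg_iff_add_eq_0)
qed

text \<open>The terms are dominated by \<open>norm (a k) * r ^ k * norm (g u)\<close>, which is
  summable and integrable together, so sum and integral may be exchanged. Keeping \<open>h\<close>
  general covers series in \<open>u\<close> and in \<open>cnj u\<close>; the radius \<open>r\<close>
  may be 1 when the coefficients decay.\<close>

lemma sums_integral_power_series:
  fixes a :: "nat \<Rightarrow> complex" and h g :: "'a \<Rightarrow> complex"
  assumes [measurable]: "h \<in> borel_measurable N" and g: "integrable N g"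
    and r: "AE u in N. norm (h u) \<le> r" and a: "summable (\<lambda>k. norm (a k) * r ^ k)"
  shows "integrable N (\<lambda>u. (\<Sum>k. a k * h u ^ k) * g u)"
    and "(\<lambda>k. a k * (\<integral>u. h u ^ k * g u \<partial>N)) sums (\<integral>u. (\<Sum>k. a k * h u ^ k) * g u \<partial>N)"
proof -
  have [measurable]: "g \<in> borel_measurable N" using g by auto
  have int: "integrable N (\<lambda>u. h u ^ k * g u)" for k
  proof (rule Bochner_Integration.integrable_bound[OF integrable_mult_right[OF integrable_norm[OF g], of "r ^ k"]])
    show "AE u in N. norm (h u ^ k * g u) \<le> norm (r ^ k * norm (g u))"
      using r by eventually_elim (auto simp: norm_mult norm_power abs_mult power_abs intro!: mult_right_mono power_mono)
  qed measurable
  have int': "integrable N (\<lambda>u. a k * h u ^ k * g u)" for k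
    using integrable_mult_right[OF int, of "a k" k] by (simp add: mult.assoc)
  have s1: "summable (\<lambda>k. norm (a k * h u ^ k))" if "norm (h u) \<le> r" for u
    using that by (intro summable_comparison_test'[OF a, of 0]) (auto simp: norm_mult norm_power intro!: mult_left_mono power_mono)
  have s2: "AE u in N. summable (\<lambda>k. norm (a k * h u ^ k * g u))"
    using r
  proof eventually_elim
    case (elim u)
    then show ?case using summable_mult2[OF s1[OF elim], of "norm (g u)"] by (simp add: norm_mult)
  qed
  have s3: "summable (\<lambda>k. \<integral>u. norm (a k * h u ^ k * g u) \<partial>N)"
  proof (rule summable_comparison_test'[of _ 0])
    show "summable (\<lambda>k. norm (a k) * r ^ k * (\<integral>u. norm (g u) \<partial>N))"
      using a by (rule summable_mult2)
    show "norm (\<integral>u. norm (a k * h u ^ k * g u) \<partial>N) \<le> norm (a k) * r ^ k * (\<integral>u. norm (g u) \<partial>N)" for k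
    proof -
      have "(\<integral>u. norm (a k * h u ^ k * g u) \<partial>N) \<le> (\<integral>u. norm (a k) * r ^ k * norm (g u) \<partial>N)"
      proof (rule integral_mono_AE)
        show "AE u in N. norm (a k * h u ^ k * g u) \<le> norm (a k) * r ^ k * norm (g u)"
          using r by eventually_elim (auto simp: norm_mult norm_power intro!: mult_right_mono mult_left_mono power_mono)
      qed (use int' g in auto)
      then show ?thesis by (simp add: abs_of_nonneg)
    qed
  qed
  have ae: "AE u in N. (\<Sum>k. a k * h u ^ k * g u) = (\<Sum>k. a k * h u ^ k) * g u"
    using r
  proof eventually_elim
    case (elim u)
    show ?case by (rule suminf_mult2[symmetric]) (rule summable_norm_cancel[OF s1[OF elim]])
  qed
  have "integrable N (\<lambda>u. \<Sum>k. a k * h u ^ k * g u)"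
    by (rule integrable_suminf[OF int' s2 s3])
  then show "integrable N (\<lambda>u. (\<Sum>k. a k * h u ^ k) * g u)"
    by (subst (asm) integrable_cong_AE[OF _ _ ae]) auto
  have "(\<lambda>k. \<integral>u. a k * h u ^ k * g u \<partial>N) sums (\<integral>u. (\<Sum>k. a k * h u ^ k * g u) \<partial>N)"
    by (rule sums_integral[OF int' s2 s3])
  also have "(\<integral>u. (\<Sum>k. a k * h u ^ k * g u) \<partial>N) = (\<integral>u. (\<Sum>k. a k * h u ^ k) * g u \<partial>N)"
    by (rule integral_cong_AE[OF _ _ ae]) auto
  also have "(\<lambda>k. \<integral>u. a k * h u ^ k * g u \<partial>N) = (\<lambda>k. a k * (\<integral>u. h u ^ k * g u \<partial>N))"
    by (simp add: mult.assoc)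
  finally show "(\<lambda>k. a k * (\<integral>u. h u ^ k * g u \<partial>N)) sums (\<integral>u. (\<Sum>k. a k * h u ^ k) * g u \<partial>N)" .
qed

text \<open>After termwise integration, orthogonality of the monomials leaves only the term of index
  \<open>j\<close>.\<close>

lemma rotation_invariant_integral_coefficient:
  fixes a :: "nat \<Rightarrow> complex"
  assumes N: "rotation_invariant N" "finite_measure N"
    and r: "AE u in N. norm u \<le> r" and a: "summable (\<lambda>k. norm (a k) * r ^ k)"
  shows "integrable N (\<lambda>u. cnj u ^ j * (\<Sum>k. a k * u ^ k))"
    and "(\<integral>u. cnj u ^ j * (\<Sum>k. a k * u ^ k) \<partial>N) = a j * complex_of_real (\<integral>u. (norm u) ^ (2 * j) \<partial>N)"
proof -
  have sets [measurable_cong]: "sets N = sets borel" using N by (simp add: rotation_invariant_def)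
  interpret finite_measure N by fact
  have int: "integrable N (\<lambda>u. cnj u ^ j)"
  proof (rule integrable_const_bound[where B = "r ^ j"])
    show "AE u in N. norm (cnj u ^ j) \<le> r ^ j"
      using r by eventually_elim (auto simp: norm_power intro: power_mono)
  qed measurable
  have "integrable N (\<lambda>u. (\<Sum>k. a k * u ^ k) * cnj u ^ j)"
    by (rule sums_integral_power_series[OF _ int r a]) measurable
  then show "integrable N (\<lambda>u. cnj u ^ j * (\<Sum>k. a k * u ^ k))" by (simp add: mult_ac)
  have "(\<lambda>k. a k * (\<integral>u. u ^ k * cnj u ^ j \<partial>N)) sums (\<integral>u. (\<Sum>k. a k * u ^ k) * cnj u ^ j \<partial>N)"
    by (rule sums_integral_power_series[OF _ int r a]) measurable
  moreover have "(\<lambda>k. a k * (\<integral>u. u ^ k * cnj u ^ j \<partial>N)) = (\<lambda>k. if k = j then a j * (\<integral>u. u ^ j * cnj u ^ j \<partial>N) else 0)"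
    using rotation_invariant_integral_monomials[OF N(1), of j] by (auto simp: mult_ac)
  moreover have "(\<lambda>k. if k = j then a j * (\<integral>u. u ^ j * cnj u ^ j \<partial>N) else 0) sums (a j * (\<integral>u. u ^ j * cnj u ^ j \<partial>N))"
    by (rule sums_single)
  ultimately have "(\<integral>u. (\<Sum>k. a k * u ^ k) * cnj u ^ j \<partial>N) = a j * (\<integral>u. u ^ j * cnj u ^ j \<partial>N)"
    by (simp only: sums_unique2)
  also have "(\<integral>u. u ^ j * cnj u ^ j \<partial>N) = (\<integral>u. complex_of_real (norm u ^ (2 * j)) \<partial>N)"
  proof (rule Bochner_Integration.integral_cong)
    show "u ^ j * cnj u ^ j = complex_of_real (norm u ^ (2 * j))" for u
      by (simp only: power_mult_distrib[symmetric] complex_norm_square[symmetric] power_mult of_real_power)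
  qed simp
  also have "\<dots> = complex_of_real (\<integral>u. norm u ^ (2 * j) \<partial>N)" by (rule integral_complex_of_real)
  finally show "(\<integral>u. cnj u ^ j * (\<Sum>k. a k * u ^ k) \<partial>N) = a j * complex_of_real (\<integral>u. (norm u) ^ (2 * j) \<partial>N)"
    by (simp add: mult_ac)
qed

text \<open>The squared modulus is written as the conjugate series times the series. Only the
  conjugate series is expanded; each resulting integral is then a coefficient integral of the other
  one.\<close>

lemma rotation_invariant_Parseval:
  fixes a :: "nat \<Rightarrow> complex"
  assumes N: "rotation_invariant N" "finite_measure N"
    and r: "AE u in N. norm u \<le> r" and a: "summable (\<lambda>k. norm (a k) * r ^ k)"
  shows "integrable N (\<lambda>u. (norm (\<Sum>k. a k * u ^ k))\<^sup>2)"
    and "(\<lambda>k. (norm (a k))\<^sup>2 * (\<integral>u. (norm u) ^ (2 * k) \<partial>N)) sums (\<integral>u. (norm (\<Sum>k. a k * u ^ k))\<^sup>2 \<partial>N)"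
proof -
  have sets [measurable_cong]: "sets N = sets borel" using N by (simp add: rotation_invariant_def)
  interpret finite_measure N by fact
  have int: "integrable N (\<lambda>u. \<Sum>k. a k * u ^ k)"
    using rotation_invariant_integral_coefficient(1)[OF N r a, of 0] by simp
  have r': "AE u in N. norm (cnj u) \<le> r" using r by simp
  have a': "summable (\<lambda>k. norm (cnj (a k)) * r ^ k)" using a by simp
  have *: "AE u in N. (\<Sum>k. cnj (a k) * cnj u ^ k) * (\<Sum>k. a k * u ^ k) = complex_of_real ((norm (\<Sum>k. a k * u ^ k))\<^sup>2)"
    using r
  proof eventually_elim
    case (elim u)
    have "summable (\<lambda>k. norm (a k * u ^ k))"
      using elim by (intro summable_comparison_test'[OF a, of 0]) (auto simp: norm_mult norm_power intro!: mult_left_mono power_mono)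
    then have "summable (\<lambda>k. a k * u ^ k)" by (rule summable_norm_cancel)
    then have "(\<lambda>k. a k * u ^ k) sums (\<Sum>k. a k * u ^ k)" by (rule summable_sums)
    then have "(\<lambda>k. cnj (a k * u ^ k)) sums cnj (\<Sum>k. a k * u ^ k)" by (simp only: sums_cnj)
    then have "(\<Sum>k. cnj (a k) * cnj u ^ k) = cnj (\<Sum>k. a k * u ^ k)"
      by (intro sums_unique[symmetric]) simp
    then show ?case by (simp only: complex_norm_square mult.commute)
  qed
  have 1: "integrable N (\<lambda>u. (\<Sum>k. cnj (a k) * cnj u ^ k) * (\<Sum>k. a k * u ^ k))"
    by (rule sums_integral_power_series[OF _ int r' a']) measurable
  then have 2: "integrable N (\<lambda>u. complex_of_real ((norm (\<Sum>k. a k * u ^ k))\<^sup>2))"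
    by (subst (asm) integrable_cong_AE[OF _ _ *]) auto
  then show 3: "integrable N (\<lambda>u. (norm (\<Sum>k. a k * u ^ k))\<^sup>2)"
    using integrable_norm[OF 2] by (simp del: of_real_power)
  have "(\<lambda>k. cnj (a k) * (\<integral>u. cnj u ^ k * (\<Sum>k. a k * u ^ k) \<partial>N)) sums (\<integral>u. (\<Sum>k. cnj (a k) * cnj u ^ k) * (\<Sum>k. a k * u ^ k) \<partial>N)"
    by (rule sums_integral_power_series[OF _ int r' a']) measurable
  also have "(\<lambda>k. cnj (a k) * (\<integral>u. cnj u ^ k * (\<Sum>k. a k * u ^ k) \<partial>N)) = (\<lambda>k. complex_of_real ((norm (a k))\<^sup>2 * (\<integral>u. (norm u) ^ (2 * k) \<partial>N)))"
    unfolding rotation_invariant_integral_coefficient(2)[OF N r a]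
    by (simp add: fun_eq_iff complex_norm_square mult_ac del: of_real_power)
  also have "(\<integral>u. (\<Sum>k. cnj (a k) * cnj u ^ k) * (\<Sum>k. a k * u ^ k) \<partial>N) = (\<integral>u. complex_of_real ((norm (\<Sum>k. a k * u ^ k))\<^sup>2) \<partial>N)"
    by (rule integral_cong_AE[OF _ _ *]) auto
  also have "\<dots> = complex_of_real (\<integral>u. (norm (\<Sum>k. a k * u ^ k))\<^sup>2 \<partial>N)"
    by (rule integral_complex_of_real)
  finally show "(\<lambda>k. (norm (a k))\<^sup>2 * (\<integral>u. (norm u) ^ (2 * k) \<partial>N)) sums (\<integral>u. (norm (\<Sum>k. a k * u ^ k))\<^sup>2 \<partial>N)"
    by (simp only: sums_of_real_iff)
qed

section \<open>The generating function of the Bergman kernel\<close>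

definition kernel_coeff :: "real \<Rightarrow> real \<Rightarrow> nat \<Rightarrow> real" where
  "kernel_coeff \<nu> a j = 1 / (pi * Beta (real j + a) (\<nu> + 1))"

text \<open>Up to a constant this is the Gauss hypergeometric function with upper parameters
  \<open>1\<close> and \<open>a + \<nu> + 1\<close> and lower parameter \<open>a\<close>. For
  \<open>a = 1\<close> it reduces to a multiple of \<open>(1 - x) powr (-(2 + \<nu>))\<close>, the
  kernel of the weighted disc.\<close>

definition kernel_gen :: "real \<Rightarrow> real \<Rightarrow> complex \<Rightarrow> complex" where
  "kernel_gen \<nu> a x = (\<Sum>j. of_real (kernel_coeff \<nu> a j) * x ^ j)"

lemma Beta_real_pos: "x > 0 \<Longrightarrow> y > 0 \<Longrightarrow> Beta x y > (0::real)"
  by (auto simp: Beta_def intro!: divide_pos_pos mult_pos_pos Gamma_real_pos)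

lemma kernel_coeff_pos: "a > 0 \<Longrightarrow> \<nu> > -1 \<Longrightarrow> kernel_coeff \<nu> a j > 0"
  by (auto simp: kernel_coeff_def intro!: divide_pos_pos mult_pos_pos Beta_real_pos)

text \<open>The functional equation of Beta in its first argument. The ratio of consecutive
  coefficients tends to 1, which gives the radius of convergence, and summing the recurrence gives
  the differential equation.\<close>

lemma kernel_coeff_Suc:
  assumes "a > 0" "\<nu> > -1"
  shows "kernel_coeff \<nu> a (Suc j) * (real j + a) = kernel_coeff \<nu> a j * (real j + a + \<nu> + 1)"
proof -
  let ?x = "real j + a"
  have "?x \<notin> \<int>\<^sub>\<le>\<^sub>0" using assms by auto
  from Beta_plus1_left[OF this, of "\<nu> + 1"]
  have *: "(?x + \<nu> + 1) * Beta (?x + 1) (\<nu> + 1) = ?x * Beta ?x (\<nu> + 1)" by (simp add: add_ac)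
  have pos: "Beta ?x (\<nu> + 1) > 0" "Beta (?x + 1) (\<nu> + 1) > 0"
    using assms by (auto intro!: Beta_real_pos)
  have "kernel_coeff \<nu> a (Suc j) * ?x = ?x / (pi * Beta (?x + 1) (\<nu> + 1))"
    by (simp add: kernel_coeff_def add_ac)
  also have "\<dots> = (?x + \<nu> + 1) / (pi * Beta ?x (\<nu> + 1))"
    using pos * by (simp add: frac_eq_eq mult_ac)
  finally show ?thesis by (simp add: kernel_coeff_def)
qed

lemma kernel_coeff_summable:
  assumes "a > 0" "\<nu> > -1" "0 \<le> r" "r < 1"
  shows "summable (\<lambda>j. kernel_coeff \<nu> a j * r ^ j)"
proof -
  have "(\<lambda>n. norm (kernel_coeff \<nu> a n) / norm (kernel_coeff \<nu> a (Suc n))) = (\<lambda>n. (real n + a) / (real n + a + \<nu> + 1))"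
  proof
    fix n
    show "norm (kernel_coeff \<nu> a n) / norm (kernel_coeff \<nu> a (Suc n)) = (real n + a) / (real n + a + \<nu> + 1)"
      using kernel_coeff_Suc[OF assms(1,2), of n] kernel_coeff_pos[OF assms(1,2), of n] kernel_coeff_pos[OF assms(1,2), of "Suc n"] assms
      by (simp add: frac_eq_eq mult_ac)
  qed
  moreover have "(\<lambda>n. (real n + a) / (real n + a + \<nu> + 1)) \<longlonglongrightarrow> 1" by real_asymp
  ultimately have "conv_radius (kernel_coeff \<nu> a) = ereal 1"
    by (intro conv_radius_ratio_limit_nonzero) auto
  then show ?thesis using assms by (intro summable_in_conv_radius) auto
qed

lemma kernel_gen_summable:
  assumes "a > 0" "\<nu> > -1" "norm x < 1"
  shows "summable (\<lambda>j. norm (complex_of_real (kernel_coeff \<nu> a j) * x ^ j))"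
    and "(\<lambda>j. complex_of_real (kernel_coeff \<nu> a j) * x ^ j) sums kernel_gen \<nu> a x"
proof -
  have "(\<lambda>j. norm (complex_of_real (kernel_coeff \<nu> a j) * x ^ j)) = (\<lambda>j. kernel_coeff \<nu> a j * norm x ^ j)"
    using kernel_coeff_pos[OF assms(1,2)] by (simp add: norm_mult norm_power abs_of_pos)
  then show 1: "summable (\<lambda>j. norm (complex_of_real (kernel_coeff \<nu> a j) * x ^ j))"
    using kernel_coeff_summable[OF assms(1,2), of "norm x"] assms(3) by simp
  then show "(\<lambda>j. complex_of_real (kernel_coeff \<nu> a j) * x ^ j) sums kernel_gen \<nu> a x"
    unfolding kernel_gen_def by (intro summable_sums summable_norm_cancel[OF 1])
qed

lemma kernel_gen_cnj:
  assumes "a > 0" "\<nu> > -1" "norm x < 1"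
  shows "kernel_gen \<nu> a (cnj x) = cnj (kernel_gen \<nu> a x)"
proof -
  have "(\<lambda>j. cnj (complex_of_real (kernel_coeff \<nu> a j) * x ^ j)) sums cnj (kernel_gen \<nu> a x)"
    using kernel_gen_summable(2)[OF assms] by (simp only: sums_cnj)
  then have "(\<lambda>j. complex_of_real (kernel_coeff \<nu> a j) * cnj x ^ j) sums cnj (kernel_gen \<nu> a x)"
    by simp
  moreover have "(\<lambda>j. complex_of_real (kernel_coeff \<nu> a j) * cnj x ^ j) sums kernel_gen \<nu> a (cnj x)"
    using assms by (intro kernel_gen_summable(2)) auto
  ultimately show ?thesis by (rule sums_unique2[symmetric])
qed

lemma kernel_gen_deriv:
  assumes "a > 0" "\<nu> > -1" "norm x < 1"
  shows "(kernel_gen \<nu> a has_field_derivative (\<Sum>n. diffs (\<lambda>j. of_real (kernel_coeff \<nu> a j)) n * x ^ n)) (at x)"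
  unfolding kernel_gen_def[abs_def]
  using assms summable_norm_cancel[OF kernel_gen_summable(1)[OF assms(1,2)]]
  by (intro termdiffs_strong'[where K = 1]) auto

lemma kernel_gen_holomorphic:
  assumes "a > 0" "\<nu> > -1"
  shows "kernel_gen \<nu> a holomorphic_on ball 0 1"
  using kernel_gen_deriv[OF assms] by (auto simp: holomorphic_on_open intro!: exI)

text \<open>The coefficient recurrence multiplied by \<open>x ^ Suc j\<close> and summed over
  \<open>j\<close>. The shift of index loses the constant term of the left-hand series, which is why
  \<open>(a - 1) * kernel_coeff \<nu> a 0\<close> is subtracted.\<close>

lemma kernel_gen_ODE:
  assumes "a > 0" "\<nu> > -1" "norm x < 1"
    and G': "(kernel_gen \<nu> a has_field_derivative G') (at x)"
  shows "x * G' + (a - 1) * kernel_gen \<nu> a x - (a - 1) * kernel_coeff \<nu> a 0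
     = x * (x * G' + (a + \<nu> + 1) * kernel_gen \<nu> a x)"
proof -
  define c where "c j = complex_of_real (kernel_coeff \<nu> a j)" for j
  define S where "S = (\<Sum>n. diffs c n * x ^ n)"
  have G: "G' = S"
    unfolding S_def c_def by (rule DERIV_unique[OF G' kernel_gen_deriv[OF assms(1-3)]])
  have sc: "summable (\<lambda>n. c n * y ^ n)" if "norm y < 1" for y
    unfolding c_def using summable_norm_cancel[OF kernel_gen_summable(1)[OF assms(1,2) that]] .
  have "summable (\<lambda>n. diffs c n * x ^ n)"
    using termdiff_converges_all termdiff_converges[of x 1 c] sc assms(3) by auto
  from diffs_equiv[OF this] have s1: "(\<lambda>n. of_nat n * c n * x ^ (n - Suc 0)) sums S"
    unfolding S_def .
  then have "(\<lambda>n. x * (of_nat n * c n * x ^ (n - Suc 0))) sums (x * S)" by (rule sums_mult)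
  moreover have "(\<lambda>n. x * (of_nat n * c n * x ^ (n - Suc 0))) = (\<lambda>n. of_nat n * c n * x ^ n)"
  proof
    show "x * (of_nat n * c n * x ^ (n - Suc 0)) = of_nat n * c n * x ^ n" for n by (cases n) auto
  qed
  ultimately have s2: "(\<lambda>n. of_nat n * c n * x ^ n) sums (x * S)" by simp
  have s3: "(\<lambda>n. c n * x ^ n) sums kernel_gen \<nu> a x"
    unfolding c_def by (rule kernel_gen_summable(2)[OF assms(1-3)])
  have "(\<lambda>n. of_nat n * c n * x ^ n + (a - 1) * (c n * x ^ n)) sums (x * S + (a - 1) * kernel_gen \<nu> a x)"
    by (intro sums_add sums_mult s2 s3)
  then have "(\<lambda>n. of_nat (Suc n) * c (Suc n) * x ^ Suc n + (a - 1) * (c (Suc n) * x ^ Suc n)) sums (x * S + (a - 1) * kernel_gen \<nu> a x - (a - 1) * c 0)"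
    by (subst sums_Suc_iff) simp
  moreover have "(\<lambda>n. x * (of_nat n * c n * x ^ n + (a + \<nu> + 1) * (c n * x ^ n))) sums (x * (x * S + (a + \<nu> + 1) * kernel_gen \<nu> a x))"
    by (intro sums_add sums_mult s2 s3)
  moreover have "of_nat (Suc n) * c (Suc n) * x ^ Suc n + (a - 1) * (c (Suc n) * x ^ Suc n) = x * (of_nat n * c n * x ^ n + (a + \<nu> + 1) * (c n * x ^ n))" for n
  proof -
    have e1: "c (Suc n) * (of_nat n + a) = c n * (of_nat n + a + \<nu> + 1)"
      using arg_cong[OF kernel_coeff_Suc[OF assms(1,2), of n], of complex_of_real] by (simp add: c_def)
    have e2: "of_nat (Suc n) * c (Suc n) * x ^ Suc n + (a - 1) * (c (Suc n) * x ^ Suc n) = (c (Suc n) * (of_nat n + a)) * (x * x ^ n)"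
      by (simp add: algebra_simps)
    have e3: "x * (of_nat n * c n * x ^ n + (a + \<nu> + 1) * (c n * x ^ n)) = (c n * (of_nat n + a + \<nu> + 1)) * (x * x ^ n)"
      by (simp add: algebra_simps)
    show ?thesis unfolding e2 e3 e1 ..
  qed
  ultimately have "x * S + (a - 1) * kernel_gen \<nu> a x - (a - 1) * c 0 = x * (x * S + (a + \<nu> + 1) * kernel_gen \<nu> a x)"
    by (simp add: sums_unique2)
  then show ?thesis by (simp add: G c_def)
qed

lemma one_minus_nonpos_Reals: "norm (x::complex) < 1 \<Longrightarrow> 1 - x \<notin> \<real>\<^sub>\<le>\<^sub>0"
  using complex_Re_le_cmod[of x] by (auto simp: complex_nonpos_Reals_iff)

lemma half_powr: "(1/2::real) powr x = 2 powr (- x)"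
  by (simp add: powr_divide powr_minus_divide)

text \<open>With \<open>H x = (1 - x) powr (2 + \<nu>) * kernel_gen \<nu> a x\<close>, the differential equation reads
  \<open>x H' x + (a - 1) H x = (a - 1) c\<^sub>0 (1 - x) powr (1 + \<nu>)\<close>, so \<open>t powr (a - 1) * H (t \<zeta>)\<close> has
  bounded derivative along each radius.\<close>

lemma kernel_gen_bound:
  assumes a: "0 < a" "a \<le> 1" and nu: "\<nu> > -1"
  shows "\<exists>C>0. \<forall>x. norm x < 1 \<longrightarrow> norm (kernel_gen \<nu> a x) \<le> C * norm (1 - x) powr (- (2 + \<nu>))"
proof -
  define G where "G = kernel_gen \<nu> a"
  define g0 where "g0 = kernel_coeff \<nu> a 0"
  define H where "H x = (1 - x) powr complex_of_real (2 + \<nu>) * G x" for x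
  define A where "A = (\<Sum>j. kernel_coeff \<nu> a j * (1/2) ^ j)"
  \<comment> \<open>A bound for the derivative of the radial function on radii from 1/2 to 1: the
    two powers of 2 bound \<open>t powr (a - 2)\<close> and
    \<open>norm (1 - t * z) powr (1 + \<nu>)\<close>.\<close>
  define M where "M = (1 - a) * g0 * (2 powr (2 - a) * 2 powr (1 + \<nu>))"
  have g0: "g0 > 0" unfolding g0_def by (rule kernel_coeff_pos[OF a(1) nu])
  have M: "M \<ge> 0" unfolding M_def using a g0 by auto
  have le2: "norm (1 - x) \<le> 2" if "norm x < 1" for x :: complex
    using norm_triangle_ineq4[of 1 x] that by simp
  have ne: "1 - x \<noteq> 0" if "norm x < 1" for x :: complex
    using that by auto
  have small: "norm (G x) \<le> A" if "norm x \<le> 1/2" for x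
  proof -
    have x: "norm x < 1" using that by simp
    have "norm (G x) \<le> (\<Sum>j. norm (complex_of_real (kernel_coeff \<nu> a j) * x ^ j))"
      unfolding G_def kernel_gen_def by (rule summable_norm[OF kernel_gen_summable(1)[OF a(1) nu x]])
    also have "\<dots> \<le> A" unfolding A_def
    proof (rule suminf_le)
      show "summable (\<lambda>j. kernel_coeff \<nu> a j * (1/2) ^ j)" by (rule kernel_coeff_summable[OF a(1) nu]) auto
      show "norm (complex_of_real (kernel_coeff \<nu> a j) * x ^ j) \<le> kernel_coeff \<nu> a j * (1/2) ^ j" for j
        using kernel_coeff_pos[OF a(1) nu, of j] power_mono[OF that, of j]
        by (simp add: norm_mult norm_power)
    qed (rule kernel_gen_summable(1)[OF a(1) nu x])
    finally show ?thesis .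
  qed
  have A: "A \<ge> 0" using order_trans[OF norm_ge_zero small[of 0]] by simp
  \<comment> \<open>The first summand bounds the radial function at radius 1/2; along the rest of
    the radius, of length below 1, the function moves by at most \<open>M\<close>.\<close>
  define B where "B = 2 powr (1 - a) * (2 powr (2 + \<nu>) * A) + M"
  have B: "B \<ge> 2 powr (2 + \<nu>) * A"
  proof -
    have "1 * (2 powr (2 + \<nu>) * A) \<le> 2 powr (1 - a) * (2 powr (2 + \<nu>) * A)"
      using a A by (intro mult_right_mono) (auto simp: ge_one_powr_ge_zero)
    then show ?thesis unfolding B_def using M by linarith
  qed
  have normH: "norm (H x) = norm (1 - x) powr (2 + \<nu>) * norm (G x)" for x
    by (simp add: H_def norm_mult norm_powr_real_powr')
  have Hsmall: "norm (H x) \<le> 2 powr (2 + \<nu>) * A" if "norm x \<le> 1/2" for x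
    unfolding normH using small[OF that] le2[of x] that nu A by (intro mult_mono powr_mono2) auto
  have large: "norm (H x) \<le> B" if x: "1/2 < norm x" "norm x < 1" for x
  proof -
    define t1 where "t1 = norm x"
    define z where "z = x / t1"
    have t1: "1/2 < t1" "t1 < 1" using x by (auto simp: t1_def)
    have z: "norm z = 1" using x by (auto simp: z_def t1_def norm_divide)
    have xz: "x = of_real t1 * z" using t1 by (simp add: z_def)
    define h where "h t = complex_of_real (t powr (a - 1)) * H (of_real t * z)" for t :: real
    define h' where "h' t = complex_of_real (t powr (a - 2)) * ((a - 1) * g0 * (1 - of_real t * z) powr complex_of_real (1 + \<nu>))" for t :: real
    have deriv: "(h has_vector_derivative h' t) (at t within {1/2..t1})" if "t \<in> {1/2..t1}" for t
    proof -
      have t: "0 < t" "t < 1" using that t1 by auto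
      define y where "y = of_real t * z"
      have y: "norm y < 1" using t z by (simp add: y_def norm_mult)
      obtain G' where G': "(G has_field_derivative G') (at y)"
        using kernel_gen_deriv[OF a(1) nu y] unfolding G_def by blast
      note ode = kernel_gen_ODE[OF a(1) nu y G'[unfolded G_def]]
      define H' where "H' = (1 - y) powr complex_of_real (2 + \<nu>) * G' - (2 + \<nu>) * (1 - y) powr complex_of_real (1 + \<nu>) * G y"
      have e: "complex_of_real (2 + \<nu>) - 1 = complex_of_real (1 + \<nu>)" by simp
      have dH: "(H has_field_derivative H') (at y)"
        unfolding H_def[abs_def] H'_def
        using one_minus_nonpos_Reals[OF y]
        by (auto intro!: derivative_eq_intros G' simp: e simp del: of_real_add)
      have key: "(a - 1) * H y + y * H' = (a - 1) * g0 * (1 - y) powr complex_of_real (1 + \<nu>)"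
      proof -
        have p: "(1 - y) powr complex_of_real (2 + \<nu>) = (1 - y) powr complex_of_real (1 + \<nu>) * (1 - y)"
          using ne[OF y] powr_add[of "1 - y" "complex_of_real (1 + \<nu>)" 1] by (simp add: add_ac)
        have "(a - 1) * H y + y * H' = (1 - y) powr complex_of_real (1 + \<nu>) *
            ((y * G' + (a - 1) * G y) - y * (y * G' + (a + \<nu> + 1) * G y))"
          unfolding H_def H'_def p by (simp add: algebra_simps)
        also have "(y * G' + (a - 1) * G y) - y * (y * G' + (a + \<nu> + 1) * G y) = (a - 1) * g0"
          using ode by (simp add: G_def g0_def algebra_simps)
        finally show ?thesis by (simp add: mult_ac)
      qed
      have d1: "((\<lambda>t. complex_of_real (t powr (a - 1))) has_vector_derivative of_real ((a - 1) * t powr (a - 2))) (at t within {1/2..t1})"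
      proof -
        have "((\<lambda>t. t powr (a - 1)) has_real_derivative (a - 1) * t powr (a - 1 - 1)) (at t within {1/2..t1})"
          using t by (intro has_real_derivative_powr has_field_derivative_at_within)
        then show ?thesis by (intro has_vector_derivative_of_real) (simp add: has_real_derivative_iff_has_vector_derivative)
      qed
      have d2: "((\<lambda>t. H (of_real t * z)) has_vector_derivative z * H') (at t within {1/2..t1})"
      proof -
        have "((\<lambda>t. of_real t * z) has_vector_derivative z) (at t within {1/2..t1})"
          by (auto intro!: derivative_eq_intros)
        from field_vector_diff_chain_within[OF this, of H H'] dH
        show ?thesis unfolding o_def y_def by (simp add: has_field_derivative_at_within)
      qed
      have "(h has_vector_derivative (complex_of_real (t powr (a - 1)) * (z * H') + of_real ((a - 1) * t powr (a - 2)) * H y)) (at t within {1/2..t1})"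
        unfolding h_def y_def by (rule has_vector_derivative_mult[OF d1 d2])
      also have "t powr (a - 1) = t * t powr (a - 2)"
        using t powr_add[of t 1 "a - 2"] by simp
      also have "complex_of_real (t * t powr (a - 2)) * (z * H') + of_real ((a - 1) * t powr (a - 2)) * H y
          = of_real (t powr (a - 2)) * ((a - 1) * H y + y * H')"
        by (simp add: y_def algebra_simps)
      also have "\<dots> = h' t" unfolding key unfolding h'_def y_def by simp
      finally show ?thesis .
    qed
    have bnd: "norm (h' t) \<le> M" if "t \<in> {1/2..t1}" for t
    proof -
      have t: "1/2 \<le> t" "t < 1" using that t1 by auto
      have y: "norm (of_real t * z) < 1" using t z by (simp add: norm_mult)
      have "t powr (a - 2) \<le> (1/2) powr (a - 2)" using t a by (intro powr_mono2') auto
      also have "(1/2::real) powr (a - 2) = 2 powr (2 - a)"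
        by (simp add: half_powr)
      finally have 1: "t powr (a - 2) \<le> 2 powr (2 - a)" .
      have 2: "norm (1 - of_real t * z) powr (1 + \<nu>) \<le> 2 powr (1 + \<nu>)"
        using le2[OF y] nu by (intro powr_mono2) auto
      have "norm (h' t) = t powr (a - 2) * ((1 - a) * g0 * norm (1 - of_real t * z) powr (1 + \<nu>))"
        unfolding h'_def using a g0 norm_of_real[of "a - 1", where 'a = complex]
        by (simp add: norm_mult norm_powr_real_powr' abs_mult)
      also have "\<dots> = (1 - a) * g0 * (t powr (a - 2) * norm (1 - of_real t * z) powr (1 + \<nu>))" by (simp add: mult_ac)
      also have "\<dots> \<le> M" unfolding M_def using a g0 1 2 by (intro mult_left_mono mult_mono) auto
      finally show ?thesis .
    qed
    have "norm (h t1 - h (1/2)) \<le> M * norm (t1 - 1/2)"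
    proof (rule differentiable_bound[of "{1/2..t1}"])
      show "(h has_derivative (\<lambda>s. s *\<^sub>R h' t)) (at t within {1/2..t1})" if "t \<in> {1/2..t1}" for t
        using deriv[OF that] by (simp add: has_vector_derivative_def)
      show "onorm (\<lambda>s. s *\<^sub>R h' t) \<le> M" if "t \<in> {1/2..t1}" for t
        using bnd[OF that] M by (intro onorm_bound) (auto simp: mult.commute[of _ M] mult.commute[of _ "norm (h' _)"] intro: mult_right_mono)
    qed (use t1 in auto)
    also have "\<dots> \<le> M" using M t1 by (simp add: mult_left_le)
    finally have "norm (h t1) \<le> norm (h (1/2)) + M"
      using norm_triangle_ineq2[of "h t1" "h (1/2)"] by simp
    also have "norm (h (1/2)) \<le> 2 powr (1 - a) * (2 powr (2 + \<nu>) * A)"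
    proof -
      have "(1/2::real) powr (a - 1) = 2 powr (1 - a)"
        by (simp add: half_powr)
      then have "norm (h (1/2)) = 2 powr (1 - a) * norm (H (of_real (1/2) * z))"
        by (simp add: h_def norm_mult)
      also have "\<dots> \<le> 2 powr (1 - a) * (2 powr (2 + \<nu>) * A)"
        using z by (intro mult_left_mono Hsmall) (simp_all add: norm_mult)
      finally show ?thesis .
    qed
    finally have 1: "norm (h t1) \<le> B" by (simp add: B_def)
    \<comment> \<open>Since \<open>a \<le> 1\<close> and \<open>t1 < 1\<close>, the integrating
      factor is at least 1, so the bound on \<open>h\<close> passes to \<open>H\<close>.\<close>
    have "1 * norm (H x) \<le> t1 powr (a - 1) * norm (H x)"
    proof (rule mult_right_mono)
      have "t1 powr 0 \<le> t1 powr (a - 1)" using t1 a by (intro powr_mono') auto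
      then show "1 \<le> t1 powr (a - 1)" using t1 by simp
    qed simp
    also have "\<dots> = norm (h t1)" by (simp add: h_def norm_mult xz)
    finally show ?thesis using 1 by simp
  qed
  have all: "norm (H x) \<le> B" if "norm x < 1" for x
    using Hsmall[of x] large[of x] B that by (cases "norm x \<le> 1/2") auto
  \<comment> \<open>The added 1 makes the constant strictly positive, as the statement
    demands.\<close>
  have "norm (G x) \<le> (B + 1) * norm (1 - x) powr (- (2 + \<nu>))" if "norm x < 1" for x
  proof -
    have p: "norm (1 - x) powr (2 + \<nu>) > 0" using ne[OF that] by simp
    have "norm (G x) = norm (H x) * norm (1 - x) powr (- (2 + \<nu>))"
      unfolding normH powr_minus using p by (simp add: field_simps)
    also have "\<dots> \<le> (B + 1) * norm (1 - x) powr (- (2 + \<nu>))"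
      using all[OF that] by (intro mult_right_mono) auto
    finally show ?thesis .
  qed
  moreover have "B + 1 > 0" using order_trans[OF norm_ge_zero all[of 0]] by simp
  ultimately show ?thesis unfolding G_def by blast
qed

section \<open>Integral estimates on the disc\<close>

lemma nn_integral_disc_measure_powr:
  "(\<integral>\<^sup>+u. ennreal (norm u powr c * (1 - (norm u)\<^sup>2) powr d) \<partial>disc_measure b \<nu>)
    = (\<integral>\<^sup>+u. ennreal (disc_weight (b + c) (\<nu> + d) u) \<partial>lborel)"
  by (subst nn_integral_disc_measure)
    (auto intro!: nn_integral_cong simp: disc_weight_def powr_add ennreal_mult[symmetric] mult_ac)

text \<open>The moments are the reciprocals of \<open>kernel_coeff\<close> at
  \<open>a = b / 2 + 1\<close>; this cancellation is the reproducing property, coefficient by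
  coefficient.\<close>

lemma disc_measure_moment:
  assumes "b > -2" "\<nu> > -1"
  shows "(\<integral>u. norm u ^ (2 * k) \<partial>disc_measure b \<nu>) = pi * Beta (real k + (b / 2 + 1)) (\<nu> + 1)"
proof -
  have "(\<integral>\<^sup>+u. ennreal (norm u ^ (2 * k)) \<partial>disc_measure b \<nu>)
      = (\<integral>\<^sup>+u. ennreal (norm u powr (2 * real k) * (1 - (norm u)\<^sup>2) powr 0) \<partial>disc_measure b \<nu>)"
  proof (rule nn_integral_cong_AE, rule AE_mp[OF AE_disc_measure], intro AE_I2 impI)
    fix u :: complex assume u: "u \<noteq> 0 \<and> norm u < 1"
    then have "(norm u)\<^sup>2 < 1" by (simp add: abs_square_less_1)
    then show "ennreal (norm u ^ (2 * k)) = ennreal (norm u powr (2 * real k) * (1 - (norm u)\<^sup>2) powr 0)"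
      using u powr_realpow[of "norm u" "2 * k"] by simp
  qed
  also have "\<dots> = ennreal (pi * Beta ((b + 2 * real k) / 2 + 1) (\<nu> + 0 + 1))"
    unfolding nn_integral_disc_measure_powr using assms by (intro nn_integral_disc_weight) auto
  also have "(b + 2 * real k) / 2 + 1 = real k + (b / 2 + 1)" by (simp add: field_simps)
  finally have "(\<integral>\<^sup>+u. ennreal (norm u ^ (2 * k)) \<partial>disc_measure b \<nu>) = ennreal (pi * Beta (real k + (b / 2 + 1)) (\<nu> + 1))"
    by simp
  moreover have "pi * Beta (real k + (b / 2 + 1)) (\<nu> + 1) \<ge> 0"
    using assms by (intro mult_nonneg_nonneg less_imp_le[OF Beta_real_pos]) auto
  ultimately show ?thesis by (subst integral_eq_nn_integral) auto
qed

lemma rotation_invariant_disc_measure: "rotation_invariant (disc_measure b \<nu>)"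
  unfolding disc_measure_def
  by (rule rotation_invariant_density) (auto simp: disc_weight_def norm_mult)

text \<open>By Euler's limit formula for Gamma, \<open>pochhammer x n\<close> grows like
  \<open>fact (n - 1) * n powr x / Gamma x\<close>. The condition \<open>y + z = 2 * x\<close>
  cancels the powers of \<open>n\<close> in the quotient, which therefore converges and is
  bounded.\<close>

lemma pochhammer_square_le:
  fixes x y z :: real
  assumes "x > 0" "y > 0" "z > 0" and xyz: "y + z = 2 * x"
  shows "\<exists>C>0. \<forall>k. (pochhammer x k)\<^sup>2 \<le> C * (pochhammer y k * pochhammer z k)"
proof -
  define R where "R k = (pochhammer x k)\<^sup>2 / (pochhammer y k * pochhammer z k)" for k
  have pos: "pochhammer x k > 0" "pochhammer y k > 0" "pochhammer z k > 0" for k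
    using assms by (auto intro: pochhammer_pos)
  have nz: "x \<notin> \<int>\<^sub>\<le>\<^sub>0" "y \<notin> \<int>\<^sub>\<le>\<^sub>0" "z \<notin> \<int>\<^sub>\<le>\<^sub>0" using assms by auto
  have "(\<lambda>n. Gamma_series' y n * Gamma_series' z n / (Gamma_series' x n)\<^sup>2) \<longlonglongrightarrow> Gamma y * Gamma z / (Gamma x)\<^sup>2"
    using nz by (intro tendsto_intros Gamma_series'_LIMSEQ) (auto simp: Gamma_eq_zero_iff)
  moreover have "eventually (\<lambda>n. Gamma_series' y n * Gamma_series' z n / (Gamma_series' x n)\<^sup>2 = R n) sequentially"
    using eventually_gt_at_top[of 0]
  proof eventually_elim
    case (elim n)
    have e: "exp (y * ln (real n)) * exp (z * ln (real n)) = (exp (x * ln (real n)))\<^sup>2"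
      by (simp add: power2_eq_square exp_add[symmetric] ring_distribs[symmetric] xyz)
    define E where "E = exp (x * ln (real n))"
    define f where "f = (fact (n - 1) :: real)"
    have E: "E > 0" "f > 0" by (auto simp: E_def f_def)
    have "Gamma_series' y n * Gamma_series' z n / (Gamma_series' x n)\<^sup>2
        = (f\<^sup>2 * (exp (y * ln (real n)) * exp (z * ln (real n))) / (pochhammer y n * pochhammer z n)) / (f * E / pochhammer x n)\<^sup>2"
      by (simp add: Gamma_series'_def E_def f_def power2_eq_square mult_ac)
    also have "\<dots> = R n"
      unfolding e E_def[symmetric] R_def using E pos[of n] by (simp add: power_divide power_mult_distrib field_simps)
    finally show ?case .
  qed
  ultimately have "R \<longlonglongrightarrow> Gamma y * Gamma z / (Gamma x)\<^sup>2"
    by (rule Lim_transform_eventually)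
  then have "Bseq R" by (intro convergent_imp_Bseq convergentI)
  then obtain C where C: "C > 0" "\<And>n. norm (R n) \<le> C" by (auto simp: Bseq_def)
  have "(pochhammer x k)\<^sup>2 \<le> C * (pochhammer y k * pochhammer z k)" for k
  proof -
    have "R k \<le> C" using C(2)[of k] by simp
    then show ?thesis using pos[of k] by (simp add: R_def divide_le_eq)
  qed
  with C show ?thesis by blast
qed

text \<open>The integrand is \<open>\<bar>(1 - x) powr (-c/2)\<bar>\<^sup>2\<close> with \<open>c = 2 + t + e\<close>, so Parseval turns the integral into a
  power series in \<open>\<bar>w\<bar>\<^sup>2\<close> whose coefficients are comparable to those of \<open>(1 - x) powr (-e)\<close>.\<close>

lemma Forelli_Rudin:
  assumes t: "t > -1" and e: "e > 0"
  shows "\<exists>C>0. \<forall>w. norm w < 1 \<longrightarrow>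
    (\<integral>\<^sup>+u. ennreal (norm (1 - w * cnj u) powr (- (2 + t + e))) \<partial>disc_measure 0 t)
      \<le> ennreal (C * (1 - (norm w)\<^sup>2) powr (- e))"
proof -
  define \<beta> where "\<beta> = (2 + t + e) / 2"
  have \<beta>: "\<beta> > 0" using assms by (simp add: \<beta>_def)
  define d where "d k = pochhammer \<beta> k / fact k" for k
  have dpos: "d k > 0" for k unfolding d_def using \<beta> by (auto intro: pochhammer_pos divide_pos_pos)
  \<comment> \<open>The squared binomial coefficient is
    \<open>(pochhammer \<beta> k / fact k)\<^sup>2\<close>, and the moment contributes
    \<open>fact k / pochhammer (t + 2) k\<close> up to a constant. The inequality turns their
    product into the binomial coefficient of exponent \<open>- e\<close>.\<close>
  obtain C where C: "C > 0" "\<And>k. (pochhammer \<beta> k)\<^sup>2 \<le> C * (pochhammer (t + 2) k * pochhammer e k)"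
    using pochhammer_square_le[of \<beta> "t + 2" e] assms \<beta> by (auto simp: \<beta>_def)
  define D where "D = C * pi * (Gamma (t + 1) / Gamma (t + 2))"
  have G: "Gamma (t + 1) > 0" "Gamma (t + 2) > 0" using t by (auto intro: Gamma_real_pos)
  have D: "D > 0" unfolding D_def using C G by auto
  interpret finite_measure "disc_measure 0 t" using t by (intro finite_disc_measure) auto
  have "(\<integral>\<^sup>+u. ennreal (norm (1 - w * cnj u) powr (- (2 + t + e))) \<partial>disc_measure 0 t)
      \<le> ennreal (D * (1 - (norm w)\<^sup>2) powr (- e))" if w: "norm w < 1" for w
  proof -
    have ds: "(\<lambda>k. d k * norm w ^ k) sums (1 - norm w) powr (- \<beta>)"
    proof -
      have "(\<lambda>k. (- \<beta> gchoose k) * (- norm w) ^ k) sums (1 + - norm w) powr (- \<beta>)"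
        using w by (intro gen_binomial_real) auto
      moreover have "(- \<beta> gchoose k) * (- norm w) ^ k = d k * norm w ^ k" for k
        by (simp add: gbinomial_pochhammer d_def power_minus[of "norm w"])
      ultimately show ?thesis by simp
    qed
    define c where "c k = complex_of_real (d k) * cnj w ^ k" for k
    have cn: "norm (c k) = d k * norm w ^ k" for k
      using dpos[of k] by (simp add: c_def norm_mult norm_power)
    \<comment> \<open>The powers of \<open>w\<close> inside \<open>c\<close> give convergence on the
      closed disc, so Parseval applies with radius 1.\<close>
    have sc: "summable (\<lambda>k. norm (c k) * 1 ^ k)" using ds by (simp add: cn sums_iff)
    have eq: "norm (1 - w * cnj u) powr (- (2 + t + e)) = (norm (\<Sum>k. c k * u ^ k))\<^sup>2" if "norm u < 1" for u
    proof -
      have lt: "norm (cnj w * u) < 1" using w that mult_strict_mono'[of "norm w" 1 "norm u" 1] by (simp add: norm_mult)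
      have "(\<lambda>k. (of_real (- \<beta>) gchoose k) * (- (cnj w * u)) ^ k) sums (1 + - (cnj w * u)) powr (of_real (- \<beta>))"
        using lt by (intro gen_binomial_complex) auto
      moreover have "(of_real (- \<beta>) gchoose k) * (- (cnj w * u)) ^ k = c k * u ^ k" for k
      proof -
        have "(of_real (- \<beta>) gchoose k :: complex) = (-1) ^ k * of_real (pochhammer \<beta> k) / fact k"
          by (simp add: gbinomial_pochhammer pochhammer_of_real)
        moreover have "(- (cnj w * u)) ^ k = (-1) ^ k * (cnj w ^ k * u ^ k)"
          by (subst power_minus) (simp only: power_mult_distrib)
        moreover have "(-1) ^ k * (-1) ^ k = (1::complex)"
          by (simp flip: power_mult_distrib)
        ultimately show ?thesis by (simp add: c_def d_def)
      qed
      ultimately have "(\<Sum>k. c k * u ^ k) = (1 - cnj w * u) powr of_real (- \<beta>)" by (simp add: sums_iff)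
      then have "norm (\<Sum>k. c k * u ^ k) = norm (1 - cnj w * u) powr (- \<beta>)" by (simp add: norm_powr_real_powr')
      also have "norm (1 - cnj w * u) = norm (1 - w * cnj u)"
        by (metis complex_cnj_cnj complex_cnj_diff complex_cnj_mult complex_cnj_one complex_mod_cnj)
      finally have "(norm (\<Sum>k. c k * u ^ k))\<^sup>2 = (norm (1 - w * cnj u) powr (- \<beta>))\<^sup>2" by simp
      also have "\<dots> = norm (1 - w * cnj u) powr (- (2 + t + e))"
        by (simp add: power2_eq_square powr_add[symmetric] \<beta>_def)
      finally show ?thesis ..
    qed
    have r: "AE u in disc_measure 0 t. norm u \<le> 1"
      using AE_disc_measure by eventually_elim auto
    note P = rotation_invariant_Parseval[OF rotation_invariant_disc_measure finite_measure_axioms r sc]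
    have "(\<integral>\<^sup>+u. ennreal (norm (1 - w * cnj u) powr (- (2 + t + e))) \<partial>disc_measure 0 t)
       = (\<integral>\<^sup>+u. ennreal ((norm (\<Sum>k. c k * u ^ k))\<^sup>2) \<partial>disc_measure 0 t)"
      by (rule nn_integral_cong_AE, rule AE_mp[OF AE_disc_measure]) (rule AE_I2, intro impI, elim conjE, simp only: eq)
    also have "\<dots> = ennreal (\<integral>u. (norm (\<Sum>k. c k * u ^ k))\<^sup>2 \<partial>disc_measure 0 t)"
      by (rule nn_integral_eq_integral[OF P(1)]) auto
    also have "(\<integral>u. (norm (\<Sum>k. c k * u ^ k))\<^sup>2 \<partial>disc_measure 0 t) \<le> D * (1 - (norm w)\<^sup>2) powr (- e)"
    proof (rule sums_le[OF _ P(2)])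
      have "(\<lambda>k. (- e gchoose k) * (- (norm w)\<^sup>2) ^ k) sums (1 + - (norm w)\<^sup>2) powr (- e)"
        using w by (intro gen_binomial_real) (auto simp: abs_square_less_1)
      moreover have "(- e gchoose k) * (- (norm w)\<^sup>2) ^ k = pochhammer e k / fact k * norm w ^ (2 * k)" for k
        by (simp add: gbinomial_pochhammer power_minus[of "(norm w)\<^sup>2"] power_mult)
      ultimately show "(\<lambda>k. D * (pochhammer e k / fact k * norm w ^ (2 * k))) sums (D * (1 - (norm w)\<^sup>2) powr (- e))"
        by (intro sums_mult) simp
      fix k
      have "Beta (real k + 1) (t + 1) = Gamma (real k + 1) * Gamma (t + 1) / Gamma (t + 2 + real k)"
        by (simp add: Beta_def add_ac)
      also have "Gamma (real k + 1) = fact k" by (simp add: Gamma_fact add_ac)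
      also have "Gamma (t + 2 + real k) = pochhammer (t + 2) k * Gamma (t + 2)"
      proof -
        have "t + 2 \<notin> \<int>\<^sub>\<le>\<^sub>0" using t nonpos_Ints_nonpos[of "t + 2"] by fastforce
        then show ?thesis using G pochhammer_Gamma[of "t + 2" k] by simp
      qed
      finally have B: "Beta (real k + 1) (t + 1) = fact k * (Gamma (t + 1) / Gamma (t + 2)) / pochhammer (t + 2) k"
        by simp
      have p: "pochhammer (t + 2) k > 0" using t by (intro pochhammer_pos) auto
      have m: "(\<integral>u. norm u ^ (2 * k) \<partial>disc_measure 0 t) = pi * Beta (real k + 1) (t + 1)"
        using disc_measure_moment[of 0 t k] t by simp
      have "(norm (c k))\<^sup>2 * (\<integral>u. norm u ^ (2 * k) \<partial>disc_measure 0 t)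
         = (pochhammer \<beta> k)\<^sup>2 * (norm w ^ (2 * k) * (pi * (Gamma (t + 1) / Gamma (t + 2))) / (fact k * pochhammer (t + 2) k))"
        unfolding m B cn d_def by (simp add: power_mult_distrib power_divide power2_eq_square power_mult field_simps)
      also have "\<dots> \<le> (C * (pochhammer (t + 2) k * pochhammer e k)) * (norm w ^ (2 * k) * (pi * (Gamma (t + 1) / Gamma (t + 2))) / (fact k * pochhammer (t + 2) k))"
        using C p G by (intro mult_right_mono) auto
      also have "\<dots> = D * (pochhammer e k / fact k * norm w ^ (2 * k))"
        using p by (simp add: D_def field_simps)
      finally show "(norm (c k))\<^sup>2 * (\<integral>u. norm u ^ (2 * k) \<partial>disc_measure 0 t) \<le> D * (pochhammer e k / fact k * norm w ^ (2 * k))" .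
    qed
    finally show ?thesis by (simp add: ennreal_leI)
  qed
  with D show ?thesis by blast
qed

text \<open>The factor \<open>norm u powr g\<close> matters only near the origin. Where
  \<open>norm u\<close> is at least 1/2 it is at most \<open>A\<close>, and the estimate without it
  applies. Where \<open>norm u\<close> is smaller, the kernel power is at most \<open>B\<close>, and
  the remaining integral of the weight is the constant \<open>I\<close>, absorbed because
  \<open>(1 - (norm w)\<^sup>2) powr (- e)\<close> is at least 1.\<close>

lemma Forelli_Rudin_punctured:
  assumes t: "t > -1" and e: "e > 0" and g: "g > -2"
  shows "\<exists>C>0. \<forall>w. norm w < 1 \<longrightarrow>
    (\<integral>\<^sup>+u. ennreal (norm (1 - w * cnj u) powr (- (2 + t + e))) \<partial>disc_measure g t)
      \<le> ennreal (C * (1 - (norm w)\<^sup>2) powr (- e))"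
proof -
  obtain C where C: "C > 0" "\<And>w. norm w < 1 \<Longrightarrow>
    (\<integral>\<^sup>+u. ennreal (norm (1 - w * cnj u) powr (- (2 + t + e))) \<partial>disc_measure 0 t)
      \<le> ennreal (C * (1 - (norm w)\<^sup>2) powr (- e))"
    using Forelli_Rudin[OF t e] by blast
  define k where "k = 2 + t + e"
  define I where "I = pi * Beta (g / 2 + 1) (t + 1)"
  have I: "I > 0" unfolding I_def using t g by (auto intro!: mult_pos_pos Beta_real_pos)
  define A where "A = (2::real) powr \<bar>g\<bar>"
  define B where "B = (2::real) powr k"
  have AB: "A > 0" "B > 0" by (auto simp: A_def B_def)
  have "(\<integral>\<^sup>+u. ennreal (norm (1 - w * cnj u) powr (- k)) \<partial>disc_measure g t)
      \<le> ennreal ((A * C + B * I) * (1 - (norm w)\<^sup>2) powr (- e))" if w: "norm w < 1" for w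
  proof -
    let ?f = "\<lambda>u. norm (1 - w * cnj u) powr (- k)"
    have "disc_weight g t u * ?f u \<le> A * (disc_weight 0 t u * ?f u) + B * disc_weight g t u" for u
    proof (cases "u \<noteq> 0 \<and> norm u < 1")
      case False
      then show ?thesis by (auto simp: disc_weight_def)
    next
      case True
      show ?thesis
      proof (cases "norm u \<ge> 1/2")
        case True
        have "norm u powr g \<le> A"
        proof -
          have "norm u powr g \<le> norm u powr (- \<bar>g\<bar>)" using True \<open>u \<noteq> 0 \<and> norm u < 1\<close> by (intro powr_mono') auto
          also have "\<dots> \<le> (1/2) powr (- \<bar>g\<bar>)" using True by (intro powr_mono2') auto
          finally show ?thesis by (simp add: half_powr A_def)
        qed
        then have "disc_weight g t u \<le> A * disc_weight 0 t u"
          using True \<open>u \<noteq> 0 \<and> norm u < 1\<close> by (auto simp: disc_weight_def intro!: mult_right_mono)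
        then have "disc_weight g t u * ?f u \<le> A * disc_weight 0 t u * ?f u"
          by (rule mult_right_mono) simp
        then show ?thesis using AB by (simp add: mult.assoc add_increasing2)
      next
        case False
        have "norm (w * cnj u) \<le> 1/2" using False w mult_mono[of "norm w" 1 "norm u" "1/2"] by (simp add: norm_mult)
        then have "norm (1 - w * cnj u) \<ge> 1/2"
          using norm_triangle_ineq2[of 1 "w * cnj u"] by simp
        then have "?f u \<le> (1/2) powr (- k)" using t e by (intro powr_mono2') (auto simp: k_def)
        then have "?f u \<le> B" by (simp add: half_powr B_def)
        then have "disc_weight g t u * ?f u \<le> B * disc_weight g t u"
          by (simp add: mult.commute[of B] mult_left_mono)
        then show ?thesis using AB by (simp add: add_increasing)
      qed
    qed
    then have "(\<integral>\<^sup>+u. ennreal (disc_weight g t u * ?f u) \<partial>lborel)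
      \<le> (\<integral>\<^sup>+u. ennreal A * ennreal (disc_weight 0 t u * ?f u) + ennreal B * ennreal (disc_weight g t u) \<partial>lborel)"
      using AB by (intro nn_integral_mono) (simp add: ennreal_mult[symmetric] ennreal_plus[symmetric] del: ennreal_plus)
    also have "\<dots> = ennreal A * (\<integral>\<^sup>+u. ennreal (disc_weight 0 t u * ?f u) \<partial>lborel) + ennreal B * (\<integral>\<^sup>+u. ennreal (disc_weight g t u) \<partial>lborel)"
      by (subst nn_integral_add) (auto simp: nn_integral_cmult)
    also have "\<dots> \<le> ennreal A * ennreal (C * (1 - (norm w)\<^sup>2) powr (- e)) + ennreal B * ennreal I"
    proof (intro add_mono mult_left_mono)
      show "(\<integral>\<^sup>+u. ennreal (disc_weight 0 t u * ?f u) \<partial>lborel) \<le> ennreal (C * (1 - (norm w)\<^sup>2) powr (- e))"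
        using C(2)[OF w] by (simp add: nn_integral_disc_measure ennreal_mult k_def)
      show "(\<integral>\<^sup>+u. ennreal (disc_weight g t u) \<partial>lborel) \<le> ennreal I"
        using nn_integral_disc_weight[OF g t] by (simp add: I_def)
    qed auto
    also have "\<dots> = ennreal (A * C * (1 - (norm w)\<^sup>2) powr (- e) + B * I)"
      using AB C I by (simp add: ennreal_mult[symmetric] ennreal_plus[symmetric] mult.assoc del: ennreal_plus)
    also have "\<dots> \<le> ennreal ((A * C + B * I) * (1 - (norm w)\<^sup>2) powr (- e))"
    proof (rule ennreal_leI)
      have w2: "(norm w)\<^sup>2 < 1" using w by (simp add: abs_square_less_1)
      have "1 powr (- e) \<le> (1 - (norm w)\<^sup>2) powr (- e)" using w2 e by (intro powr_mono2') auto
      then have "B * I * 1 \<le> B * I * (1 - (norm w)\<^sup>2) powr (- e)"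
        using AB I by (intro mult_left_mono) auto
      then show "A * C * (1 - (norm w)\<^sup>2) powr (- e) + B * I \<le> (A * C + B * I) * (1 - (norm w)\<^sup>2) powr (- e)"
        by (simp add: algebra_simps)
    qed
    finally show ?thesis by (simp add: nn_integral_disc_measure ennreal_mult)
  qed
  moreover have "A * C + B * I > 0" using AB C I by (simp add: add_pos_pos)
  ultimately show ?thesis unfolding k_def by blast
qed

text \<open>The Bergman kernel of the punctured disc for the measure \<open>disc_measure b \<nu>\<close>, where \<open>1 / w ^ s\<close> is the
  most singular square integrable power and \<open>a = 1 + b / 2 - s\<close>: the squared norm of \<open>w ^ (j - s)\<close> is
  \<open>\<pi> Beta (j + a) (\<nu> + 1)\<close>.\<close>

definition disc_kernel :: "real \<Rightarrow> real \<Rightarrow> nat \<Rightarrow> complex \<Rightarrow> complex \<Rightarrow> complex" where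
  "disc_kernel \<nu> a s w u = kernel_gen \<nu> a (w * cnj u) / (w * cnj u) ^ s"

lemma norm_mult_less_1: "norm w < 1 \<Longrightarrow> norm u < 1 \<Longrightarrow> norm (w * cnj u) < 1"
  using mult_strict_mono'[of "norm w" 1 "norm u" 1] by (simp add: norm_mult)

lemma disc_kernel_cnj:
  assumes "a > 0" "\<nu> > -1" "norm w < 1" "norm u < 1"
  shows "disc_kernel \<nu> a s u w = cnj (disc_kernel \<nu> a s w u)"
  using kernel_gen_cnj[OF assms(1,2) norm_mult_less_1[OF assms(3,4)]]
  by (simp add: disc_kernel_def mult.commute)

text \<open>Kernel bound and test weight together form a disc weight with exponents
  \<open>g = b - s - r * l\<close> and \<open>t = \<nu> - r * e\<close>. The conditions on
  \<open>r\<close> make these integrable, and \<open>2 + t + r * e = 2 + \<nu>\<close> returns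
  exactly the boundary power of the test weight at \<open>w\<close>. The factor
  \<open>norm w powr (- s)\<close> left over is at most \<open>norm w powr (- (r * l))\<close>
  because \<open>s \<le> r * l\<close>.\<close>

lemma disc_schur_test:
  assumes a: "0 < a" "a \<le> 1" and nu: "\<nu> > -1"
    and r: "real s \<le> r * l" "b - real s - r * l > -2" "0 < r * e" "r * e < \<nu> + 1"
  shows "\<exists>C>0. \<forall>w. w \<noteq> 0 \<and> norm w < 1 \<longrightarrow>
     (\<integral>\<^sup>+u. ennreal (norm (disc_kernel \<nu> a s w u) * (norm u powr (- l) * (1 - (norm u)\<^sup>2) powr (- e)) powr r) \<partial>disc_measure b \<nu>)
       \<le> ennreal (C * (norm w powr (- l) * (1 - (norm w)\<^sup>2) powr (- e)) powr r)"
proof -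
  let ?\<phi> = "\<lambda>u::complex. norm u powr (- l) * (1 - (norm u)\<^sup>2) powr (- e)"
  obtain C where C: "C > 0" "\<And>x. norm x < 1 \<Longrightarrow> norm (kernel_gen \<nu> a x) \<le> C * norm (1 - x) powr (- (2 + \<nu>))"
    using kernel_gen_bound[OF a nu] by blast
  define t where "t = \<nu> - r * e"
  define g where "g = b - real s - r * l"
  have nte: "2 + t + r * e = 2 + \<nu>" by (simp add: t_def)
  obtain D where D: "D > 0" "\<And>w. norm w < 1 \<Longrightarrow>
    (\<integral>\<^sup>+u. ennreal (norm (1 - w * cnj u) powr (- (2 + \<nu>))) \<partial>disc_measure g t)
      \<le> ennreal (D * (1 - (norm w)\<^sup>2) powr (- (r * e)))"
    using Forelli_Rudin_punctured[of t "r * e" g] r unfolding nte by (auto simp: t_def g_def)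
  have "(\<integral>\<^sup>+u. ennreal (norm (disc_kernel \<nu> a s w u) * ?\<phi> u powr r) \<partial>disc_measure b \<nu>)
       \<le> ennreal (C * D * (norm w powr (- l) * (1 - (norm w)\<^sup>2) powr (- e)) powr r)"
    if w: "w \<noteq> 0" "norm w < 1" for w
  proof -
    have w2: "(norm w)\<^sup>2 < 1" using w by (simp add: abs_square_less_1)
    let ?f = "\<lambda>u. norm (1 - w * cnj u) powr (- (2 + \<nu>))"
    have *: "disc_weight b \<nu> u * (norm (disc_kernel \<nu> a s w u) * ?\<phi> u powr r)
      \<le> (C * norm w powr (- real s)) * (disc_weight g t u * ?f u)" for u
    proof (cases "u \<noteq> 0 \<and> norm u < 1")
      case False
      then show ?thesis by (auto simp: disc_weight_def)
    next
      case True
      then have u2: "(norm u)\<^sup>2 < 1" by (simp add: abs_square_less_1)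
      have "norm (disc_kernel \<nu> a s w u) = norm (kernel_gen \<nu> a (w * cnj u)) * (norm w powr (- real s) * norm u powr (- real s))"
        using w True by (simp add: disc_kernel_def norm_divide norm_power norm_mult norm_inverse power_mult_distrib powr_minus powr_realpow divide_inverse)
      also have "\<dots> \<le> (C * ?f u) * (norm w powr (- real s) * norm u powr (- real s))"
        using norm_mult_less_1[of w u] w True by (intro mult_right_mono C(2)) auto
      finally have k: "norm (disc_kernel \<nu> a s w u) \<le> (C * ?f u) * (norm w powr (- real s) * norm u powr (- real s))" .
      have p: "?\<phi> u powr r = norm u powr (- (r * l)) * (1 - (norm u)\<^sup>2) powr (- (r * e))"
        using u2 by (simp add: powr_mult powr_powr mult_ac)
      have "disc_weight b \<nu> u * (norm (disc_kernel \<nu> a s w u) * ?\<phi> u powr r)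
        \<le> disc_weight b \<nu> u * ((C * ?f u) * (norm w powr (- real s) * norm u powr (- real s)) * (norm u powr (- (r * l)) * (1 - (norm u)\<^sup>2) powr (- (r * e))))"
        unfolding p using k by (intro mult_left_mono mult_right_mono) auto
      also have "\<dots> = (C * norm w powr (- real s)) * (disc_weight b \<nu> u * (norm u powr (- real s - r * l) * (1 - (norm u)\<^sup>2) powr (- (r * e))) * ?f u)"
        using powr_add[of "norm u" "- real s" "- (r * l)"] by (simp add: mult_ac)
      also have "disc_weight b \<nu> u * (norm u powr (- real s - r * l) * (1 - (norm u)\<^sup>2) powr (- (r * e))) = disc_weight g t u"
        using True by (subst disc_weight_mult) (auto simp: g_def t_def algebra_simps)
      finally show ?thesis .
    qed
    have "(\<integral>\<^sup>+u. ennreal (norm (disc_kernel \<nu> a s w u) * ?\<phi> u powr r) \<partial>disc_measure b \<nu>)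
      = (\<integral>\<^sup>+u. ennreal (disc_weight b \<nu> u * (norm (disc_kernel \<nu> a s w u) * ?\<phi> u powr r)) \<partial>lborel)"
      unfolding disc_kernel_def kernel_gen_def by (subst nn_integral_disc_measure) (auto simp: ennreal_mult)
    also have "\<dots> \<le> (\<integral>\<^sup>+u. ennreal (C * norm w powr (- real s)) * ennreal (disc_weight g t u * ?f u) \<partial>lborel)"
      by (intro nn_integral_mono order_trans[OF ennreal_leI[OF *]]) (use C in \<open>simp add: ennreal_mult\<close>)
    also have "\<dots> = ennreal (C * norm w powr (- real s)) * (\<integral>\<^sup>+u. ennreal (disc_weight g t u * ?f u) \<partial>lborel)"
      by (rule nn_integral_cmult) measurable
    also have "(\<integral>\<^sup>+u. ennreal (disc_weight g t u * ?f u) \<partial>lborel) = (\<integral>\<^sup>+u. ennreal (?f u) \<partial>disc_measure g t)"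
      by (subst nn_integral_disc_measure) (auto simp: ennreal_mult)
    also have "ennreal (C * norm w powr (- real s)) * \<dots> \<le> ennreal (C * norm w powr (- real s)) * ennreal (D * (1 - (norm w)\<^sup>2) powr (- (r * e)))"
      using w by (intro mult_left_mono D(2)) auto
    also have "\<dots> = ennreal (C * D * (norm w powr (- real s) * (1 - (norm w)\<^sup>2) powr (- (r * e))))"
      using C D by (simp add: ennreal_mult[symmetric] mult_ac)
    also have "\<dots> \<le> ennreal (C * D * (norm w powr (- (r * l)) * (1 - (norm w)\<^sup>2) powr (- (r * e))))"
      using w r C D by (intro ennreal_leI mult_left_mono mult_right_mono powr_mono') auto
    also have "norm w powr (- (r * l)) * (1 - (norm w)\<^sup>2) powr (- (r * e)) = (norm w powr (- l) * (1 - (norm w)\<^sup>2) powr (- e)) powr r"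
      using w2 by (simp add: powr_mult powr_powr mult_ac)
    finally show ?thesis .
  qed
  moreover have "C * D > 0" using C D by simp
  ultimately show ?thesis by blast
qed

text \<open>The smallest \<open>l\<close> with \<open>s \<le> p * l\<close> and
  \<open>s \<le> q * l\<close> is taken. It must also satisfy \<open>p * l < b + 2 - s\<close> and
  \<open>q * l < b + 2 - s\<close>. For the values \<open>p * (s / p)\<close> and
  \<open>q * (s / q)\<close> this is \<open>a > 0\<close>; for the mixed ones it is
  \<open>s * p < b + 2\<close> and \<open>s * q < b + 2\<close>, because
  \<open>p / q = p - 1\<close> and \<open>q / p = q - 1\<close>.\<close>

lemma disc_schur_weight:
  assumes a: "0 < a" "a \<le> 1" "a = 1 + b / 2 - real s" and nu: "\<nu> > -1"
    and pq: "p > 1" "q > 1" "1 / p + 1 / q = 1" and sp: "real s * p < b + 2" "real s * q < b + 2"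
  shows "\<exists>\<phi> C. \<phi> \<in> borel_measurable borel \<and> (\<forall>u. u \<noteq> 0 \<and> norm u < 1 \<longrightarrow> \<phi> u > (0::real)) \<and> C > 0 \<and>
     (\<forall>w. w \<noteq> 0 \<and> norm w < 1 \<longrightarrow>
        (\<integral>\<^sup>+u. ennreal (norm (disc_kernel \<nu> a s w u) * \<phi> u powr p) \<partial>disc_measure b \<nu>) \<le> ennreal (C * \<phi> w powr p) \<and>
        (\<integral>\<^sup>+u. ennreal (norm (disc_kernel \<nu> a s w u) * \<phi> u powr q) \<partial>disc_measure b \<nu>) \<le> ennreal (C * \<phi> w powr q))"
proof -
  define l where "l = max (real s / p) (real s / q)"
  \<comment> \<open>Any small positive \<open>e\<close> with \<open>p * e\<close> and
    \<open>q * e\<close> below \<open>\<nu> + 1\<close> would serve; with this one both stay below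
    half of it.\<close>
  define e where "e = (\<nu> + 1) / (2 * (p + q))"
  define \<phi> where "\<phi> u = norm u powr (- l) * (1 - (norm u)\<^sup>2) powr (- e)" for u :: complex
  have ppos: "p > 0" "q > 0" using pq by auto
  have pq': "p + q = p * q" using pq by (simp add: field_simps)
  have e: "e > 0" using nu ppos by (simp add: e_def)
  have epq: "p * e < \<nu> + 1" "q * e < \<nu> + 1"
  proof -
    have "(\<nu> + 1) * (p / (2 * (p + q))) < (\<nu> + 1) * 1" "(\<nu> + 1) * (q / (2 * (p + q))) < (\<nu> + 1) * 1"
      using nu ppos by (intro mult_strict_left_mono; simp add: divide_less_eq)+
    then show "p * e < \<nu> + 1" "q * e < \<nu> + 1" by (simp_all add: e_def mult_ac)
  qed
  have l1: "real s \<le> p * l" "real s \<le> q * l"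
    using ppos by (auto simp: l_def max_def field_simps)
  have s2: "2 * real s < b + 2" using a by auto
  have sq: "real s * (p / q) < b + 2 - real s" "real s * (q / p) < b + 2 - real s"
  proof -
    have "1 + p / q = p" "1 + q / p = q" using pq' ppos by (auto simp: field_simps)
    then have "p / q = p - 1" "q / p = q - 1" by auto
    then have "real s * (p / q) = real s * p - real s" "real s * (q / p) = real s * q - real s"
      by (simp_all only: right_diff_distrib mult_1_right)
    then show "real s * (p / q) < b + 2 - real s" "real s * (q / p) < b + 2 - real s" using sp by linarith+
  qed
  have l2: "p * l < b + 2 - real s" "q * l < b + 2 - real s"
    using ppos sq s2 by (auto simp: l_def max_def mult_ac)
  obtain C1 where C1: "C1 > 0" "\<And>w. w \<noteq> 0 \<Longrightarrow> norm w < 1 \<Longrightarrow>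
     (\<integral>\<^sup>+u. ennreal (norm (disc_kernel \<nu> a s w u) * \<phi> u powr p) \<partial>disc_measure b \<nu>) \<le> ennreal (C1 * \<phi> w powr p)"
    using disc_schur_test[OF a(1,2) nu, of s p l b e] l1 l2 e epq ppos unfolding \<phi>_def by auto
  obtain C2 where C2: "C2 > 0" "\<And>w. w \<noteq> 0 \<Longrightarrow> norm w < 1 \<Longrightarrow>
     (\<integral>\<^sup>+u. ennreal (norm (disc_kernel \<nu> a s w u) * \<phi> u powr q) \<partial>disc_measure b \<nu>) \<le> ennreal (C2 * \<phi> w powr q)"
    using disc_schur_test[OF a(1,2) nu, of s q l b e] l1 l2 e epq ppos unfolding \<phi>_def by auto
  have "\<phi> u > 0" if "u \<noteq> 0" "norm u < 1" for u
  proof -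
    have "(norm u)\<^sup>2 < 1" using that by (simp add: abs_square_less_1)
    then show ?thesis using that by (simp add: \<phi>_def)
  qed
  moreover have "\<phi> \<in> borel_measurable borel" unfolding \<phi>_def by measurable
  moreover have "(\<integral>\<^sup>+u. ennreal (norm (disc_kernel \<nu> a s w u) * \<phi> u powr p) \<partial>disc_measure b \<nu>) \<le> ennreal (max C1 C2 * \<phi> w powr p)"
    "(\<integral>\<^sup>+u. ennreal (norm (disc_kernel \<nu> a s w u) * \<phi> u powr q) \<partial>disc_measure b \<nu>) \<le> ennreal (max C1 C2 * \<phi> w powr q)"
    if "w \<noteq> 0" "norm w < 1" for w
    by (rule order_trans[OF C1(2)[OF that]] order_trans[OF C2(2)[OF that]]; intro ennreal_leI mult_right_mono; simp)+
  moreover have "max C1 C2 > 0" using C1 by auto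
  ultimately show ?thesis by (intro exI[of _ \<phi>] exI[of _ "max C1 C2"]) auto
qed

section \<open>The reproducing property in one variable\<close>

lemma sets_ball_borel [measurable]: "ball c r \<in> sets borel"
  by simp

lemma holomorphic_coefficients_summable:
  assumes g: "g holomorphic_on ball w R" and r: "0 \<le> r" "r < R"
  shows "summable (\<lambda>k. norm ((deriv ^^ k) g w / fact k) * r ^ k)"
proof -
  obtain r' where r': "r < r'" "r' < R" using r dense by blast
  have "w + of_real r' \<in> ball w R" using r r' by (simp add: dist_norm)
  from holomorphic_power_series[OF g this]
  have "summable (\<lambda>n. (deriv ^^ n) g w / fact n * of_real r' ^ n)" by (simp add: sums_iff)
  from powser_insidea[OF this, of "of_real r"]
  have "summable (\<lambda>k. norm ((deriv ^^ k) g w / fact k * of_real r ^ k))" using r r' by simp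
  moreover have "norm (x * of_real r ^ k) = norm x * r ^ k" for x :: complex and k
    using r by (simp add: norm_mult norm_power)
  ultimately show ?thesis by (simp only:)
qed

text \<open>Parseval on a disc about \<open>w\<close>: all terms are nonnegative, and keeping only
  the one of index 0 gives the inequality.\<close>

lemma area_mean_value_square:
  assumes g: "g holomorphic_on ball w R" and r: "0 < r" "r < R"
  shows "ennreal ((norm (g w))\<^sup>2 * (pi * r\<^sup>2)) \<le> (\<integral>\<^sup>+u\<in>ball w r. ennreal ((norm (g u))\<^sup>2) \<partial>lborel)"
proof -
  define a where "a k = (deriv ^^ k) g w / fact k" for k
  define N where "N = density lborel (\<lambda>u::complex. indicator (ball 0 r) u :: ennreal)"
  have [measurable_cong]: "sets N = sets borel" by (simp add: N_def)
  have Nball: "emeasure N UNIV = ennreal (pi * r\<^sup>2)"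
  proof -
    have "emeasure N UNIV = (\<integral>\<^sup>+u. indicator (ball 0 r) (u::complex) \<partial>lborel)"
      unfolding N_def by (subst emeasure_density, rule borel_measurable_indicator, simp, simp, simp)
    also have "\<dots> = emeasure lborel (ball (0::complex) r)" by (rule nn_integral_indicator) simp
    also have "\<dots> = ennreal (pi * r\<^sup>2)"
      using r emeasure_ball[of r "0::complex"] by (simp add: eval_unit_ball_vol)
    finally show ?thesis .
  qed
  then have fin: "finite_measure N" by (intro finite_measureI) (simp add: N_def)
  have rot: "rotation_invariant N"
    unfolding N_def by (rule rotation_invariant_density, measurable) (simp add: norm_mult indicator_def)
  have AEN: "AE u in N. norm u < r"
    unfolding N_def by (subst AE_density, measurable) (rule AE_I2, simp add: indicator_def)
  then have AEr: "AE u in N. norm u \<le> r" by eventually_elim auto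
  have sa: "summable (\<lambda>k. norm (a k) * r ^ k)"
    unfolding a_def using holomorphic_coefficients_summable[OF g] r by auto
  note P = rotation_invariant_Parseval[OF rot fin AEr sa]
  have series: "(\<Sum>k. a k * u ^ k) = g (w + u)" if "norm u < r" for u
    using holomorphic_power_series[OF g, of "w + u"] that r by (simp add: a_def sums_iff dist_norm)
  have "(norm (a 0))\<^sup>2 * (\<integral>u. norm u ^ (2 * 0) \<partial>N) \<le> (\<integral>u. (norm (\<Sum>k. a k * u ^ k))\<^sup>2 \<partial>N)"
    using sum_le_suminf[OF sums_summable[OF P(2)], of "{0}"] sums_unique[OF P(2)] by simp
  moreover have "(\<integral>u. norm u ^ (2 * 0) \<partial>N) = pi * r\<^sup>2"
  proof -
    have "measure N UNIV = pi * r\<^sup>2" using Nball by (simp add: measure_def)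
    then show ?thesis by (simp add: N_def)
  qed
  ultimately have "(norm (g w))\<^sup>2 * (pi * r\<^sup>2) \<le> (\<integral>u. (norm (\<Sum>k. a k * u ^ k))\<^sup>2 \<partial>N)"
    by (simp add: a_def)
  then have "ennreal ((norm (g w))\<^sup>2 * (pi * r\<^sup>2)) \<le> ennreal (\<integral>u. (norm (\<Sum>k. a k * u ^ k))\<^sup>2 \<partial>N)"
    by (rule ennreal_leI)
  also have "\<dots> = (\<integral>\<^sup>+u. ennreal ((norm (\<Sum>k. a k * u ^ k))\<^sup>2) \<partial>N)"
    by (rule nn_integral_eq_integral[symmetric, OF P(1)]) auto
  also have "\<dots> = (\<integral>\<^sup>+u. ennreal ((norm (\<Sum>k. a k * (u - w) ^ k))\<^sup>2) * indicator (ball w r) u \<partial>distr lborel borel ((+) w))"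
    unfolding N_def
    by (subst nn_integral_density, measurable, subst nn_integral_distr, auto simp: mult.commute indicator_def dist_norm intro!: nn_integral_cong)
  also have "\<dots> = (\<integral>\<^sup>+u\<in>ball w r. ennreal ((norm (g u))\<^sup>2) \<partial>lborel)"
    unfolding lborel_distr_plus using series by (intro nn_integral_cong) (auto simp: indicator_def dist_norm norm_minus_commute)
  finally show ?thesis .
qed

text \<open>One constant serves both signs of the exponent, so weights can be compared on discs
  whose radius is proportional to the distance from the origin.\<close>

lemma powr_bounded_below_scaled:
  fixes x y b :: real
  assumes "y > 0" "y / 2 \<le> x" "x \<le> 2 * y"
  shows "2 powr (- \<bar>b\<bar>) * y powr b \<le> x powr b"
proof (cases "b \<ge> 0")
  case True
  have "(y / 2) powr b \<le> x powr b" using assms True by (intro powr_mono2) auto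
  then show ?thesis using True assms by (simp add: powr_divide powr_minus field_simps)
next
  case False
  have "(2 * y) powr b \<le> x powr b" using assms False by (intro powr_mono2') auto
  then show ?thesis using False assms by (simp add: powr_mult)
qed

text \<open>The area inequality on the disc of radius \<open>norm w / 2\<close> about
  \<open>w\<close> bounds \<open>(norm (g w))\<^sup>2 * norm w powr (b + 2)\<close>. Since
  \<open>a \<le> 1\<close> means \<open>b \<le> 2 * s\<close>, the function
  \<open>w ^ Suc s * g w\<close> is bounded near 0 and extends to some \<open>F\<close>. If
  \<open>F 0\<close> were nonzero, \<open>g\<close> would be as large as the power
  \<open>- Suc s\<close> near 0, which is not square integrable, again by
  \<open>b \<le> 2 * s\<close>. So \<open>F\<close> vanishes at 0 and one factor \<open>w\<close>
  can be divided out.\<close>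

lemma square_integrable_removable:
  assumes g: "g holomorphic_on ball 0 1 - {0}" and [measurable]: "g \<in> borel_measurable borel"
    and fin: "(\<integral>\<^sup>+u. ennreal ((norm (g u))\<^sup>2) \<partial>disc_measure b \<nu>) < \<infinity>"
    and a: "0 < a" "a \<le> 1" "a = 1 + b / 2 - real s"
  shows "\<exists>h. h holomorphic_on ball 0 1 \<and> (\<forall>u\<in>ball 0 1 - {0}. h u = u ^ s * g u)"
proof -
  obtain I where I: "I \<ge> 0" "(\<integral>\<^sup>+u. ennreal ((norm (g u))\<^sup>2) \<partial>disc_measure b \<nu>) = ennreal I"
    using fin by (cases "\<integral>\<^sup>+u. ennreal ((norm (g u))\<^sup>2) \<partial>disc_measure b \<nu>") auto
  define k where "k = 2 powr (- \<bar>b\<bar>) * (2 powr (- \<bar>\<nu>\<bar>))"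
  have k: "k > 0" by (simp add: k_def)
  define f where "f w = w ^ Suc s * g w" for w
  have bound: "(norm (f w))\<^sup>2 \<le> 4 * I / (k * pi)" if w: "w \<noteq> 0" "norm w < 1/4" for w
  proof -
    define r where "r = norm w / 2"
    have r: "r > 0" "norm w = 2 * r" using w by (auto simp: r_def)
    have hol: "g holomorphic_on ball w (norm w)"
    proof (rule holomorphic_on_subset[OF g], rule subsetI)
      fix x assume "x \<in> ball w (norm w)"
      then have "norm (x - w) < norm w" by (simp add: dist_norm norm_minus_commute)
      then show "x \<in> ball 0 1 - {0}" using w norm_triangle_sub[of x w] by auto
    qed
    have weight: "k * norm w powr b \<le> disc_weight b \<nu> u" if "u \<in> ball w r" for u
    proof -
      have u: "norm w / 2 \<le> norm u" "norm u \<le> 2 * norm w" "norm u < 1/2" "u \<noteq> 0"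
        using that r w norm_triangle_ineq2[of w u] norm_triangle_ineq2[of u w]
        by (auto simp: dist_norm norm_minus_commute)
      have "(norm u)\<^sup>2 \<le> (1/2)\<^sup>2" using u by (intro power_mono) auto
      \<comment> \<open>For \<open>norm u < 1/2\<close> the base lies between 1/2 and 1, so it can
        be compared with 1.\<close>
      then have "2 powr (- \<bar>\<nu>\<bar>) * 1 powr \<nu> \<le> (1 - (norm u)\<^sup>2) powr \<nu>"
        using order_trans[OF _ zero_le_power2, of "-1" "norm u"]
        by (intro powr_bounded_below_scaled) (simp_all add: power_divide)
      moreover have "2 powr (- \<bar>b\<bar>) * norm w powr b \<le> norm u powr b"
        using u w by (intro powr_bounded_below_scaled) auto
      ultimately have "(2 powr (- \<bar>b\<bar>) * norm w powr b) * (2 powr (- \<bar>\<nu>\<bar>) * 1 powr \<nu>) \<le> norm u powr b * (1 - (norm u)\<^sup>2) powr \<nu>"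
        by (intro mult_mono) auto
      then show ?thesis using u by (simp add: disc_weight_def k_def mult_ac)
    qed
    have "ennreal (k * norm w powr b * ((norm (g w))\<^sup>2 * (pi * r\<^sup>2)))
        = ennreal (k * norm w powr b) * ennreal ((norm (g w))\<^sup>2 * (pi * r\<^sup>2))"
      using k by (intro ennreal_mult) auto
    also have "\<dots> \<le> ennreal (k * norm w powr b) * (\<integral>\<^sup>+u\<in>ball w r. ennreal ((norm (g u))\<^sup>2) \<partial>lborel)"
      using r by (intro mult_left_mono area_mean_value_square[OF hol]) auto
    also have "\<dots> = (\<integral>\<^sup>+u. ennreal (k * norm w powr b) * (ennreal ((norm (g u))\<^sup>2) * indicator (ball w r) u) \<partial>lborel)"
      by (rule nn_integral_cmult[symmetric]) measurable
    also have "\<dots> \<le> (\<integral>\<^sup>+u. ennreal (disc_weight b \<nu> u) * ennreal ((norm (g u))\<^sup>2) \<partial>lborel)"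
      using weight by (intro nn_integral_mono) (auto simp: indicator_def intro!: mult_right_mono ennreal_leI)
    also have "\<dots> = ennreal I" using I by (simp add: nn_integral_disc_measure)
    finally have "k * norm w powr b * ((norm (g w))\<^sup>2 * (pi * r\<^sup>2)) \<le> I" using I by simp
    then have *: "(norm w powr b * (norm w)\<^sup>2) * (norm (g w))\<^sup>2 \<le> 4 * I / (k * pi)"
      using k by (simp add: r_def power_divide field_simps)
    have "(norm (f w))\<^sup>2 = (norm w powr (2 * real s + 2)) * (norm (g w))\<^sup>2"
    proof -
      have "(norm w ^ Suc s)\<^sup>2 = norm w powr (real (2 * Suc s))"
        using w powr_realpow[of "norm w" "2 * Suc s"] by (simp add: power_mult[symmetric] mult.commute del: power_Suc)
      then show ?thesis by (simp add: f_def norm_mult norm_power power_mult_distrib add.commute del: power_Suc)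
    qed
    also have "\<dots> \<le> norm w powr (b + 2) * (norm (g w))\<^sup>2"
      using w a by (intro mult_right_mono powr_mono') (auto simp: field_simps)
    also have "norm w powr (b + 2) = norm w powr b * (norm w)\<^sup>2"
      using w by (simp add: powr_add)
    finally show ?thesis using * by simp
  qed
  have "f holomorphic_on ball 0 1 - {0}" unfolding f_def by (intro holomorphic_intros g)
  moreover have "\<exists>B. eventually (\<lambda>w. norm (f w) \<le> B) (at 0)"
  proof (intro exI)
    have "eventually (\<lambda>w::complex. w \<in> ball 0 (1/4) - {0}) (at 0)"
      by (rule eventually_at_in_open) auto
    then show "eventually (\<lambda>w. norm (f w) \<le> sqrt (4 * I / (k * pi))) (at 0)"
    proof eventually_elim
      case (elim w)
      then show ?case using bound[of w] by (intro real_le_rsqrt) auto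
    qed
  qed
  ultimately obtain F where F: "F holomorphic_on ball 0 1" "\<And>u. u \<in> ball 0 1 - {0} \<Longrightarrow> F u = f u"
    using holomorphic_on_extend_bounded[of f "ball 0 1" 0] by auto
  have F0: "F 0 = 0"
  proof (rule ccontr)
    assume c: "F 0 \<noteq> 0"
    define e where "e = norm (F 0) / 2"
    have e: "e > 0" using c by (simp add: e_def)
    have "isCont F 0" using F(1) holomorphic_on_imp_continuous_on[of F "ball 0 1"] by (simp add: continuous_on_eq_continuous_at)
    then obtain d0 where d0: "d0 > 0" "\<And>u. norm u < d0 \<Longrightarrow> norm (F u - F 0) < e"
      using e by (auto simp: continuous_at dist_norm LIM_def; metis dist_norm diff_zero dist_self less_le)
    define d where "d = min d0 1"
    have d: "0 < d" "d \<le> 1" using d0 by (auto simp: d_def)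
    have le: "ennreal (e\<^sup>2) * (ennreal (disc_weight (b - 2 * real s - 2) \<nu> u) * indicator (ball 0 d) u)
       \<le> ennreal (disc_weight b \<nu> u) * ennreal ((norm (g u))\<^sup>2)" for u
    proof (cases "u \<noteq> 0 \<and> norm u < d")
      case False
      then show ?thesis by (auto simp: disc_weight_def)
    next
      case True
      then have u: "u \<noteq> 0" "norm u < 1" "norm u < d0" by (auto simp: d_def)
      have "norm (F 0) - norm (F u) < e" using d0(2)[OF u(3)] norm_triangle_ineq2[of "F 0" "F u"] by (simp add: norm_minus_commute)
      then have "e \<le> norm (F u)" by (simp add: e_def)
      then have "e \<le> norm u powr (real (Suc s)) * norm (g u)"
        using F(2)[of u] u powr_realpow[of "norm u" "Suc s"] by (simp add: f_def norm_mult norm_power del: power_Suc)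
      then have "e\<^sup>2 \<le> (norm u powr (real (Suc s)) * norm (g u))\<^sup>2" using e by (intro power_mono) auto
      also have "\<dots> = norm u powr (2 * real s + 2) * (norm (g u))\<^sup>2"
        by (simp add: power2_eq_square powr_add[symmetric] mult_ac) (simp add: algebra_simps powr_add)
      finally have "disc_weight (b - 2 * real s - 2) \<nu> u * e\<^sup>2 \<le> disc_weight (b - 2 * real s - 2) \<nu> u * (norm u powr (2 * real s + 2) * (norm (g u))\<^sup>2)"
        by (intro mult_left_mono) auto
      also have "\<dots> = disc_weight b \<nu> u * (norm (g u))\<^sup>2"
        using u powr_add[of "norm u" "b - 2 * real s - 2" "2 * real s + 2"] by (simp add: disc_weight_def)
      finally show ?thesis using True
        by (simp add: ennreal_mult[symmetric] mult_ac ennreal_leI)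
    qed
    have "\<infinity> = ennreal (e\<^sup>2) * (\<integral>\<^sup>+u\<in>ball 0 d. ennreal (disc_weight (b - 2 * real s - 2) \<nu> u) \<partial>lborel)"
      using nn_integral_disc_weight_infinite[of "b - 2 * real s - 2" d \<nu>] d a e by (simp add: ennreal_mult_top)
    also have "\<dots> = (\<integral>\<^sup>+u. ennreal (e\<^sup>2) * (ennreal (disc_weight (b - 2 * real s - 2) \<nu> u) * indicator (ball 0 d) u) \<partial>lborel)"
      by (rule nn_integral_cmult[symmetric]) measurable
    also have "\<dots> \<le> (\<integral>\<^sup>+u. ennreal (disc_weight b \<nu> u) * ennreal ((norm (g u))\<^sup>2) \<partial>lborel)"
      by (rule nn_integral_mono) (rule le)
    also have "\<dots> < \<infinity>" using fin by (simp add: nn_integral_disc_measure)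
    finally show False by simp
  qed
  have "(\<lambda>z. if z = 0 then deriv F 0 else (F z - F 0) / (z - 0)) holomorphic_on ball 0 1"
    by (rule pole_lemma[OF F(1)]) simp
  then show ?thesis
    using F(2) F0 by (intro exI[of _ "\<lambda>z. if z = 0 then deriv F 0 else (F z - F 0) / (z - 0)"]) (auto simp: f_def)
qed

text \<open>Taking \<open>norm u ^ (2 * s)\<close> out of the weight turns a function with a pole of
  order at most \<open>s\<close> into the power series \<open>u ^ s * g u\<close>, integrated
  against a weight of exponent \<open>b - 2 * s\<close>.\<close>

lemma disc_measure_shift:
  "disc_measure b \<nu> = density (disc_measure (b - 2 * real s) \<nu>) (\<lambda>u. ennreal (norm u ^ (2 * s)))"
proof -
  have "disc_weight b \<nu> u = disc_weight (b - 2 * real s) \<nu> u * norm u ^ (2 * s)" for u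
  proof (cases "u = 0")
    case False
    then have "norm u powr b = norm u powr (b - 2 * real s) * norm u ^ (2 * s)"
      using powr_add[of "norm u" "b - 2 * real s" "real (2 * s)"] powr_realpow[of "norm u" "2 * s"] by simp
    then show ?thesis by (simp add: disc_weight_def)
  qed (simp add: disc_weight_def)
  then show ?thesis
    unfolding disc_measure_def by (subst density_density_eq) (auto simp: ennreal_mult)
qed

text \<open>The Taylor series of an integrable \<open>h\<close> need not converge absolutely at
  radius 1. The coefficient formula is therefore used on discs of radius \<open>r n\<close> tending
  to 1, and the limit is taken by dominated convergence with majorant
  \<open>norm (h u)\<close>.\<close>

lemma disc_integral_coefficient:
  assumes b: "b > -2" "\<nu> > -1" and h: "h holomorphic_on ball 0 1" and int: "integrable (disc_measure b \<nu>) h"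
  shows "(\<integral>u. cnj u ^ j * h u \<partial>disc_measure b \<nu>) = (deriv ^^ j) h 0 / fact j * of_real (pi * Beta (real j + (b / 2 + 1)) (\<nu> + 1))"
proof -
  define a where "a k = (deriv ^^ k) h 0 / fact k" for k
  define M where "M = disc_measure b \<nu>"
  have [measurable_cong]: "sets M = sets borel" by (simp add: M_def)
  interpret finite_measure M unfolding M_def by (rule finite_disc_measure[OF b])
  have [measurable]: "h \<in> borel_measurable M" using int by (auto simp: M_def)
  define r where "r n = 1 - 1 / real (n + 2)" for n
  have r: "0 < r n" "r n < 1" for n by (auto simp: r_def field_simps)
  define N where "N n = density M (\<lambda>u. ennreal (indicator (ball 0 (r n)) u))" for n
  have N: "rotation_invariant (N n)" "finite_measure (N n)" "AE u in N n. norm u \<le> r n" for n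
  proof -
    have "N n = density lborel (\<lambda>u. ennreal (disc_weight b \<nu> u) * ennreal (indicator (ball 0 (r n)) u))"
      unfolding N_def M_def disc_measure_def by (subst density_density_eq) auto
    then show "rotation_invariant (N n)"
      by (simp only:) (rule rotation_invariant_density, measurable, auto simp: disc_weight_def norm_mult indicator_def)
    show "finite_measure (N n)"
    proof (rule finite_measureI)
      have "emeasure (N n) UNIV = (\<integral>\<^sup>+u. ennreal (indicator (ball 0 (r n)) u) * indicator UNIV u \<partial>M)"
        unfolding N_def by (rule emeasure_density) (auto simp: M_def)
      also have "\<dots> \<le> (\<integral>\<^sup>+u. 1 \<partial>M)" by (intro nn_integral_mono) (simp add: indicator_def)
      also have "\<dots> = emeasure M (space M)" by simp
      also have "\<dots> < \<infinity>" by (simp add: less_top[symmetric])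
      finally show "emeasure (N n) (space (N n)) \<noteq> \<infinity>" by (simp add: N_def M_def)
    qed
    show "AE u in N n. norm u \<le> r n"
      unfolding N_def by (subst AE_density, measurable) (rule AE_I2, simp add: indicator_def)
  qed
  have series: "(\<Sum>k. a k * u ^ k) = h u" if "norm u < 1" for u
    using holomorphic_power_series[OF h, of u] that by (simp add: a_def sums_iff)
  have eq: "(\<integral>u. indicator (ball 0 (r n)) u *\<^sub>R (cnj u ^ j * h u) \<partial>M) = a j * of_real (\<integral>u. indicator (ball 0 (r n)) u *\<^sub>R norm u ^ (2 * j) \<partial>M)" for n
  proof -
    have "summable (\<lambda>k. norm (a k) * r n ^ k)"
      unfolding a_def using r[of n] by (intro holomorphic_coefficients_summable[OF h]) auto
    note C = rotation_invariant_integral_coefficient(2)[OF N this, of j]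
    have "(\<integral>u. cnj u ^ j * (\<Sum>k. a k * u ^ k) \<partial>N n) = (\<integral>u. indicator (ball 0 (r n)) u *\<^sub>R (cnj u ^ j * (\<Sum>k. a k * u ^ k)) \<partial>M)"
      unfolding N_def by (rule integral_density) measurable
    also have "\<dots> = (\<integral>u. indicator (ball 0 (r n)) u *\<^sub>R (cnj u ^ j * h u) \<partial>M)"
      using r[of n] by (intro Bochner_Integration.integral_cong) (auto simp: indicator_def series)
    finally show ?thesis using C unfolding N_def by (subst (asm) (2) integral_density) auto
  qed
  have AEM: "AE u in M. norm u < 1" using AE_disc_measure[of b \<nu>] unfolding M_def by eventually_elim auto
  have rlim: "r \<longlonglongrightarrow> 1" unfolding r_def by real_asymp
  have ev: "eventually (\<lambda>n. indicator (ball 0 (r n)) u = (1::real)) sequentially" if "norm u < 1" for u :: complex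
    using order_tendstoD(1)[OF rlim that] by eventually_elim (simp add: indicator_def)
  have L1: "(\<lambda>n. \<integral>u. indicator (ball 0 (r n)) u *\<^sub>R (cnj u ^ j * h u) \<partial>M) \<longlonglongrightarrow> (\<integral>u. cnj u ^ j * h u \<partial>M)"
  proof (rule integral_dominated_convergence[where w = "\<lambda>u. norm (h u)"])
    show "AE u in M. (\<lambda>n. indicator (ball 0 (r n)) u *\<^sub>R (cnj u ^ j * h u)) \<longlonglongrightarrow> cnj u ^ j * h u"
      using AEM
    proof eventually_elim
      case (elim u)
      show ?case by (rule tendsto_eventually) (use ev[OF elim] in eventually_elim, simp)
    qed
    show "AE u in M. norm (indicator (ball 0 (r n)) u *\<^sub>R (cnj u ^ j * h u)) \<le> norm (h u)" for n
      using AEM by eventually_elim (auto simp: indicator_def norm_mult norm_power power_le_one mult_left_le_one_le)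
  qed (use int in \<open>auto simp: M_def\<close>)
  have L2: "(\<lambda>n. \<integral>u. indicator (ball 0 (r n)) u *\<^sub>R norm u ^ (2 * j) \<partial>M) \<longlonglongrightarrow> (\<integral>u. norm u ^ (2 * j) \<partial>M)"
  proof (rule integral_dominated_convergence[where w = "\<lambda>u. 1"])
    show "AE u in M. (\<lambda>n. indicator (ball 0 (r n)) u *\<^sub>R norm u ^ (2 * j)) \<longlonglongrightarrow> norm u ^ (2 * j)"
      using AEM
    proof eventually_elim
      case (elim u)
      show ?case by (rule tendsto_eventually) (use ev[OF elim] in eventually_elim, simp)
    qed
    show "AE u in M. norm (indicator (ball 0 (r n)) u *\<^sub>R norm u ^ (2 * j)) \<le> 1" for n
      using AEM by eventually_elim (auto simp: indicator_def power_le_one)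
  qed auto
  have "(\<lambda>n. a j * complex_of_real (\<integral>u. indicator (ball 0 (r n)) u *\<^sub>R norm u ^ (2 * j) \<partial>M)) \<longlonglongrightarrow> a j * complex_of_real (\<integral>u. norm u ^ (2 * j) \<partial>M)"
    by (intro tendsto_intros L2)
  from LIMSEQ_unique[OF L1[unfolded eq] this]
  show ?thesis unfolding M_def a_def disc_measure_moment[OF b] .
qed

text \<open>Since \<open>norm u ^ (2 * s)\<close> equals \<open>u ^ s * cnj u ^ s\<close>, the
  kernel of order \<open>s\<close> acting on \<open>g\<close> becomes \<open>1 / z ^ s\<close> times
  \<open>kernel_gen\<close> acting on \<open>u ^ s * g u\<close> for the shifted weight. There each
  kernel coefficient cancels the corresponding moment, and the Taylor series of
  \<open>z ^ s * g z\<close> remains.\<close>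

lemma disc_kernel_reproducing:
  assumes g: "g holomorphic_on ball 0 1 - {0}" and [measurable]: "g \<in> borel_measurable borel"
    and fin: "(\<integral>\<^sup>+u. ennreal ((norm (g u))\<^sup>2) \<partial>disc_measure b \<nu>) < \<infinity>"
    and a: "0 < a" "a \<le> 1" "a = 1 + b / 2 - real s" and nu: "\<nu> > -1" and z: "z \<noteq> 0" "norm z < 1"
  shows "(\<integral>u. disc_kernel \<nu> a s z u * g u \<partial>disc_measure b \<nu>) = g z"
proof -
  obtain h where h: "h holomorphic_on ball 0 1" "\<And>u. u \<noteq> 0 \<Longrightarrow> norm u < 1 \<Longrightarrow> h u = u ^ s * g u"
    using square_integrable_removable[OF g _ fin a] by auto
  define N where "N = disc_measure (b - 2 * real s) \<nu>"
  define h0 where "h0 u = u ^ s * g u" for u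
  have [measurable_cong]: "sets N = sets borel" by (simp add: N_def)
  have [measurable]: "h0 \<in> borel_measurable borel" unfolding h0_def by measurable
  have b2: "b - 2 * real s > -2" using a by auto
  interpret finite_measure N unfolding N_def by (rule finite_disc_measure[OF b2 nu])
  have AEN: "AE u in N. u \<noteq> 0 \<and> norm u < 1" unfolding N_def by (rule AE_disc_measure)
  have h0h: "AE u in N. h0 u = h u" using AEN by eventually_elim (simp add: h0_def h)
  have "(\<integral>\<^sup>+u. ennreal ((norm (g u))\<^sup>2) \<partial>disc_measure b \<nu>) = (\<integral>\<^sup>+u. ennreal ((norm (h0 u))\<^sup>2) \<partial>N)"
    unfolding disc_measure_shift[of b \<nu> s] N_def[symmetric]
    by (subst nn_integral_density) (auto simp: h0_def norm_mult norm_power power_mult_distrib ennreal_mult power_mult[symmetric] mult.commute[of s])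
  then have sq: "integrable N (\<lambda>u. (norm (h0 u))\<^sup>2)"
    using fin by (intro integrableI_bounded) auto
  have int0: "integrable N h0"
  proof (rule Bochner_Integration.integrable_bound[of _ "\<lambda>u. 1 + (norm (h0 u))\<^sup>2"])
    show "AE u in N. norm (h0 u) \<le> norm (1 + (norm (h0 u))\<^sup>2)"
    proof (rule AE_I2)
      fix u
      have "2 * norm (h0 u) \<le> 1 + (norm (h0 u))\<^sup>2"
        using sum_squares_bound[of 1 "norm (h0 u)"] by simp
      then have "norm (h0 u) \<le> 1 + (norm (h0 u))\<^sup>2" using norm_ge_zero[of "h0 u"] by linarith
      then show "norm (h0 u) \<le> norm (1 + (norm (h0 u))\<^sup>2)" by simp
    qed
  qed (use sq in auto)
  \<comment> \<open>\<open>h0\<close> is Borel but has no prescribed value at 0, while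
    \<open>h\<close> is known only inside the disc. \<open>h1\<close> is Borel and holomorphic in
    the disc, and agrees with \<open>h0\<close> almost everywhere.\<close>
  define h1 where "h1 u = (if norm u < 1 then h u else 0)" for u
  have [measurable]: "h1 \<in> borel_measurable borel"
  proof -
    have "(\<lambda>u. indicator (ball 0 1) u *\<^sub>R h u) \<in> borel_measurable borel"
      by (rule borel_measurable_continuous_on_indicator) (auto intro: holomorphic_on_imp_continuous_on[OF h(1)])
    moreover have "h1 = (\<lambda>u. indicator (ball 0 1) u *\<^sub>R h u)" by (auto simp: h1_def indicator_def)
    ultimately show ?thesis by simp
  qed
  have h1: "h1 holomorphic_on ball 0 1" by (rule holomorphic_transform[OF h(1)]) (simp add: h1_def)
  have h01: "AE u in N. h0 u = h1 u" using AEN by eventually_elim (simp add: h0_def h1_def h)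
  have int1: "integrable N h1" using int0 integrable_cong_AE[OF _ _ h01] by auto
  have "AE u in N. norm (cnj u) \<le> 1" using AEN by eventually_elim auto
  moreover have "summable (\<lambda>k. norm (of_real (kernel_coeff \<nu> a k) * z ^ k) * 1 ^ k)"
    using kernel_gen_summable(1)[OF a(1) nu z(2)] by simp
  ultimately have "(\<lambda>k. of_real (kernel_coeff \<nu> a k) * z ^ k * (\<integral>u. cnj u ^ k * h1 u \<partial>N)) sums
      (\<integral>u. (\<Sum>k. of_real (kernel_coeff \<nu> a k) * z ^ k * cnj u ^ k) * h1 u \<partial>N)"
    by (intro sums_integral_power_series[OF _ int1]) auto
  also have "(\<lambda>k. of_real (kernel_coeff \<nu> a k) * z ^ k * (\<integral>u. cnj u ^ k * h1 u \<partial>N)) = (\<lambda>k. (deriv ^^ k) h1 0 / fact k * z ^ k)"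
  proof
    fix k
    have "(\<integral>u. cnj u ^ k * h1 u \<partial>N) = (deriv ^^ k) h1 0 / fact k * of_real (pi * Beta (real k + a) (\<nu> + 1))"
    proof -
      have "(b - 2 * real s) / 2 + 1 = a" using a(3) by (simp add: field_simps)
      then show ?thesis using disc_integral_coefficient[OF b2 nu h1 int1[unfolded N_def], of k] by (simp only: N_def)
    qed
    moreover have "pi * Beta (real k + a) (\<nu> + 1) \<noteq> 0" using Beta_real_pos[of "real k + a" "\<nu> + 1"] a nu by simp
    ultimately show "of_real (kernel_coeff \<nu> a k) * z ^ k * (\<integral>u. cnj u ^ k * h1 u \<partial>N) = (deriv ^^ k) h1 0 / fact k * z ^ k"
      by (simp add: kernel_coeff_def)
  qed
  also have "(\<integral>u. (\<Sum>k. of_real (kernel_coeff \<nu> a k) * z ^ k * cnj u ^ k) * h1 u \<partial>N) = (\<integral>u. kernel_gen \<nu> a (z * cnj u) * h0 u \<partial>N)"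
    using h01 by (intro integral_cong_AE) (auto simp: kernel_gen_def power_mult_distrib mult.assoc)
  finally have "(\<lambda>k. (deriv ^^ k) h1 0 / fact k * z ^ k) sums (\<integral>u. kernel_gen \<nu> a (z * cnj u) * h0 u \<partial>N)" .
  moreover have "(\<lambda>k. (deriv ^^ k) h1 0 / fact k * z ^ k) sums h1 z"
    using holomorphic_power_series[OF h1, of z] z by simp
  ultimately have 1: "(\<integral>u. kernel_gen \<nu> a (z * cnj u) * h0 u \<partial>N) = z ^ s * g z"
    using sums_unique2 z h by (simp add: h1_def)
  have "(\<integral>u. disc_kernel \<nu> a s z u * g u \<partial>disc_measure b \<nu>) = (\<integral>u. norm u ^ (2 * s) *\<^sub>R (disc_kernel \<nu> a s z u * g u) \<partial>N)"
    unfolding disc_measure_shift[of b \<nu> s] N_def[symmetric] disc_kernel_def kernel_gen_def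
    by (rule integral_density) measurable
  also have "\<dots> = (\<integral>u. (kernel_gen \<nu> a (z * cnj u) * h0 u) / z ^ s \<partial>N)"
  proof (rule integral_cong_AE)
    show "AE u in N. norm u ^ (2 * s) *\<^sub>R (disc_kernel \<nu> a s z u * g u) = (kernel_gen \<nu> a (z * cnj u) * h0 u) / z ^ s"
      using AEN
    proof eventually_elim
      case (elim u)
      have "complex_of_real (norm u ^ (2 * s)) = u ^ s * cnj u ^ s"
      proof -
        have "complex_of_real (norm u ^ (2 * s)) = complex_of_real ((norm u)\<^sup>2) ^ s" by (simp add: power_mult)
        also have "\<dots> = u ^ s * cnj u ^ s" by (simp only: complex_norm_square power_mult_distrib)
        finally show ?thesis .
      qed
      then show ?case using elim z
        by (simp add: scaleR_conv_of_real disc_kernel_def h0_def power_mult_distrib)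
    qed
  qed (auto simp: disc_kernel_def kernel_gen_def)
  also have "\<dots> = (\<integral>u. kernel_gen \<nu> a (z * cnj u) * h0 u \<partial>N) / z ^ s" by simp
  finally show ?thesis using 1 z by simp
qed

text \<open>The factor \<open>cnj u ^ s\<close> cancels the denominator of the kernel in
  \<open>u\<close>. What is left is \<open>kernel_gen\<close> integrated against 1, where only the
  constant term survives.\<close>

lemma disc_kernel_cnj_power:
  assumes a: "0 < a" and b: "b > -2" and nu: "\<nu> > -1" and z: "z \<noteq> 0" "norm z < 1"
  shows "(\<integral>u. disc_kernel \<nu> a s z u * cnj u ^ s \<partial>disc_measure b \<nu>)
      = of_real (kernel_coeff \<nu> a 0 * measure (disc_measure b \<nu>) UNIV) / z ^ s"
proof -
  define N where "N = disc_measure b \<nu>"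
  have [measurable_cong]: "sets N = sets borel" by (simp add: N_def)
  interpret finite_measure N unfolding N_def by (rule finite_disc_measure[OF b nu])
  have AEN: "AE u in N. u \<noteq> 0 \<and> norm u < 1" unfolding N_def by (rule AE_disc_measure)
  have "AE u in N. norm (cnj u) \<le> 1" using AEN by eventually_elim auto
  moreover have "summable (\<lambda>k. norm (of_real (kernel_coeff \<nu> a k) * z ^ k) * 1 ^ k)"
    using kernel_gen_summable(1)[OF a(1) nu z(2)] by simp
  ultimately have "(\<lambda>k. of_real (kernel_coeff \<nu> a k) * z ^ k * (\<integral>u. cnj u ^ k * 1 \<partial>N)) sums
      (\<integral>u. (\<Sum>k. of_real (kernel_coeff \<nu> a k) * z ^ k * cnj u ^ k) * 1 \<partial>N)"
    by (intro sums_integral_power_series) auto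
  moreover have "of_real (kernel_coeff \<nu> a k) * z ^ k * (\<integral>u. cnj u ^ k * 1 \<partial>N) = (if k = 0 then of_real (kernel_coeff \<nu> a 0 * measure N UNIV) else 0)" for k
    using rotation_invariant_integral_monomials[OF rotation_invariant_disc_measure, of k 0 b \<nu>]
    by (simp add: N_def scaleR_conv_of_real mult.commute)
  ultimately have 1: "(\<integral>u. (\<Sum>k. of_real (kernel_coeff \<nu> a k) * z ^ k * cnj u ^ k) * 1 \<partial>N) = of_real (kernel_coeff \<nu> a 0 * measure N UNIV)"
    using sums_single[of 0 "\<lambda>_. complex_of_real (kernel_coeff \<nu> a 0 * measure N UNIV)"] by (simp add: sums_unique2)
  have "(\<integral>u. disc_kernel \<nu> a s z u * cnj u ^ s \<partial>N) = (\<integral>u. (\<Sum>k. of_real (kernel_coeff \<nu> a k) * z ^ k * cnj u ^ k) * 1 / z ^ s \<partial>N)"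
  proof (rule integral_cong_AE)
    show "AE u in N. disc_kernel \<nu> a s z u * cnj u ^ s = (\<Sum>k. of_real (kernel_coeff \<nu> a k) * z ^ k * cnj u ^ k) * 1 / z ^ s"
      using AEN by eventually_elim (simp add: disc_kernel_def kernel_gen_def power_mult_distrib mult.assoc)
  qed (auto simp: disc_kernel_def kernel_gen_def)
  then show ?thesis using 1 by (simp add: N_def)
qed

section \<open>The Schur test\<close>

text \<open>Jensen's inequality on a measure of mass at most \<open>m\<close>, obtained by
  integrating Young's inequality for \<open>h x\<close> against a constant.\<close>

lemma nn_integral_Jensen_powr:
  fixes h :: "'a \<Rightarrow> real"
  assumes [measurable]: "h \<in> borel_measurable M" and h: "\<And>x. h x \<ge> 0"
    and m: "m > 0" "emeasure M (space M) \<le> ennreal m"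
    and B: "B \<ge> 0" "(\<integral>\<^sup>+x. ennreal (h x powr p) \<partial>M) \<le> ennreal B" and p: "p > 1"
  shows "(\<integral>\<^sup>+x. ennreal (h x) \<partial>M) \<le> ennreal (m powr (1 - 1 / p) * B powr (1 / p))"
proof (cases "B = 0")
  case True
  then have "(\<integral>\<^sup>+x. ennreal (h x powr p) \<partial>M) = 0" using B by simp
  then have "AE x in M. ennreal (h x powr p) = 0" by (subst (asm) nn_integral_0_iff_AE) auto
  then have "AE x in M. ennreal (h x) = 0"
  proof eventually_elim
    case (elim x)
    then show ?case using h[of x] by (simp add: ennreal_eq_0_iff)
  qed
  then have "(\<integral>\<^sup>+x. ennreal (h x) \<partial>M) = 0" by (subst nn_integral_0_iff_AE) auto
  then show ?thesis by simp
next
  case False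
  with B have B0: "B > 0" by simp
  \<comment> \<open>The constant optimal for Young's inequality: \<open>t powr p\<close> is the
    bound for the mean of the \<open>p\<close>-th powers. It is positive only for
    \<open>B > 0\<close>, hence the separate case above.\<close>
  define t where "t = (B / m) powr (1 / p)"
  define q where "q = p / (p - 1)"
  have t: "t > 0" using B0 m by (simp add: t_def)
  have tp: "t powr p = B / m" using B0 m p by (simp add: t_def powr_powr)
  have q: "q > 1" "1 / p + 1 / q = 1" using p by (auto simp: q_def field_simps)
  define c where "c = p * t powr (p - 1)"
  have c: "c > 0" using t p by (simp add: c_def)
  have pq: "p / q = p - 1" using p by (simp add: q_def)
  have young: "h x \<le> 1 / c * h x powr p + (p - 1) * (B / m) / c" for x
  proof -
    have "h x * t powr (p - 1) \<le> h x powr p / p + (t powr (p - 1)) powr q / q"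
      using p q h[of x] by (intro Youngs_inequality) auto
    also have "(t powr (p - 1)) powr q = B / m" using p by (simp add: powr_powr q_def tp)
    finally have "p * (h x * t powr (p - 1)) \<le> p * (h x powr p / p + B / m / q)"
      using p by (intro mult_left_mono) auto
    also have "\<dots> = h x powr p + p / q * (B / m)" using p by (simp add: field_simps)
    finally have "c * h x \<le> h x powr p + (p - 1) * (B / m)" unfolding pq by (simp add: c_def mult_ac)
    then have "h x \<le> (h x powr p + (p - 1) * (B / m)) / c" using c by (simp add: pos_le_divide_eq mult.commute)
    then show ?thesis by (simp add: add_divide_distrib)
  qed
  have "(\<integral>\<^sup>+x. ennreal (h x) \<partial>M) \<le> (\<integral>\<^sup>+x. ennreal (1 / c) * ennreal (h x powr p) + ennreal ((p - 1) * (B / m) / c) \<partial>M)"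
  proof (rule nn_integral_mono)
    fix x
    have "ennreal (h x) \<le> ennreal (1 / c * h x powr p + (p - 1) * (B / m) / c)" by (rule ennreal_leI[OF young])
    also have "\<dots> = ennreal (1 / c) * ennreal (h x powr p) + ennreal ((p - 1) * (B / m) / c)"
      using c p B0 m by (subst ennreal_plus) (auto simp: ennreal_mult[symmetric])
    finally show "ennreal (h x) \<le> \<dots>" .
  qed
  also have "\<dots> = ennreal (1 / c) * (\<integral>\<^sup>+x. ennreal (h x powr p) \<partial>M) + ennreal ((p - 1) * (B / m) / c) * emeasure M (space M)"
    by (subst nn_integral_add) (auto simp: nn_integral_cmult)
  also have "\<dots> \<le> ennreal (1 / c) * ennreal B + ennreal ((p - 1) * (B / m) / c) * ennreal m"
    using B m by (intro add_mono mult_left_mono) auto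
  also have "\<dots> = ennreal (1 / c * B + (p - 1) * (B / m) / c * m)"
    using c p B0 m by (subst ennreal_plus) (auto simp: ennreal_mult[symmetric])
  also have "1 / c * B + (p - 1) * (B / m) / c * m = B * t powr (1 - p)"
    using c p B0 m t powr_minus[of t "p - 1"] by (simp add: c_def field_simps)
  also have "t powr (1 - p) = (B / m) powr (1 / p - 1)"
    using p by (simp add: t_def powr_powr diff_divide_distrib)
  also have "B * (B / m) powr (1 / p - 1) = m powr (1 - 1 / p) * B powr (1 / p)"
    using B0 m by (simp add: powr_divide powr_diff field_simps)
  finally show ?thesis .
qed

text \<open>For fixed \<open>x\<close>, Jensen is applied to
  \<open>f y * \<phi> y powr (- q)\<close> and the measure of density
  \<open>k x y * \<phi> y powr q\<close>, whose mass is at most \<open>C * \<phi> x powr q\<close>.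
  As \<open>q * (p - 1) = p\<close>, the \<open>p\<close>-th power of the inner integral is at most
  \<open>C powr (p - 1) * \<phi> x powr p * J x\<close>. Integrating in \<open>x\<close> and
  exchanging the order uses the symmetry of \<open>k\<close> and the bound with exponent
  \<open>p\<close>. The finiteness claim is essential, since \<open>enn2real\<close> sends infinity
  to 0.\<close>

lemma schur_test:
  fixes k :: "'a \<Rightarrow> 'a \<Rightarrow> real" and \<phi> f :: "'a \<Rightarrow> real"
  assumes M: "sigma_finite_measure M"
    and k_meas [measurable]: "case_prod k \<in> borel_measurable (M \<Otimes>\<^sub>M M)" and k: "\<And>x y. k x y \<ge> 0"
    and sym: "\<And>x y. x \<in> space M \<Longrightarrow> y \<in> space M \<Longrightarrow> k x y = k y x"
    and [measurable]: "\<phi> \<in> borel_measurable M" and phi: "AE x in M. \<phi> x > 0"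
    and pq: "p > 1" "q > 1" "1 / p + 1 / q = 1" and C: "C > 0"
    and q_bound: "AE x in M. (\<integral>\<^sup>+y. ennreal (k x y * \<phi> y powr q) \<partial>M) \<le> ennreal (C * \<phi> x powr q)"
    and p_bound: "AE x in M. (\<integral>\<^sup>+y. ennreal (k x y * \<phi> y powr p) \<partial>M) \<le> ennreal (C * \<phi> x powr p)"
    and [measurable]: "f \<in> borel_measurable M" and f: "\<And>x. f x \<ge> 0"
    and B: "B \<ge> 0" "(\<integral>\<^sup>+x. ennreal (f x powr p) \<partial>M) \<le> ennreal B"
  shows "AE x in M. (\<integral>\<^sup>+y. ennreal (k x y * f y) \<partial>M) < \<infinity>"
    and "(\<integral>\<^sup>+x. ennreal (enn2real (\<integral>\<^sup>+y. ennreal (k x y * f y) \<partial>M) powr p) \<partial>M) \<le> ennreal (C powr p * B)"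
proof -
  let ?S = "\<lambda>x. \<integral>\<^sup>+y. ennreal (k x y * f y) \<partial>M"
  interpret sigma_finite_measure M by fact
  interpret pair_sigma_finite M M ..
  have pq': "q - p * q = - p" "q * (p - 1) = p" using pq by (auto simp: field_simps)
  \<comment> \<open>The exponent \<open>- p\<close> is \<open>q - p * q\<close>: the density
    contributes \<open>q\<close>, and the \<open>p\<close>-th power of
    \<open>\<phi> y powr (- q)\<close> the rest.\<close>
  define J where "J x = (\<integral>\<^sup>+y. ennreal (k x y * \<phi> y powr (- p) * f y powr p) \<partial>M)" for x
  have [measurable]: "J \<in> borel_measurable M" unfolding J_def by measurable
  have kx [measurable]: "(\<lambda>y. k x y) \<in> borel_measurable M" if "x \<in> space M" for x
    using that by measurable
  have swap: "(\<integral>\<^sup>+x. ennreal (\<phi> x powr p) * J x \<partial>M) \<le> ennreal (C * B)"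
  proof -
    have "(\<integral>\<^sup>+x. ennreal (\<phi> x powr p) * J x \<partial>M) = (\<integral>\<^sup>+x. \<integral>\<^sup>+y. ennreal (\<phi> x powr p * (k x y * \<phi> y powr (- p) * f y powr p)) \<partial>M \<partial>M)"
      unfolding J_def using k by (intro nn_integral_cong, subst nn_integral_cmult[symmetric]) (auto simp: ennreal_mult)
    also have "\<dots> = (\<integral>\<^sup>+y. \<integral>\<^sup>+x. ennreal (\<phi> x powr p * (k x y * \<phi> y powr (- p) * f y powr p)) \<partial>M \<partial>M)"
      by (rule Fubini'[symmetric]) measurable
    also have "\<dots> = (\<integral>\<^sup>+y. ennreal (\<phi> y powr (- p) * f y powr p) * (\<integral>\<^sup>+x. ennreal (k y x * \<phi> x powr p) \<partial>M) \<partial>M)"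
    proof (rule nn_integral_cong)
      fix y assume y: "y \<in> space M"
      have "(\<integral>\<^sup>+x. ennreal (\<phi> x powr p * (k x y * \<phi> y powr (- p) * f y powr p)) \<partial>M)
        = (\<integral>\<^sup>+x. ennreal (\<phi> y powr (- p) * f y powr p) * ennreal (k y x * \<phi> x powr p) \<partial>M)"
        using k y by (intro nn_integral_cong) (auto simp: sym[OF _ y] ennreal_mult[symmetric] mult_ac)
      also have "\<dots> = ennreal (\<phi> y powr (- p) * f y powr p) * (\<integral>\<^sup>+x. ennreal (k y x * \<phi> x powr p) \<partial>M)"
        using y by (intro nn_integral_cmult) measurable
      finally show "(\<integral>\<^sup>+x. ennreal (\<phi> x powr p * (k x y * \<phi> y powr (- p) * f y powr p)) \<partial>M) = \<dots>" .
    qed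
    also have "\<dots> \<le> (\<integral>\<^sup>+y. ennreal C * ennreal (f y powr p) \<partial>M)"
    proof (rule nn_integral_mono_AE)
      show "AE y in M. ennreal (\<phi> y powr (- p) * f y powr p) * (\<integral>\<^sup>+x. ennreal (k y x * \<phi> x powr p) \<partial>M) \<le> ennreal C * ennreal (f y powr p)"
        using p_bound phi
      proof eventually_elim
        case (elim y)
        have "ennreal (\<phi> y powr (- p) * f y powr p) * (\<integral>\<^sup>+x. ennreal (k y x * \<phi> x powr p) \<partial>M)
          \<le> ennreal (\<phi> y powr (- p) * f y powr p) * ennreal (C * \<phi> y powr p)"
          using elim by (intro mult_left_mono) auto
        also have "\<dots> = ennreal C * ennreal (f y powr p)"
          using elim C by (simp add: ennreal_mult[symmetric] powr_minus)
        finally show ?case .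
      qed
    qed
    also have "\<dots> = ennreal C * (\<integral>\<^sup>+y. ennreal (f y powr p) \<partial>M)" by (rule nn_integral_cmult) measurable
    also have "\<dots> \<le> ennreal C * ennreal B" using B by (intro mult_left_mono) auto
    also have "\<dots> = ennreal (C * B)" using C B by (simp add: ennreal_mult)
    finally show ?thesis .
  qed
  have "(\<integral>\<^sup>+x. ennreal (\<phi> x powr p) * J x \<partial>M) \<noteq> \<infinity>" using swap by (auto simp: top_unique)
  then have "AE x in M. ennreal (\<phi> x powr p) * J x \<noteq> \<infinity>" by (intro nn_integral_PInf_AE) auto
  then have Jfin: "AE x in M. J x < \<infinity>"
    using phi
  proof eventually_elim
    case (elim x)
    then show ?case by (auto simp: ennreal_mult_eq_top_iff less_top[symmetric] ennreal_eq_0_iff)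
  qed
  have main: "AE x in M. ?S x < \<infinity> \<and>
      ennreal (enn2real (?S x) powr p) \<le> ennreal (C powr (p - 1)) * (ennreal (\<phi> x powr p) * J x)"
    using Jfin q_bound phi AE_space
  proof eventually_elim
    case (elim x)
    note x = \<open>x \<in> space M\<close>
    obtain j where j: "j \<ge> 0" "J x = ennreal j" using elim(1) by (cases "J x") auto
    define R where "R = density M (\<lambda>y. ennreal (k x y * \<phi> y powr q))"
    define m where "m = C * \<phi> x powr q"
    define I where "I = ?S x"
    have m: "m > 0" using C elim by (simp add: m_def)
    have mm: "emeasure R (space R) \<le> ennreal m"
      using elim(2) x by (simp add: R_def emeasure_density m_def)
    have hp: "(\<integral>\<^sup>+y. ennreal ((f y * \<phi> y powr (- q)) powr p) \<partial>R) \<le> ennreal j"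
    proof -
      have "(\<integral>\<^sup>+y. ennreal ((f y * \<phi> y powr (- q)) powr p) \<partial>R) = (\<integral>\<^sup>+y. ennreal (k x y * \<phi> y powr q) * ennreal ((f y * \<phi> y powr (- q)) powr p) \<partial>M)"
        unfolding R_def using x by (intro nn_integral_density) measurable
      also have "\<dots> = J x" unfolding J_def
      proof (rule nn_integral_cong_AE)
        show "AE y in M. ennreal (k x y * \<phi> y powr q) * ennreal ((f y * \<phi> y powr (- q)) powr p) = ennreal (k x y * \<phi> y powr (- p) * f y powr p)"
          using phi
        proof eventually_elim
          case (elim y)
          have "\<phi> y powr q * (f y * \<phi> y powr (- q)) powr p = f y powr p * (\<phi> y powr q * \<phi> y powr (- q * p))"
            using f[of y] by (simp add: powr_mult powr_powr mult_ac)
          also have "\<phi> y powr q * \<phi> y powr (- q * p) = \<phi> y powr (- p)"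
            unfolding powr_add[symmetric] using pq'(1) by (simp add: mult.commute)
          finally have "k x y * \<phi> y powr q * (f y * \<phi> y powr (- q)) powr p = k x y * \<phi> y powr (- p) * f y powr p"
            by (simp add: mult.assoc mult.commute[of "f y powr p"])
          then show ?case using k[of x y] by (simp add: ennreal_mult[symmetric])
        qed
      qed
      finally show ?thesis using j by simp
    qed
    have "I = (\<integral>\<^sup>+y. ennreal (f y * \<phi> y powr (- q)) \<partial>R)"
    proof -
      have "(\<integral>\<^sup>+y. ennreal (f y * \<phi> y powr (- q)) \<partial>R) = (\<integral>\<^sup>+y. ennreal (k x y * \<phi> y powr q) * ennreal (f y * \<phi> y powr (- q)) \<partial>M)"
        unfolding R_def using x by (intro nn_integral_density) measurable
      also have "\<dots> = I" unfolding I_def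
      proof (rule nn_integral_cong_AE)
        show "AE y in M. ennreal (k x y * \<phi> y powr q) * ennreal (f y * \<phi> y powr (- q)) = ennreal (k x y * f y)"
          using phi
        proof eventually_elim
          case (elim y)
          have "\<phi> y powr q * \<phi> y powr (- q) = 1" using elim by (simp add: powr_minus)
          then have "k x y * \<phi> y powr q * (f y * \<phi> y powr (- q)) = k x y * f y"
            by (metis mult.assoc mult.commute mult.right_neutral)
          then show ?case using k[of x y] f[of y] by (simp add: ennreal_mult[symmetric])
        qed
      qed
      finally show ?thesis ..
    qed
    also have "\<dots> \<le> ennreal (m powr (1 - 1 / p) * j powr (1 / p))"
      using f by (intro nn_integral_Jensen_powr[OF _ _ m mm j(1) hp pq(1)]) (auto simp: R_def)
    finally have I: "I \<le> ennreal (m powr (1 - 1 / p) * j powr (1 / p))" .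
    then have Ifin: "I < \<infinity>" by (auto intro: le_less_trans)
    have "enn2real I \<le> m powr (1 - 1 / p) * j powr (1 / p)"
      using I by (intro enn2real_leI) auto
    then have "enn2real I powr p \<le> (m powr (1 - 1 / p) * j powr (1 / p)) powr p"
      using pq by (intro powr_mono2) auto
    also have "\<dots> = m powr (p - 1) * j"
      using m j pq by (simp add: powr_mult powr_powr left_diff_distrib)
    also have "m powr (p - 1) = C powr (p - 1) * \<phi> x powr p"
      using C elim pq'(2) by (simp add: m_def powr_mult powr_powr)
    finally have "enn2real I powr p \<le> C powr (p - 1) * (\<phi> x powr p * j)" by (simp add: mult.assoc)
    then have "ennreal (enn2real I powr p) \<le> ennreal (C powr (p - 1) * (\<phi> x powr p * j))" by (rule ennreal_leI)
    also have "\<dots> = ennreal (C powr (p - 1)) * (ennreal (\<phi> x powr p) * J x)"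
      using j by (simp add: ennreal_mult)
    finally show ?case using Ifin by (simp add: I_def)
  qed
  then show "AE x in M. ?S x < \<infinity>" by eventually_elim auto
  have "(\<integral>\<^sup>+x. ennreal (enn2real (?S x) powr p) \<partial>M)
      \<le> (\<integral>\<^sup>+x. ennreal (C powr (p - 1)) * (ennreal (\<phi> x powr p) * J x) \<partial>M)"
    using main by (intro nn_integral_mono_AE) (auto elim: eventually_mono)
  also have "\<dots> = ennreal (C powr (p - 1)) * (\<integral>\<^sup>+x. ennreal (\<phi> x powr p) * J x \<partial>M)"
    by (rule nn_integral_cmult) measurable
  also have "\<dots> \<le> ennreal (C powr (p - 1)) * ennreal (C * B)" by (intro mult_left_mono swap) auto
  also have "\<dots> = ennreal (C powr p * B)"
    using C B powr_add[of C "p - 1" 1] by (simp add: ennreal_mult[symmetric] mult_ac)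
  finally show "(\<integral>\<^sup>+x. ennreal (enn2real (?S x) powr p) \<partial>M) \<le> ennreal (C powr p * B)" .
qed

text \<open>The last conclusion keeps the absolute value inside the inner integral; absolute
  convergence in Fubini's theorem relies on it.\<close>

lemma schur_test_operator:
  fixes K :: "'a \<Rightarrow> 'a \<Rightarrow> complex" and \<phi> :: "'a \<Rightarrow> real" and f :: "'a \<Rightarrow> complex"
  assumes M: "sigma_finite_measure M"
    and K_meas [measurable]: "case_prod K \<in> borel_measurable (M \<Otimes>\<^sub>M M)"
    and sym: "\<And>x y. x \<in> space M \<Longrightarrow> y \<in> space M \<Longrightarrow> norm (K x y) = norm (K y x)"
    and phi_meas [measurable]: "\<phi> \<in> borel_measurable M" and phi: "AE x in M. \<phi> x > 0"
    and pq: "p > 1" "q > 1" "1 / p + 1 / q = 1" and C: "C > 0"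
    and q_bound: "AE x in M. (\<integral>\<^sup>+y. ennreal (norm (K x y) * \<phi> y powr q) \<partial>M) \<le> ennreal (C * \<phi> x powr q)"
    and p_bound: "AE x in M. (\<integral>\<^sup>+y. ennreal (norm (K x y) * \<phi> y powr p) \<partial>M) \<le> ennreal (C * \<phi> x powr p)"
    and f_meas [measurable]: "f \<in> borel_measurable M" and f: "integrable M (\<lambda>x. norm (f x) powr p)"
  shows "AE x in M. integrable M (\<lambda>y. K x y * f y)"
    and "(\<lambda>x. \<integral>y. K x y * f y \<partial>M) \<in> borel_measurable M"
    and "integrable M (\<lambda>x. norm (\<integral>y. K x y * f y \<partial>M) powr p)"
    and "(\<integral>x. norm (\<integral>y. K x y * f y \<partial>M) powr p \<partial>M) \<le> C powr p * (\<integral>x. norm (f x) powr p \<partial>M)"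
    and "integrable M (\<lambda>x. enn2real (\<integral>\<^sup>+y. ennreal (norm (K x y) * norm (f y)) \<partial>M) powr p)"
proof -
  let ?T = "\<lambda>x. \<integral>y. K x y * f y \<partial>M"
  let ?S = "\<lambda>x. \<integral>\<^sup>+y. ennreal (norm (K x y) * norm (f y)) \<partial>M"
  interpret sigma_finite_measure M by fact
  interpret pair_sigma_finite M M ..
  define B where "B = (\<integral>x. norm (f x) powr p \<partial>M)"
  have B: "B \<ge> 0" "(\<integral>\<^sup>+x. ennreal (norm (f x) powr p) \<partial>M) \<le> ennreal B"
    using nn_integral_eq_integral[OF f] by (auto simp: B_def)
  have km: "(\<lambda>(x, y). norm (K x y)) \<in> borel_measurable (M \<Otimes>\<^sub>M M)" by measurable
  note S = schur_test[OF M km norm_ge_zero sym phi_meas phi pq C q_bound p_bound _ norm_ge_zero B]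
  have S1: "AE x in M. ?S x < \<infinity>" by (rule S) measurable
  have S2: "(\<integral>\<^sup>+x. ennreal (enn2real (?S x) powr p) \<partial>M) \<le> ennreal (C powr p * B)"
    by (rule S) measurable
  show 1: "AE x in M. integrable M (\<lambda>y. K x y * f y)"
    using S1 AE_space
  proof eventually_elim
    case (elim x)
    then show ?case by (intro integrableI_bounded) (auto simp: norm_mult)
  qed
  show [measurable]: "(\<lambda>x. \<integral>y. K x y * f y \<partial>M) \<in> borel_measurable M"
    by measurable
  show 5: "integrable M (\<lambda>x. enn2real (?S x) powr p)"
  proof (rule integrableI_bounded)
    have "(\<integral>\<^sup>+x. ennreal (norm (enn2real (?S x) powr p)) \<partial>M) \<le> ennreal (C powr p * B)"
      using S2 by simp
    then show "(\<integral>\<^sup>+x. ennreal (norm (enn2real (?S x) powr p)) \<partial>M) < \<infinity>"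
      by (rule le_less_trans) simp
  qed measurable
  have le: "AE x in M. norm (?T x) powr p \<le> enn2real (?S x) powr p"
    using 1 S1
  proof eventually_elim
    case (elim x)
    have "ennreal (norm (?T x)) \<le> (\<integral>\<^sup>+y. ennreal (norm (K x y * f y)) \<partial>M)"
      by (rule integral_norm_bound_ennreal[OF elim(1)])
    then have "norm (?T x) \<le> enn2real (?S x)"
      using elim(2) by (subst ennreal_le_iff[symmetric]) (auto simp: norm_mult)
    then show ?case using pq by (intro powr_mono2) auto
  qed
  show 3: "integrable M (\<lambda>x. norm (?T x) powr p)"
    by (rule Bochner_Integration.integrable_bound[OF 5]) (use le in auto)
  have "(\<integral>x. norm (?T x) powr p \<partial>M) \<le> (\<integral>x. enn2real (?S x) powr p \<partial>M)"
    by (rule integral_mono_AE[OF 3 5 le])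
  also have "\<dots> \<le> C powr p * B"
  proof -
    have "ennreal (\<integral>x. enn2real (?S x) powr p \<partial>M) \<le> ennreal (C powr p * B)"
      using S2 by (subst nn_integral_eq_integral[OF 5, symmetric]) auto
    then show ?thesis using B by (subst (asm) ennreal_le_iff) auto
  qed
  finally show "(\<integral>x. norm (?T x) powr p \<partial>M) \<le> C powr p * (\<integral>x. norm (f x) powr p \<partial>M)"
    by (simp add: B_def)
qed

lemma integrable_mult_of_squares:
  fixes f g :: "'a \<Rightarrow> complex"
  assumes [measurable]: "f \<in> borel_measurable M" "g \<in> borel_measurable M"
    and "integrable M (\<lambda>x. (norm (f x))\<^sup>2)" "integrable M (\<lambda>x. (norm (g x))\<^sup>2)"
  shows "integrable M (\<lambda>x. f x * g x)"
proof (rule Bochner_Integration.integrable_bound[of _ "\<lambda>x. (norm (f x))\<^sup>2 + (norm (g x))\<^sup>2"])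
  show "AE x in M. norm (f x * g x) \<le> norm ((norm (f x))\<^sup>2 + (norm (g x))\<^sup>2)"
  proof (rule AE_I2)
    fix x
    have "2 * norm (f x) * norm (g x) \<le> (norm (f x))\<^sup>2 + (norm (g x))\<^sup>2" by (rule sum_squares_bound)
    moreover have "0 \<le> norm (f x) * norm (g x)" by simp
    ultimately have "norm (f x) * norm (g x) \<le> (norm (f x))\<^sup>2 + (norm (g x))\<^sup>2" by linarith
    then show "norm (f x * g x) \<le> norm ((norm (f x))\<^sup>2 + (norm (g x))\<^sup>2)"
      unfolding norm_mult real_norm_def by (rule order_trans) (rule abs_ge_self)
  qed
qed (use assms in auto)

text \<open>The Schur test makes the double integral absolutely convergent, so Fubini applies.\<close>

lemma schur_operator_symmetric:
  fixes K :: "'a \<Rightarrow> 'a \<Rightarrow> complex" and \<phi> :: "'a \<Rightarrow> real" and f g :: "'a \<Rightarrow> complex"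
  assumes M: "sigma_finite_measure M"
    and K_meas [measurable]: "case_prod K \<in> borel_measurable (M \<Otimes>\<^sub>M M)"
    and sym: "\<And>x y. x \<in> space M \<Longrightarrow> y \<in> space M \<Longrightarrow> K y x = cnj (K x y)"
    and phi_meas: "\<phi> \<in> borel_measurable M" and phi: "AE x in M. \<phi> x > 0" and C: "C > 0"
    and bound: "AE x in M. (\<integral>\<^sup>+y. ennreal (norm (K x y) * \<phi> y powr 2) \<partial>M) \<le> ennreal (C * \<phi> x powr 2)"
    and [measurable]: "f \<in> borel_measurable M" "g \<in> borel_measurable M"
    and f: "integrable M (\<lambda>x. norm (f x) powr 2)" and g: "integrable M (\<lambda>x. norm (g x) powr 2)"
  shows "(\<integral>x. (\<integral>y. K x y * f y \<partial>M) * cnj (g x) \<partial>M) = (\<integral>y. f y * cnj (\<integral>x. K y x * g x \<partial>M) \<partial>M)"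
proof -
  interpret sigma_finite_measure M by fact
  interpret pair_sigma_finite M M ..
  have sym': "norm (K x y) = norm (K y x)" if "x \<in> space M" "y \<in> space M" for x y
    using sym[OF that] by simp
  define S where "S x = enn2real (\<integral>\<^sup>+y. ennreal (norm (K x y) * norm (f y)) \<partial>M)" for x
  have [measurable]: "S \<in> borel_measurable M" unfolding S_def by measurable
  note O = schur_test_operator[OF M K_meas sym' phi_meas phi _ _ _ C bound bound _ f]
  have S: "integrable M (\<lambda>x. S x powr 2)" unfolding S_def by (rule O(5)) auto
  have I: "AE x in M. integrable M (\<lambda>y. K x y * f y)" by (rule O(1)) auto
  \<comment> \<open>The iterated integral of the absolute value is that of
    \<open>S x * norm (g x)\<close>, a product of two square integrable functions.\<close>
  have "integrable M (\<lambda>x. complex_of_real (S x) * g x)"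
    using S g by (intro integrable_mult_of_squares) (auto simp: S_def)
  from integrable_norm[OF this] have Sg: "integrable M (\<lambda>x. S x * norm (g x))"
    by (simp add: norm_mult S_def)
  have "integrable (M \<Otimes>\<^sub>M M) (\<lambda>(x, y). K x y * f y * cnj (g x))"
  proof (rule Fubini_integrable)
    show "(\<lambda>(x, y). K x y * f y * cnj (g x)) \<in> borel_measurable (M \<Otimes>\<^sub>M M)" by measurable
    show "AE x in M. integrable M (\<lambda>y. case (x, y) of (x, y) \<Rightarrow> K x y * f y * cnj (g x))"
      using I by eventually_elim simp
    have "AE x in M. (\<integral>y. norm (K x y * f y) \<partial>M) = S x"
      using I
    proof eventually_elim
      case (elim x)
      have m: "(\<lambda>y. norm (K x y * f y)) \<in> borel_measurable M" using elim by auto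
      show ?case by (subst integral_eq_nn_integral[OF m]) (auto simp: S_def norm_mult)
    qed
    then have "AE x in M. (\<integral>y. norm (case (x, y) of (x, y) \<Rightarrow> K x y * f y * cnj (g x)) \<partial>M) = S x * norm (g x)"
      by eventually_elim (simp add: norm_mult)
    from integrable_cong_AE[OF _ _ this] Sg
    show "integrable M (\<lambda>x. \<integral>y. norm (case (x, y) of (x, y) \<Rightarrow> K x y * f y * cnj (g x)) \<partial>M)"
      by auto
  qed
  then have "(\<integral>y. (\<integral>x. K x y * f y * cnj (g x) \<partial>M) \<partial>M) = (\<integral>x. (\<integral>y. K x y * f y * cnj (g x) \<partial>M) \<partial>M)"
    by (rule Fubini_integral)
  moreover have "(\<integral>y. K x y * f y * cnj (g x) \<partial>M) = (\<integral>y. K x y * f y \<partial>M) * cnj (g x)" for x by simp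
  moreover have "(\<integral>x. K x y * f y * cnj (g x) \<partial>M) = f y * cnj (\<integral>x. K y x * g x \<partial>M)" if y: "y \<in> space M" for y
  proof -
    have "(\<integral>x. K x y * f y * cnj (g x) \<partial>M) = (\<integral>x. f y * cnj (K y x * g x) \<partial>M)"
      using y by (intro Bochner_Integration.integral_cong) (auto simp: sym[OF y])
    also have "\<dots> = f y * (\<integral>x. cnj (K y x * g x) \<partial>M)" by (rule integral_mult_right_zero)
    also have "(\<integral>x. cnj (K y x * g x) \<partial>M) = cnj (\<integral>x. K y x * g x \<partial>M)" by (rule Bochner_Integration.integral_cnj)
    finally show ?thesis .
  qed
  ultimately show ?thesis by (simp cong: Bochner_Integration.integral_cong)
qed

section \<open>The Hartogs triangle as a product\<close>

text \<open>The exponent \<open>\<nu> + 2\<close> combines the power \<nu> in the Hartogs weight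
  with the Jacobian of \<open>u \<mapsto> v * u\<close> for fixed \<open>v\<close>. The measure is
  not normalised; \<open>hartogs_const\<close> is carried separately.\<close>

definition hartogs_prod :: "real \<Rightarrow> (complex \<times> complex) measure" where
  "hartogs_prod \<nu> = disc_measure 0 \<nu> \<Otimes>\<^sub>M disc_measure (\<nu> + 2) \<nu>"

definition hartogs_map :: "complex \<times> complex \<Rightarrow> complex \<times> complex" where
  "hartogs_map w = (fst w * snd w, snd w)"

lemma hartogs_map_measurable [measurable]: "hartogs_map \<in> borel_measurable borel"
  unfolding hartogs_map_def[abs_def] borel_prod[symmetric] by measurable

lemma sets_hartogs_prod [measurable_cong, simp]: "sets (hartogs_prod \<nu>) = sets borel"
proof -
  have "sets (hartogs_prod \<nu>) = sets (borel \<Otimes>\<^sub>M borel)"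
    unfolding hartogs_prod_def by (rule sets_pair_measure_cong) simp_all
  then show ?thesis by (simp only: borel_prod)
qed

lemma space_hartogs_prod [simp]: "space (hartogs_prod \<nu>) = UNIV"
  using sets_eq_imp_space_eq[OF sets_hartogs_prod] by simp

lemma hartogs_map_measurable_prod [measurable]: "hartogs_map \<in> borel_measurable (hartogs_prod \<nu>)"
  by (simp only: measurable_cong_sets[OF sets_hartogs_prod refl] hartogs_map_measurable)

lemma hartogs_open: "open hartogs"
  unfolding hartogs_def by (intro open_Collect_conj open_Collect_less continuous_intros)

lemma hartogs_borel [measurable]: "hartogs \<in> sets borel"
  using hartogs_open by simp

lemma hartogs_weight_measurable [measurable]: "hartogs_weight \<nu> \<in> borel_measurable borel"
  unfolding hartogs_weight_def[abs_def] borel_prod[symmetric] by measurable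

lemma hartogs_weight_nonneg [simp]: "hartogs_weight \<nu> z \<ge> 0"
  by (simp add: hartogs_weight_def)

lemma space_hartogs_measure [simp]: "space (hartogs_measure \<nu>) = hartogs"
  by (simp add: hartogs_measure_def)

lemma borel_measurable_lebesgue_on_hartogs:
  "F \<in> borel_measurable borel \<Longrightarrow> F \<in> borel_measurable (lebesgue_on hartogs)"
  by (intro measurable_restrict_space1 measurable_completion) simp

lemma borel_measurable_hartogs:
  "F \<in> borel_measurable borel \<Longrightarrow> F \<in> borel_measurable (hartogs_measure \<nu>)"
  unfolding hartogs_measure_def by (simp add: borel_measurable_lebesgue_on_hartogs)

lemma id_measurable_hartogs: "(\<lambda>z. z) \<in> measurable (hartogs_measure \<nu>) borel"
  by (rule borel_measurable_hartogs) simp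

lemma pair_sigma_finite_disc: "pair_sigma_finite (disc_measure b \<nu>) (disc_measure b' \<nu>')"
  unfolding pair_sigma_finite_def by (simp add: sigma_finite_disc_measure)

lemma nn_integral_hartogs_prod:
  assumes [measurable]: "F \<in> borel_measurable borel"
  shows "(\<integral>\<^sup>+w. F w \<partial>hartogs_prod \<nu>)
    = (\<integral>\<^sup>+v. \<integral>\<^sup>+u. F (u, v) \<partial>disc_measure 0 \<nu> \<partial>disc_measure (\<nu> + 2) \<nu>)"
proof -
  interpret pair_sigma_finite "disc_measure 0 \<nu>" "disc_measure (\<nu> + 2) \<nu>" by (rule pair_sigma_finite_disc)
  have "F \<in> borel_measurable (disc_measure 0 \<nu> \<Otimes>\<^sub>M disc_measure (\<nu> + 2) \<nu>)"
    using assms by (simp only: hartogs_prod_def[symmetric] measurable_cong_sets[OF sets_hartogs_prod refl])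
  from nn_integral_snd[OF this] show ?thesis unfolding hartogs_prod_def ..
qed

text \<open>The change of variables is done slice by slice: for fixed second coordinate
  \<open>v\<close> it is multiplication by \<open>v\<close> in the first, with Jacobian the squared
  norm of \<open>v\<close>.\<close>

lemma nn_integral_hartogs_weight:
  assumes [measurable]: "F \<in> borel_measurable borel"
  shows "(\<integral>\<^sup>+z. ennreal (hartogs_weight \<nu> z) * F z \<partial>lebesgue_on hartogs) = (\<integral>\<^sup>+w. F (hartogs_map w) \<partial>hartogs_prod \<nu>)"
proof -
  define G where "G z = ennreal (hartogs_weight \<nu> z) * F z * indicator hartogs z" for z
  have [measurable]: "G \<in> borel_measurable borel" unfolding G_def by measurable
  have "(\<integral>\<^sup>+z. ennreal (hartogs_weight \<nu> z) * F z \<partial>lebesgue_on hartogs) = (\<integral>\<^sup>+z. G z \<partial>lebesgue)"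
    unfolding G_def by (rule nn_integral_restrict_space) simp
  also have "\<dots> = (\<integral>\<^sup>+z. G z \<partial>(lborel \<Otimes>\<^sub>M lborel))"
    by (simp add: nn_integral_completion lborel_prod)
  also have "\<dots> = (\<integral>\<^sup>+v. \<integral>\<^sup>+u. G (u, v) \<partial>lborel \<partial>lborel)"
    by (rule lborel_pair.nn_integral_snd[symmetric]) (simp add: lborel_prod)
  also have "\<dots> = (\<integral>\<^sup>+v. ennreal (disc_weight (\<nu> + 2) \<nu> v) * (\<integral>\<^sup>+u. F (hartogs_map (u, v)) \<partial>disc_measure 0 \<nu>) \<partial>lborel)"
  proof (rule nn_integral_cong)
    fix v :: complex
    have [measurable]: "(\<lambda>u. G (u, v)) \<in> borel_measurable borel" "(\<lambda>u. F (hartogs_map (u, v))) \<in> borel_measurable borel"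
      by measurable
    show "(\<integral>\<^sup>+u. G (u, v) \<partial>lborel) = ennreal (disc_weight (\<nu> + 2) \<nu> v) * (\<integral>\<^sup>+u. F (hartogs_map (u, v)) \<partial>disc_measure 0 \<nu>)"
    proof (cases "v \<noteq> 0 \<and> norm v < 1")
      case False
      then have "G (u, v) = 0" for u by (auto simp: G_def hartogs_def indicator_def)
      then show ?thesis using False by (auto simp: disc_weight_def)
    next
      case True
      have "(\<integral>\<^sup>+u. G (u, v) \<partial>lborel) = ennreal ((norm v)\<^sup>2) * (\<integral>\<^sup>+u. G (v * u, v) \<partial>lborel)"
        using True by (intro nn_integral_complex_mult) auto
      also have "\<dots> = (\<integral>\<^sup>+u. ennreal ((norm v)\<^sup>2) * G (v * u, v) \<partial>lborel)"
        by (rule nn_integral_cmult[symmetric]) measurable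
      also have "\<dots> = (\<integral>\<^sup>+u. ennreal (disc_weight (\<nu> + 2) \<nu> v) * (ennreal (disc_weight 0 \<nu> u) * F (hartogs_map (u, v))) \<partial>lborel)"
      proof (rule nn_integral_cong_AE, rule AE_mp[OF AE_lborel_singleton[of 0]], intro AE_I2 impI)
        \<comment> \<open>At \<open>u = 0\<close> the two weights disagree, because
          \<open>disc_weight\<close> is set to 0 there; a single point is negligible.\<close>
        fix u :: complex assume u: "u \<noteq> 0"
        show "ennreal ((norm v)\<^sup>2) * G (v * u, v) = ennreal (disc_weight (\<nu> + 2) \<nu> v) * (ennreal (disc_weight 0 \<nu> u) * F (hartogs_map (u, v)))"
        proof (cases "norm u < 1")
          case True
          have v: "v \<noteq> 0" "norm v < 1" using \<open>v \<noteq> 0 \<and> norm v < 1\<close> by auto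
          have h: "(v * u, v) \<in> hartogs" using v True by (simp add: hartogs_def norm_mult)
          have "(norm v)\<^sup>2 * hartogs_weight \<nu> (v * u, v) = disc_weight (\<nu> + 2) \<nu> v * disc_weight 0 \<nu> u"
            using u v True powr_add[of "norm v" \<nu> 2] by (simp add: hartogs_weight_def disc_weight_def mult_ac)
          then have "ennreal ((norm v)\<^sup>2) * ennreal (hartogs_weight \<nu> (v * u, v)) = ennreal (disc_weight (\<nu> + 2) \<nu> v) * ennreal (disc_weight 0 \<nu> u)"
            by (simp add: ennreal_mult[symmetric])
          then show ?thesis using h by (simp add: G_def hartogs_map_def mult.assoc[symmetric]) (simp add: mult_ac)
        next
          case False
          then have "(v * u, v) \<notin> hartogs" using True by (simp add: hartogs_def norm_mult mult_le_cancel_left1 not_less)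
          then show ?thesis using False by (simp add: G_def disc_weight_def)
        qed
      qed
      also have "\<dots> = ennreal (disc_weight (\<nu> + 2) \<nu> v) * (\<integral>\<^sup>+u. ennreal (disc_weight 0 \<nu> u) * F (hartogs_map (u, v)) \<partial>lborel)"
        by (rule nn_integral_cmult) measurable
      also have "(\<integral>\<^sup>+u. ennreal (disc_weight 0 \<nu> u) * F (hartogs_map (u, v)) \<partial>lborel) = (\<integral>\<^sup>+u. F (hartogs_map (u, v)) \<partial>disc_measure 0 \<nu>)"
        by (rule nn_integral_disc_measure[symmetric]) measurable
      finally show ?thesis .
    qed
  qed
  also have "\<dots> = (\<integral>\<^sup>+v. \<integral>\<^sup>+u. F (hartogs_map (u, v)) \<partial>disc_measure 0 \<nu> \<partial>disc_measure (\<nu> + 2) \<nu>)"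
  proof (rule nn_integral_disc_measure[symmetric])
    interpret sigma_finite_measure "disc_measure 0 \<nu>" by (rule sigma_finite_disc_measure)
    show "(\<lambda>v. \<integral>\<^sup>+u. F (hartogs_map (u, v)) \<partial>disc_measure 0 \<nu>) \<in> borel_measurable borel"
      by measurable
  qed
  also have "\<dots> = (\<integral>\<^sup>+w. F (hartogs_map w) \<partial>hartogs_prod \<nu>)"
    by (rule nn_integral_hartogs_prod[symmetric]) measurable
  finally show ?thesis .
qed

lemma emeasure_hartogs_prod:
  "emeasure (hartogs_prod \<nu>) UNIV = emeasure (disc_measure 0 \<nu>) UNIV * emeasure (disc_measure (\<nu> + 2) \<nu>) UNIV"
proof -
  interpret pair_sigma_finite "disc_measure 0 \<nu>" "disc_measure (\<nu> + 2) \<nu>" by (rule pair_sigma_finite_disc)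
  show ?thesis
    using M2.emeasure_pair_measure_Times[of UNIV "disc_measure 0 \<nu>" UNIV] by (simp add: hartogs_prod_def)
qed

lemma emeasure_disc_measure:
  assumes "b > -2" "\<nu> > -1"
  shows "emeasure (disc_measure b \<nu>) UNIV = ennreal (pi * Beta (b / 2 + 1) (\<nu> + 1))"
  using nn_integral_disc_weight[OF assms] by (simp add: disc_measure_def emeasure_density)

text \<open>The total mass is a product of two Beta values, positive and finite. So neither the
  default value 0 of a divergent Bochner integral nor a division by 0 enters the definition of the
  constant.\<close>

lemma hartogs_const_pos:
  assumes "\<nu> > -1"
  shows "hartogs_const \<nu> > 0"
proof -
  define A where "A = pi * Beta (0 / 2 + 1) (\<nu> + 1)"
  define B where "B = pi * Beta ((\<nu> + 2) / 2 + 1) (\<nu> + 1)"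
  have "(\<nu> + 2) / 2 + 1 > 0" using assms by (simp add: field_simps)
  then have AB: "A > 0" "B > 0" unfolding A_def B_def using assms
    by (intro mult_pos_pos Beta_real_pos; simp)+
  have "(\<integral>\<^sup>+z. ennreal (hartogs_weight \<nu> z) \<partial>lebesgue_on hartogs) = emeasure (hartogs_prod \<nu>) UNIV"
    using nn_integral_hartogs_weight[of "\<lambda>_. 1" \<nu>] by simp
  also have "\<dots> = ennreal (A * B)"
    unfolding emeasure_hartogs_prod using assms AB by (subst (1 2) emeasure_disc_measure) (auto simp: A_def B_def ennreal_mult)
  finally have "(\<integral>z. hartogs_weight \<nu> z \<partial>lebesgue_on hartogs) = A * B"
    using AB by (subst integral_eq_nn_integral) (auto intro: borel_measurable_lebesgue_on_hartogs)
  then show ?thesis using AB by (simp add: hartogs_const_def)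
qed

section \<open>Transfer of integrals from the Hartogs triangle to the product of discs\<close>

lemma nn_integral_hartogs:
  assumes F [measurable]: "F \<in> borel_measurable borel" and nu: "\<nu> > -1"
  shows "(\<integral>\<^sup>+z. F z \<partial>hartogs_measure \<nu>) = ennreal (hartogs_const \<nu>) * (\<integral>\<^sup>+w. F (hartogs_map w) \<partial>hartogs_prod \<nu>)"
proof -
  have "(\<integral>\<^sup>+z. F z \<partial>hartogs_measure \<nu>)
      = (\<integral>\<^sup>+z. ennreal (hartogs_const \<nu> * hartogs_weight \<nu> z) * F z \<partial>lebesgue_on hartogs)"
    unfolding hartogs_measure_def
    by (rule nn_integral_density) (auto intro!: borel_measurable_lebesgue_on_hartogs)
  also have "\<dots> = (\<integral>\<^sup>+z. ennreal (hartogs_weight \<nu> z) * (ennreal (hartogs_const \<nu>) * F z) \<partial>lebesgue_on hartogs)"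
    using hartogs_const_pos[OF nu] by (intro nn_integral_cong) (simp add: ennreal_mult mult_ac)
  also have "\<dots> = (\<integral>\<^sup>+w. ennreal (hartogs_const \<nu>) * F (hartogs_map w) \<partial>hartogs_prod \<nu>)"
    by (rule nn_integral_hartogs_weight) measurable
  also have "\<dots> = ennreal (hartogs_const \<nu>) * (\<integral>\<^sup>+w. F (hartogs_map w) \<partial>hartogs_prod \<nu>)"
    by (rule nn_integral_cmult) measurable
  finally show ?thesis .
qed

text \<open>\<open>hartogs_measure\<close> lives on a Lebesgue sigma-algebra over the triangle only.
  Pushing it to the Borel sets makes it comparable with the image of the product measure, and so
  transfers integrability and Bochner integrals of Borel functions.\<close>

lemma distr_hartogs:
  assumes nu: "\<nu> > -1"
  shows "distr (hartogs_measure \<nu>) borel (\<lambda>z. z)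
    = density (distr (hartogs_prod \<nu>) borel hartogs_map) (\<lambda>_. ennreal (hartogs_const \<nu>))"
proof (rule measure_eqI)
  fix A assume "A \<in> sets (distr (hartogs_measure \<nu>) borel (\<lambda>z. z))"
  then have A [measurable]: "A \<in> sets borel" by simp
  have "emeasure (distr (hartogs_measure \<nu>) borel (\<lambda>z. z)) A = (\<integral>\<^sup>+z. indicator A z \<partial>distr (hartogs_measure \<nu>) borel (\<lambda>z. z))"
    by (subst nn_integral_indicator) auto
  also have "\<dots> = (\<integral>\<^sup>+z. indicator A z \<partial>hartogs_measure \<nu>)"
    by (subst nn_integral_distr[OF id_measurable_hartogs]) auto
  also have "\<dots> = ennreal (hartogs_const \<nu>) * (\<integral>\<^sup>+w. indicator A (hartogs_map w) \<partial>hartogs_prod \<nu>)"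
    by (rule nn_integral_hartogs[OF _ nu]) measurable
  also have "\<dots> = ennreal (hartogs_const \<nu>) * (\<integral>\<^sup>+w. indicator A w \<partial>distr (hartogs_prod \<nu>) borel hartogs_map)"
    by (subst nn_integral_distr) auto
  also have "\<dots> = (\<integral>\<^sup>+w. ennreal (hartogs_const \<nu>) * indicator A w \<partial>distr (hartogs_prod \<nu>) borel hartogs_map)"
    by (rule nn_integral_cmult[symmetric]) measurable
  also have "\<dots> = emeasure (density (distr (hartogs_prod \<nu>) borel hartogs_map) (\<lambda>_. ennreal (hartogs_const \<nu>))) A"
    by (subst emeasure_density) auto
  finally show "emeasure (distr (hartogs_measure \<nu>) borel (\<lambda>z. z)) A = \<dots>" .
qed simp

lemma integrable_hartogs_iff:
  fixes F :: "complex \<times> complex \<Rightarrow> 'b::{banach, second_countable_topology}"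
  assumes [measurable]: "F \<in> borel_measurable borel" and nu: "\<nu> > -1"
  shows "integrable (hartogs_measure \<nu>) F \<longleftrightarrow> integrable (hartogs_prod \<nu>) (\<lambda>w. F (hartogs_map w))"
proof -
  have "integrable (hartogs_measure \<nu>) F \<longleftrightarrow> integrable (distr (hartogs_measure \<nu>) borel (\<lambda>z. z)) F"
    by (rule integrable_distr_eq[OF id_measurable_hartogs assms(1), symmetric])
  also have "\<dots> \<longleftrightarrow> integrable (distr (hartogs_prod \<nu>) borel hartogs_map) (\<lambda>z. hartogs_const \<nu> *\<^sub>R F z)"
    unfolding distr_hartogs[OF nu] using hartogs_const_pos[OF nu] by (subst integrable_density) auto
  also have "\<dots> \<longleftrightarrow> integrable (distr (hartogs_prod \<nu>) borel hartogs_map) F"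
  proof
    assume "integrable (distr (hartogs_prod \<nu>) borel hartogs_map) (\<lambda>z. hartogs_const \<nu> *\<^sub>R F z)"
    from integrable_scaleR_right[OF this, of "inverse (hartogs_const \<nu>)"]
    show "integrable (distr (hartogs_prod \<nu>) borel hartogs_map) F"
      using hartogs_const_pos[OF nu] by simp
  qed (rule integrable_scaleR_right)
  also have "\<dots> \<longleftrightarrow> integrable (hartogs_prod \<nu>) (\<lambda>w. F (hartogs_map w))"
    by (rule integrable_distr_eq) measurable
  finally show ?thesis .
qed

lemma integral_hartogs:
  fixes F :: "complex \<times> complex \<Rightarrow> 'b::{banach, second_countable_topology}"
  assumes [measurable]: "F \<in> borel_measurable borel" and nu: "\<nu> > -1"
  shows "(\<integral>z. F z \<partial>hartogs_measure \<nu>) = hartogs_const \<nu> *\<^sub>R (\<integral>w. F (hartogs_map w) \<partial>hartogs_prod \<nu>)"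
proof -
  have "(\<integral>z. F z \<partial>hartogs_measure \<nu>) = (\<integral>z. F z \<partial>distr (hartogs_measure \<nu>) borel (\<lambda>z. z))"
    by (subst integral_distr[OF id_measurable_hartogs]) auto
  also have "\<dots> = (\<integral>z. hartogs_const \<nu> *\<^sub>R F z \<partial>distr (hartogs_prod \<nu>) borel hartogs_map)"
    unfolding distr_hartogs[OF nu] using hartogs_const_pos[OF nu] by (subst integral_density) auto
  also have "\<dots> = hartogs_const \<nu> *\<^sub>R (\<integral>z. F z \<partial>distr (hartogs_prod \<nu>) borel hartogs_map)" by simp
  also have "(\<integral>z. F z \<partial>distr (hartogs_prod \<nu>) borel hartogs_map) = (\<integral>w. F (hartogs_map w) \<partial>hartogs_prod \<nu>)"
    by (rule integral_distr) measurable
  finally show ?thesis .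
qed

lemma emeasure_hartogs_measure:
  assumes "\<nu> > -1"
  shows "emeasure (hartogs_measure \<nu>) hartogs < \<infinity>"
proof -
  have "emeasure (hartogs_measure \<nu>) hartogs = (\<integral>\<^sup>+z. 1 \<partial>hartogs_measure \<nu>)" by simp
  also have "\<dots> = ennreal (hartogs_const \<nu>) * emeasure (hartogs_prod \<nu>) UNIV"
    using nn_integral_hartogs[of "\<lambda>_. 1", OF _ assms] by simp
  also have "\<dots> < \<infinity>"
    unfolding emeasure_hartogs_prod using assms by (subst (1 2) emeasure_disc_measure) (auto simp: ennreal_mult_less_top)
  finally show ?thesis .
qed

lemma finite_hartogs_measure: "\<nu> > -1 \<Longrightarrow> finite_measure (hartogs_measure \<nu>)"
  using emeasure_hartogs_measure[of \<nu>] by (intro finite_measureI) (simp add: less_top)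

text \<open>The slice \<open>fst z = 0\<close> pulls back to a set where a product coordinate is 0.
  It is discarded because the disc estimates are stated at nonzero points.\<close>

lemma AE_hartogs:
  assumes "\<nu> > -1"
  shows "AE z in hartogs_measure \<nu>. z \<in> hartogs \<and> fst z \<noteq> 0"
proof -
  define A where "A = {z::complex \<times> complex. fst z = 0}"
  have [measurable]: "A \<in> sets borel"
    unfolding A_def by (intro borel_closed closed_Collect_eq continuous_intros)
  have "(\<integral>\<^sup>+z. indicator A z \<partial>hartogs_measure \<nu>) = ennreal (hartogs_const \<nu>) * (\<integral>\<^sup>+w. indicator A (hartogs_map w) \<partial>hartogs_prod \<nu>)"
    by (rule nn_integral_hartogs[OF _ assms]) measurable
  also have "(\<integral>\<^sup>+w. indicator A (hartogs_map w) \<partial>hartogs_prod \<nu>) = (\<integral>\<^sup>+v. \<integral>\<^sup>+u. indicator A (hartogs_map (u, v)) \<partial>disc_measure 0 \<nu> \<partial>disc_measure (\<nu> + 2) \<nu>)"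
    by (rule nn_integral_hartogs_prod) measurable
  also have "\<dots> = (\<integral>\<^sup>+v. \<integral>\<^sup>+u. 0 \<partial>disc_measure 0 \<nu> \<partial>disc_measure (\<nu> + 2) \<nu>)"
  proof (rule nn_integral_cong_AE, rule AE_mp[OF AE_disc_measure], intro AE_I2 impI)
    fix v :: complex assume v: "v \<noteq> 0 \<and> norm v < 1"
    show "(\<integral>\<^sup>+u. indicator A (hartogs_map (u, v)) \<partial>disc_measure 0 \<nu>) = (\<integral>\<^sup>+u. 0 \<partial>disc_measure 0 \<nu>)"
      by (rule nn_integral_cong_AE, rule AE_mp[OF AE_disc_measure], intro AE_I2 impI)
        (use v in \<open>auto simp: A_def hartogs_map_def\<close>)
  qed
  finally have "(\<integral>\<^sup>+z. indicator A z \<partial>hartogs_measure \<nu>) = 0" by simp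
  moreover have "(\<lambda>z. indicator A z :: ennreal) \<in> borel_measurable (hartogs_measure \<nu>)"
    by (rule borel_measurable_hartogs) measurable
  ultimately have "AE z in hartogs_measure \<nu>. indicator A z = (0::ennreal)"
    by (subst (asm) nn_integral_0_iff_AE) auto
  then show ?thesis using AE_space
    by eventually_elim (auto simp: A_def indicator_def split: if_splits)
qed

section \<open>The Bergman kernel of the Hartogs triangle\<close>

text \<open>The prefactor compensates the normalising constant in \<open>hartogs_measure\<close>.
  The disc parameters come from \<open>a = 1 + b / 2 - s\<close>: the first factor has
  \<open>b = 0\<close> and no pole, the second has \<open>b = \<nu> + 2\<close>.\<close>

definition bergman_kernel :: "real \<Rightarrow> nat \<Rightarrow> complex \<times> complex \<Rightarrow> complex \<times> complex \<Rightarrow> complex" where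
  "bergman_kernel \<nu> s z u = of_real (1 / hartogs_const \<nu>) *
     disc_kernel \<nu> 1 0 (fst z / snd z) (fst u / snd u) * disc_kernel \<nu> (2 + \<nu> / 2 - real s) s (snd z) (snd u)"

definition bergman_op :: "real \<Rightarrow> nat \<Rightarrow> (complex \<times> complex \<Rightarrow> complex) \<Rightarrow> complex \<times> complex \<Rightarrow> complex" where
  "bergman_op \<nu> s f z = (\<integral>u. bergman_kernel \<nu> s z u * f u \<partial>hartogs_measure \<nu>)"

lemma kernel_gen_measurable [measurable]: "kernel_gen \<nu> a \<in> borel_measurable borel"
  unfolding kernel_gen_def[abs_def] by measurable

lemma disc_kernel_measurable [measurable (raw)]:
  assumes [measurable]: "f \<in> borel_measurable M" "g \<in> borel_measurable M"
  shows "(\<lambda>x. disc_kernel \<nu> a s (f x) (g x)) \<in> borel_measurable M"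
  unfolding disc_kernel_def by measurable

lemma fst_borel: "fst \<in> borel_measurable (borel :: (complex \<times> complex) measure)"
  and snd_borel: "snd \<in> borel_measurable (borel :: (complex \<times> complex) measure)"
  unfolding borel_prod[symmetric] by measurable

lemma fst_hartogs [measurable]: "fst \<in> borel_measurable (hartogs_measure \<nu>)"
  and snd_hartogs [measurable]: "snd \<in> borel_measurable (hartogs_measure \<nu>)"
  by (intro borel_measurable_hartogs fst_borel snd_borel)+

lemma hartogsD:
  assumes "z \<in> hartogs"
  shows "snd z \<noteq> 0" "norm (snd z) < 1" "norm (fst z / snd z) < 1" "norm (fst z) < norm (snd z)"
  using assms by (auto simp: hartogs_def norm_divide divide_less_eq)

text \<open>\<open>s\<close> is the largest integer below \<open>2 + \<nu> / 2\<close>: \<open>1 / snd z ^ s\<close> is the most singular monomial in \<open>A\<^sup>2\<close>.\<close>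

locale hartogs_bergman =
  fixes \<nu> :: real and s :: nat
  assumes nu: "\<nu> > -1" and s: "real s < 2 + \<nu> / 2" "2 + \<nu> / 2 \<le> real s + 1"
begin

abbreviation H where "H \<equiv> hartogs_measure \<nu>"
abbreviation a where "a \<equiv> 2 + \<nu> / 2 - real s"
abbreviation K where "K \<equiv> bergman_kernel \<nu> s"
abbreviation M1 where "M1 \<equiv> disc_measure 0 \<nu>"
abbreviation M2 where "M2 \<equiv> disc_measure (\<nu> + 2) \<nu>"
abbreviation K1 where "K1 \<equiv> disc_kernel \<nu> 1 0"
abbreviation K2 where "K2 \<equiv> disc_kernel \<nu> a s"
abbreviation T where "T \<equiv> bergman_op \<nu> s"

lemma a_bounds: "0 < a" "a \<le> 1" "a = 1 + (\<nu> + 2) / 2 - real s"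
  using s by (auto simp: field_simps)

lemma const_pos: "hartogs_const \<nu> > 0"
  by (rule hartogs_const_pos[OF nu])

lemma sigma_finite_H: "sigma_finite_measure H"
  using finite_hartogs_measure[OF nu] by (rule finite_measure.axioms)

lemma kernel_measurable: "case_prod K \<in> borel_measurable (H \<Otimes>\<^sub>M H)"
proof -
  have [measurable]: "(\<lambda>x. fst (fst x)) \<in> borel_measurable (H \<Otimes>\<^sub>M H)" "(\<lambda>x. snd (fst x)) \<in> borel_measurable (H \<Otimes>\<^sub>M H)"
    "(\<lambda>x. fst (snd x)) \<in> borel_measurable (H \<Otimes>\<^sub>M H)" "(\<lambda>x. snd (snd x)) \<in> borel_measurable (H \<Otimes>\<^sub>M H)"
    using measurable_compose[OF measurable_fst fst_hartogs] measurable_compose[OF measurable_fst snd_hartogs]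
      measurable_compose[OF measurable_snd fst_hartogs] measurable_compose[OF measurable_snd snd_hartogs] by auto
  show ?thesis unfolding case_prod_beta' bergman_kernel_def by measurable
qed

lemma kernel_borel: "K z \<in> borel_measurable borel"
proof -
  note [measurable] = fst_borel snd_borel
  show ?thesis unfolding bergman_kernel_def[abs_def] by measurable
qed

lemma kernel_cnj:
  assumes "z \<in> hartogs" "u \<in> hartogs"
  shows "K u z = cnj (K z u)"
proof -
  have "K1 (fst u / snd u) (fst z / snd z) = cnj (K1 (fst z / snd z) (fst u / snd u))"
    using hartogsD[OF assms(1)] hartogsD[OF assms(2)] nu by (intro disc_kernel_cnj) auto
  moreover have "K2 (snd u) (snd z) = cnj (K2 (snd z) (snd u))"
    using hartogsD[OF assms(1)] hartogsD[OF assms(2)] nu a_bounds(1) by (intro disc_kernel_cnj) simp_all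
  ultimately show ?thesis by (simp add: bergman_kernel_def)
qed

text \<open>A product of Schur weights of the two disc kernels is a Schur weight of the product
  kernel. The first kernel has order 0, so its conditions hold for every \<open>p\<close>; those of
  the second are the assumptions on \<open>s\<close>.\<close>

lemma kernel_schur_weight:
  assumes pq: "p > 1" "q > 1" "1 / p + 1 / q = 1" and sp: "real s * p < \<nu> + 4" "real s * q < \<nu> + 4"
  shows "\<exists>\<phi> C. \<phi> \<in> borel_measurable H \<and> (AE z in H. \<phi> z > (0::real)) \<and> C > 0 \<and>
    (AE z in H. (\<integral>\<^sup>+u. ennreal (norm (K z u) * \<phi> u powr q) \<partial>H) \<le> ennreal (C * \<phi> z powr q)) \<and>
    (AE z in H. (\<integral>\<^sup>+u. ennreal (norm (K z u) * \<phi> u powr p) \<partial>H) \<le> ennreal (C * \<phi> z powr p))"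
proof -
  obtain \<phi>1 C1 where 1: "\<phi>1 \<in> borel_measurable borel" "\<And>u. u \<noteq> 0 \<Longrightarrow> norm u < 1 \<Longrightarrow> \<phi>1 u > (0::real)" "C1 > 0"
    "\<And>w r. w \<noteq> 0 \<Longrightarrow> norm w < 1 \<Longrightarrow> r = p \<or> r = q \<Longrightarrow>
        (\<integral>\<^sup>+u. ennreal (norm (K1 w u) * \<phi>1 u powr r) \<partial>M1) \<le> ennreal (C1 * \<phi>1 w powr r)"
    using disc_schur_weight[of 1 0 0 \<nu> p q] pq nu by auto
  have "real s * p < \<nu> + 2 + 2" "real s * q < \<nu> + 2 + 2" using sp by auto
  then obtain \<phi>2 C2 where 2: "\<phi>2 \<in> borel_measurable borel" "\<And>u. u \<noteq> 0 \<Longrightarrow> norm u < 1 \<Longrightarrow> \<phi>2 u > (0::real)" "C2 > 0"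
    "\<And>w r. w \<noteq> 0 \<Longrightarrow> norm w < 1 \<Longrightarrow> r = p \<or> r = q \<Longrightarrow>
        (\<integral>\<^sup>+u. ennreal (norm (K2 w u) * \<phi>2 u powr r) \<partial>M2) \<le> ennreal (C2 * \<phi>2 w powr r)"
    using disc_schur_weight[OF a_bounds nu pq] by auto
  note [measurable] = 1(1) 2(1)
  define \<phi> where "\<phi> z = \<phi>1 (fst z / snd z) * \<phi>2 (snd z)" for z
  have pos: "\<phi> z > 0" if "z \<in> hartogs" "fst z \<noteq> 0" for z
    unfolding \<phi>_def using hartogsD[OF that(1)] that(2) by (intro mult_pos_pos 1(2) 2(2)) auto
  have bound: "(\<integral>\<^sup>+u. ennreal (norm (K z u) * \<phi> u powr r) \<partial>H) \<le> ennreal (C1 * C2 * \<phi> z powr r)"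
    if z: "z \<in> hartogs" "fst z \<noteq> 0" and r: "r = p \<or> r = q" for z r
  proof -
    define x where "x = fst z / snd z"
    define y where "y = snd z"
    have x: "x \<noteq> 0" "norm x < 1" and y: "y \<noteq> 0" "norm y < 1" using hartogsD[OF z(1)] z(2) by (auto simp: x_def y_def)
    define c where "c = hartogs_const \<nu>"
    have c: "c > 0" unfolding c_def by (rule const_pos)
    note [measurable] = fst_borel snd_borel
    have [measurable]: "\<phi> \<in> borel_measurable borel" unfolding \<phi>_def by measurable
    note [measurable] = kernel_borel
    define f1 where "f1 u = norm (K1 x u) * \<phi>1 u powr r" for u
    define f2 where "f2 v = norm (K2 y v) * \<phi>2 v powr r" for v
    have [measurable]: "f1 \<in> borel_measurable borel" "f2 \<in> borel_measurable borel" unfolding f1_def f2_def by measurable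
    have f12: "f1 u \<ge> 0" "f2 u \<ge> 0" for u by (auto simp: f1_def f2_def)
    have "(\<integral>\<^sup>+u. ennreal (norm (K z u) * \<phi> u powr r) \<partial>H)
      = ennreal c * (\<integral>\<^sup>+w. ennreal (norm (K z (hartogs_map w)) * \<phi> (hartogs_map w) powr r) \<partial>hartogs_prod \<nu>)"
      unfolding c_def by (rule nn_integral_hartogs[OF _ nu]) measurable
    also have "(\<integral>\<^sup>+w. ennreal (norm (K z (hartogs_map w)) * \<phi> (hartogs_map w) powr r) \<partial>hartogs_prod \<nu>)
      = (\<integral>\<^sup>+v. \<integral>\<^sup>+u. ennreal (norm (K z (hartogs_map (u, v))) * \<phi> (hartogs_map (u, v)) powr r) \<partial>M1 \<partial>M2)"
      by (rule nn_integral_hartogs_prod) measurable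
    also have "\<dots> = (\<integral>\<^sup>+v. ennreal (1 / c * f2 v) * (\<integral>\<^sup>+u. ennreal (f1 u) \<partial>M1) \<partial>M2)"
    proof (rule nn_integral_cong_AE, rule AE_mp[OF AE_disc_measure], intro AE_I2 impI)
      fix v :: complex assume v: "v \<noteq> 0 \<and> norm v < 1"
      have "(\<integral>\<^sup>+u. ennreal (norm (K z (hartogs_map (u, v))) * \<phi> (hartogs_map (u, v)) powr r) \<partial>M1)
        = (\<integral>\<^sup>+u. ennreal (1 / c * f2 v) * ennreal (f1 u) \<partial>M1)"
      proof (rule nn_integral_cong_AE, rule AE_mp[OF AE_disc_measure], intro AE_I2 impI)
        fix u :: complex assume u: "u \<noteq> 0 \<and> norm u < 1"
        have "\<phi> (hartogs_map (u, v)) = \<phi>1 u * \<phi>2 v" using v by (simp add: \<phi>_def hartogs_map_def)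
        moreover have "\<phi>1 u > 0" "\<phi>2 v > 0" using u v 1(2) 2(2) by auto
        ultimately have "norm (K z (hartogs_map (u, v))) * \<phi> (hartogs_map (u, v)) powr r = 1 / c * f2 v * f1 u"
          using v c by (simp add: bergman_kernel_def hartogs_map_def f1_def f2_def norm_mult norm_divide powr_mult x_def y_def c_def mult_ac)
        then show "ennreal (norm (K z (hartogs_map (u, v))) * \<phi> (hartogs_map (u, v)) powr r) = ennreal (1 / c * f2 v) * ennreal (f1 u)"
          using c f12 by (simp add: ennreal_mult[symmetric])
      qed
      also have "\<dots> = ennreal (1 / c * f2 v) * (\<integral>\<^sup>+u. ennreal (f1 u) \<partial>M1)"
        by (rule nn_integral_cmult) measurable
      finally show "(\<integral>\<^sup>+u. ennreal (norm (K z (hartogs_map (u, v))) * \<phi> (hartogs_map (u, v)) powr r) \<partial>M1) = \<dots>" .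
    qed
    also have "\<dots> = (\<integral>\<^sup>+v. ennreal (1 / c * f2 v) \<partial>M2) * (\<integral>\<^sup>+u. ennreal (f1 u) \<partial>M1)"
      by (rule nn_integral_multc) measurable
    also have "(\<integral>\<^sup>+v. ennreal (1 / c * f2 v) \<partial>M2) = (\<integral>\<^sup>+v. ennreal (1 / c) * ennreal (f2 v) \<partial>M2)"
      using c f12 by (intro nn_integral_cong ennreal_mult) auto
    also have "\<dots> = ennreal (1 / c) * (\<integral>\<^sup>+v. ennreal (f2 v) \<partial>M2)"
      by (rule nn_integral_cmult) measurable
    finally have "(\<integral>\<^sup>+u. ennreal (norm (K z u) * \<phi> u powr r) \<partial>H)
      = ennreal c * (ennreal (1 / c) * (\<integral>\<^sup>+v. ennreal (f2 v) \<partial>M2) * (\<integral>\<^sup>+u. ennreal (f1 u) \<partial>M1))" .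
    also have "\<dots> \<le> ennreal c * (ennreal (1 / c) * ennreal (C2 * \<phi>2 y powr r) * ennreal (C1 * \<phi>1 x powr r))"
      unfolding f1_def f2_def using r x y by (intro mult_left_mono mult_mono 1(4) 2(4)) auto
    also have "\<dots> = ennreal (C1 * C2 * (\<phi>1 x powr r * \<phi>2 y powr r))"
      using c 1(3) 2(3) by (simp add: ennreal_mult[symmetric] mult_ac)
    also have "\<phi>1 x powr r * \<phi>2 y powr r = \<phi> z powr r"
      using 1(2)[OF x] 2(2)[OF y] by (simp add: \<phi>_def x_def y_def powr_mult)
    finally show ?thesis .
  qed
  have "\<phi> \<in> borel_measurable H" unfolding \<phi>_def by measurable
  moreover have "AE z in H. \<phi> z > 0" using AE_hartogs[OF nu] by eventually_elim (auto intro: pos)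
  moreover have "AE z in H. (\<integral>\<^sup>+u. ennreal (norm (K z u) * \<phi> u powr r) \<partial>H) \<le> ennreal (C1 * C2 * \<phi> z powr r)"
    if "r = p \<or> r = q" for r
    using AE_hartogs[OF nu] by eventually_elim (rule bound[OF _ _ that], auto)
  moreover have "C1 * C2 > 0" using 1(3) 2(3) by simp
  ultimately show ?thesis by (intro exI[of _ \<phi>] exI[of _ "C1 * C2"]) auto
qed

lemma op_bounds:
  assumes p: "p > 1" and sp: "real s * p < \<nu> + 4" "real s * (p / (p - 1)) < \<nu> + 4"
  shows "\<exists>C>0. \<forall>f\<in>Lp \<nu> p. (AE z in H. integrable H (\<lambda>u. K z u * f u)) \<and> T f \<in> Lp \<nu> p \<and>
     Lp_norm \<nu> p (T f) \<le> C * Lp_norm \<nu> p f"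
proof -
  define q where "q = p / (p - 1)"
  have pq: "p > 1" "q > 1" "1 / p + 1 / q = 1" using p by (auto simp: q_def field_simps)
  obtain \<phi> C where phi: "\<phi> \<in> borel_measurable H" "AE z in H. \<phi> z > (0::real)" "C > 0"
    "AE z in H. (\<integral>\<^sup>+u. ennreal (norm (K z u) * \<phi> u powr q) \<partial>H) \<le> ennreal (C * \<phi> z powr q)"
    "AE z in H. (\<integral>\<^sup>+u. ennreal (norm (K z u) * \<phi> u powr p) \<partial>H) \<le> ennreal (C * \<phi> z powr p)"
    using kernel_schur_weight[OF pq] sp q_def by blast
  have sym: "norm (K x y) = norm (K y x)" if "x \<in> space H" "y \<in> space H" for x y
    using kernel_cnj[of x y] that by simp
  have "(AE z in H. integrable H (\<lambda>u. K z u * f u)) \<and> T f \<in> Lp \<nu> p \<and> Lp_norm \<nu> p (T f) \<le> C * Lp_norm \<nu> p f"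
    if f: "f \<in> Lp \<nu> p" for f
  proof -
    have f': "f \<in> borel_measurable H" "integrable H (\<lambda>z. norm (f z) powr p)" using f by (auto simp: Lp_def)
    note S = schur_test_operator[OF sigma_finite_H kernel_measurable sym phi(1,2) pq phi(3,4,5) f']
    have "Lp_norm \<nu> p (T f) \<le> (C powr p * (\<integral>z. norm (f z) powr p \<partial>H)) powr (1 / p)"
      unfolding Lp_norm_def bergman_op_def using p by (intro powr_mono2 S(4)) auto
    also have "\<dots> = C * Lp_norm \<nu> p f"
      unfolding Lp_norm_def using p phi(3) by (subst powr_mult) (auto simp: powr_powr)
    finally have "Lp_norm \<nu> p (T f) \<le> C * Lp_norm \<nu> p f" .
    moreover have "T f \<in> Lp \<nu> p" unfolding Lp_def bergman_op_def using S(2,3) by auto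
    ultimately show ?thesis using S(1) by auto
  qed
  then show ?thesis using phi(3) by blast
qed

lemma Lp_bounded_operator_op:
  assumes p: "p > 1" and sp: "real s * p < \<nu> + 4" "real s * (p / (p - 1)) < \<nu> + 4"
  shows "Lp_bounded_operator \<nu> p T"
proof -
  obtain C where C: "\<And>f. f \<in> Lp \<nu> p \<Longrightarrow> (AE z in H. integrable H (\<lambda>u. K z u * f u)) \<and> T f \<in> Lp \<nu> p \<and>
     Lp_norm \<nu> p (T f) \<le> C * Lp_norm \<nu> p f"
    using op_bounds[OF assms] by blast
  have lin: "AE z in H. T (\<lambda>w. c * f w + d * g w) z = c * T f z + d * T g z" if fg: "f \<in> Lp \<nu> p" "g \<in> Lp \<nu> p" for f g c d
  proof -
    have "AE z in H. integrable H (\<lambda>u. K z u * f u)" "AE z in H. integrable H (\<lambda>u. K z u * g u)"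
      using C fg by auto
    then show ?thesis
    proof eventually_elim
      case (elim z)
      have "T (\<lambda>w. c * f w + d * g w) z = (\<integral>u. c * (K z u * f u) + d * (K z u * g u) \<partial>H)"
        unfolding bergman_op_def by (rule Bochner_Integration.integral_cong) (auto simp: algebra_simps)
      also have "\<dots> = (\<integral>u. c * (K z u * f u) \<partial>H) + (\<integral>u. d * (K z u * g u) \<partial>H)"
        using elim by (intro Bochner_Integration.integral_add) auto
      finally show ?case by (simp add: bergman_op_def)
    qed
  qed
  show ?thesis unfolding Lp_bounded_operator_def
    using C lin by blast
qed

text \<open>The choice of \<open>s\<close> places the exponent 2, its own conjugate, in the
  admissible range. This brings the kernel operator to \<open>L\<^sup>2\<close> by the Schur test
  itself.\<close>

lemma twice_s_less: "real s * 2 < \<nu> + 4" "real s * (2 / (2 - 1)) < \<nu> + 4"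
  using s by auto

lemma op_L2: "\<exists>C>0. \<forall>f\<in>Lp \<nu> 2. (AE z in H. integrable H (\<lambda>u. K z u * f u)) \<and> T f \<in> Lp \<nu> 2 \<and>
     Lp_norm \<nu> 2 (T f) \<le> C * Lp_norm \<nu> 2 f"
  by (rule op_bounds) (use twice_s_less in auto)

lemma op_symmetric:
  assumes "f \<in> Lp \<nu> 2" "g \<in> Lp \<nu> 2"
  shows "L2_inner \<nu> (T f) g = L2_inner \<nu> f (T g)"
proof -
  obtain \<phi> C where phi: "\<phi> \<in> borel_measurable H" "AE z in H. \<phi> z > (0::real)" "C > 0"
    "AE z in H. (\<integral>\<^sup>+u. ennreal (norm (K z u) * \<phi> u powr 2) \<partial>H) \<le> ennreal (C * \<phi> z powr 2)"
    using kernel_schur_weight[of 2 2] twice_s_less by auto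
  have sym: "K y x = cnj (K x y)" if "x \<in> space H" "y \<in> space H" for x y
    using kernel_cnj[of x y] that by simp
  show ?thesis
    unfolding L2_inner_def bergman_op_def
    using assms by (intro schur_operator_symmetric[OF sigma_finite_H kernel_measurable sym phi]) (auto simp: Lp_def)
qed

end

section \<open>Differentiation under the integral sign and holomorphy in two variables\<close>

text \<open>The uniform bound \<open>w\<close> on both partial derivatives makes the integrand
  Lipschitz in \<open>z\<close> with constant \<open>2 * w u\<close>. The normalised remainder of
  the linear approximation is then at most \<open>4 * w u\<close>, and dominated convergence along
  sequences gives the derivative of the integral.\<close>

lemma has_derivative_integral2:
  fixes f :: "complex \<times> complex \<Rightarrow> 'a \<Rightarrow> complex"
  assumes r: "r > 0"
    and d: "\<And>u z. u \<in> space M \<Longrightarrow> z \<in> ball z0 r \<Longrightarrow>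
      ((\<lambda>z. f z u) has_derivative (\<lambda>h. A z u * fst h + B z u * snd h)) (at z)"
    and bound: "\<And>u z. u \<in> space M \<Longrightarrow> z \<in> ball z0 r \<Longrightarrow> norm (A z u) \<le> w u"
      "\<And>u z. u \<in> space M \<Longrightarrow> z \<in> ball z0 r \<Longrightarrow> norm (B z u) \<le> w u"
    and w: "integrable M w" and f: "\<And>z. z \<in> ball z0 r \<Longrightarrow> integrable M (f z)"
    and [measurable]: "A z0 \<in> borel_measurable M" "B z0 \<in> borel_measurable M"
  shows "((\<lambda>z. \<integral>u. f z u \<partial>M) has_derivative (\<lambda>h. (\<integral>u. A z0 u \<partial>M) * fst h + (\<integral>u. B z0 u \<partial>M) * snd h)) (at z0)"
proof -
  have z0: "z0 \<in> ball z0 r" using r by simp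
  have intA: "integrable M (A z0)"
  proof (rule Bochner_Integration.integrable_bound[OF w])
    show "AE u in M. norm (A z0 u) \<le> norm (w u)"
      by (rule AE_I2, rule order_trans[OF bound(1)[OF _ z0]]) auto
  qed measurable
  have intB: "integrable M (B z0)"
  proof (rule Bochner_Integration.integrable_bound[OF w])
    show "AE u in M. norm (B z0 u) \<le> norm (w u)"
      by (rule AE_I2, rule order_trans[OF bound(2)[OF _ z0]]) auto
  qed measurable
  define D where "D h u = A z0 u * fst h + B z0 u * snd h" for h :: "complex \<times> complex" and u
  define E where "E h = (\<integral>u. A z0 u \<partial>M) * fst h + (\<integral>u. B z0 u \<partial>M) * snd h" for h :: "complex \<times> complex"
  have intD: "integrable M (D h)" for h
    unfolding D_def using intA intB by auto
  have E: "E h = (\<integral>u. D h u \<partial>M)" for h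
    unfolding E_def D_def using intA intB by simp
  have normD: "norm (A z u * fst h + B z u * snd h) \<le> 2 * w u * norm h"
    if "u \<in> space M" "z \<in> ball z0 r" for u z and h :: "complex \<times> complex"
  proof -
    have "norm (A z u * fst h + B z u * snd h) \<le> norm (A z u) * norm (fst h) + norm (B z u) * norm (snd h)"
      by (rule order_trans[OF norm_triangle_ineq]) (simp add: norm_mult)
    also have "\<dots> \<le> w u * norm h + w u * norm h"
    proof (intro add_mono mult_mono bound that)
      have "0 \<le> w u" by (rule order_trans[OF norm_ge_zero bound(1)[OF that]])
      then show "0 \<le> w u" "0 \<le> w u" by auto
    qed (use norm_fst_le[of "fst h" "snd h"] norm_snd_le[of "snd h" "fst h"] in auto)
    finally show ?thesis by (simp add: mult_ac)
  qed
  have w0: "0 \<le> w u" if "u \<in> space M" for u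
    by (rule order_trans[OF norm_ge_zero bound(1)[OF that z0]])
  have lip: "norm (f z u - f z0 u) \<le> 2 * w u * norm (z - z0)" if "u \<in> space M" "z \<in> ball z0 r" for u z
  proof (rule differentiable_bound[of "ball z0 r" "\<lambda>z. f z u" "\<lambda>z h. A z u * fst h + B z u * snd h"])
    show "((\<lambda>z. f z u) has_derivative (\<lambda>h. A x u * fst h + B x u * snd h)) (at x within ball z0 r)" if "x \<in> ball z0 r" for x
      using d[OF \<open>u \<in> space M\<close> that] by (rule has_derivative_at_withinI)
    show "onorm (\<lambda>h. A x u * fst h + B x u * snd h) \<le> 2 * w u" if "x \<in> ball z0 r" for x
      using normD[OF \<open>u \<in> space M\<close> that] w0[OF \<open>u \<in> space M\<close>] by (intro onorm_bound) auto
  qed (use that z0 in auto)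
  have bl: "bounded_linear E" unfolding E_def
    by (intro bounded_linear_add bounded_linear_const_mult bounded_linear_fst bounded_linear_snd)
  have "((\<lambda>z. ((\<integral>u. f z u \<partial>M) - (\<integral>u. f z0 u \<partial>M) - E (z - z0)) /\<^sub>R norm (z - z0)) \<longlongrightarrow> 0) (at z0)"
    unfolding tendsto_at_iff_sequentially comp_def
  proof (intro allI impI)
    fix X :: "nat \<Rightarrow> complex \<times> complex" assume X: "\<forall>i. X i \<in> UNIV - {z0}" "X \<longlonglongrightarrow> z0"
    have "eventually (\<lambda>i. X i \<in> ball z0 r) sequentially"
      using tendstoD[OF X(2) r] by (auto simp: dist_commute)
    then obtain N where N: "\<And>i. i \<ge> N \<Longrightarrow> X i \<in> ball z0 r" by (auto simp: eventually_sequentially)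
    \<comment> \<open>Dropping the first \<open>N\<close> terms puts the whole sequence in the ball,
      where the bounds hold for every index.\<close>
    define Y where "Y i = X (i + N)" for i
    have Y: "Y i \<in> ball z0 r" "Y i \<noteq> z0" "Y \<longlonglongrightarrow> z0" for i
      using N X LIMSEQ_ignore_initial_segment[OF X(2), of N] by (auto simp: Y_def[abs_def])
    have eq: "((\<integral>u. f (Y i) u \<partial>M) - (\<integral>u. f z0 u \<partial>M) - E (Y i - z0)) /\<^sub>R norm (Y i - z0)
        = (\<integral>u. (f (Y i) u - f z0 u - D (Y i - z0) u) /\<^sub>R norm (Y i - z0) \<partial>M)" for i
      unfolding E using f[OF Y(1)] f[OF z0] intD by simp
    have "(\<lambda>i. \<integral>u. (f (Y i) u - f z0 u - D (Y i - z0) u) /\<^sub>R norm (Y i - z0) \<partial>M) \<longlonglongrightarrow> (\<integral>u. 0 \<partial>M)"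
    proof (rule integral_dominated_convergence[where w = "\<lambda>u. 4 * w u"])
      show "AE u in M. (\<lambda>i. (f (Y i) u - f z0 u - D (Y i - z0) u) /\<^sub>R norm (Y i - z0)) \<longlonglongrightarrow> 0"
      proof (rule AE_I2)
        fix u assume u: "u \<in> space M"
        have "((\<lambda>z. (f z u - f z0 u - D (z - z0) u) /\<^sub>R norm (z - z0)) \<longlongrightarrow> 0) (at z0)"
          using d[OF u z0] unfolding has_derivative_at_within D_def by simp
        then show "(\<lambda>i. (f (Y i) u - f z0 u - D (Y i - z0) u) /\<^sub>R norm (Y i - z0)) \<longlonglongrightarrow> 0"
          unfolding tendsto_at_iff_sequentially comp_def using Y by blast
      qed
      show "AE u in M. norm ((f (Y i) u - f z0 u - D (Y i - z0) u) /\<^sub>R norm (Y i - z0)) \<le> 4 * w u" for i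
      proof (rule AE_I2)
        fix u assume u: "u \<in> space M"
        have "norm (f (Y i) u - f z0 u - D (Y i - z0) u) \<le> norm (f (Y i) u - f z0 u) + norm (D (Y i - z0) u)"
          by (rule norm_triangle_ineq4)
        also have "\<dots> \<le> 2 * w u * norm (Y i - z0) + 2 * w u * norm (Y i - z0)"
          unfolding D_def by (intro add_mono lip normD u Y z0)
        finally have "norm (f (Y i) u - f z0 u - D (Y i - z0) u) \<le> 4 * w u * norm (Y i - z0)" by simp
        then have "norm (f (Y i) u - f z0 u - D (Y i - z0) u) / norm (Y i - z0) \<le> 4 * w u"
          using Y(2)[of i] by (simp add: divide_le_eq)
        then show "norm ((f (Y i) u - f z0 u - D (Y i - z0) u) /\<^sub>R norm (Y i - z0)) \<le> 4 * w u"
          by (simp add: divide_inverse mult.commute)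
      qed
      show "(\<lambda>u. (f (Y i) u - f z0 u - D (Y i - z0) u) /\<^sub>R norm (Y i - z0)) \<in> borel_measurable M" for i
        using f[OF Y(1)[of i]] f[OF z0] intD[of "Y i - z0"] by (intro borel_measurable_scaleR borel_measurable_diff) auto
    qed (use w in auto)
    then have "(\<lambda>i. ((\<integral>u. f (Y i) u \<partial>M) - (\<integral>u. f z0 u \<partial>M) - E (Y i - z0)) /\<^sub>R norm (Y i - z0)) \<longlonglongrightarrow> 0"
      unfolding eq by simp
    then show "(\<lambda>i. ((\<integral>u. f (X i) u \<partial>M) - (\<integral>u. f z0 u \<partial>M) - E (X i - z0)) /\<^sub>R norm (X i - z0)) \<longlonglongrightarrow> 0"
      unfolding Y_def by (rule LIMSEQ_offset)
  qed
  then have "((\<lambda>z. \<integral>u. f z u \<partial>M) has_derivative E) (at z0)"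
    using bl by (simp add: has_derivative_at_within)
  then show ?thesis unfolding E_def .
qed

lemma holomorphic2_onI_open:
  assumes "open S" "\<And>z. z \<in> S \<Longrightarrow> \<exists>a b. (f has_derivative (\<lambda>h. a * fst h + b * snd h)) (at z)"
  shows "holomorphic2_on f S"
  unfolding holomorphic2_on_def using assms has_derivative_at_withinI by blast

lemma holomorphic2_onD_open:
  assumes "holomorphic2_on f S" "open S" "z \<in> S"
  obtains a b where "(f has_derivative (\<lambda>h. a * fst h + b * snd h)) (at z)"
  using assms at_within_open[OF assms(3,2)] unfolding holomorphic2_on_def by auto

lemma holomorphic2_on_diff:
  assumes "holomorphic2_on f S" "holomorphic2_on g S"
  shows "holomorphic2_on (\<lambda>z. f z - g z) S"
  unfolding holomorphic2_on_def
proof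
  fix z assume z: "z \<in> S"
  obtain a b c d where 1: "(f has_derivative (\<lambda>h. a * fst h + b * snd h)) (at z within S)"
    and 2: "(g has_derivative (\<lambda>h. c * fst h + d * snd h)) (at z within S)"
    using assms z unfolding holomorphic2_on_def by blast
  have "((\<lambda>z. f z - g z) has_derivative (\<lambda>h. (a - c) * fst h + (b - d) * snd h)) (at z within S)"
    using has_derivative_diff[OF 1 2] by (simp add: algebra_simps)
  then show "\<exists>a b. ((\<lambda>z. f z - g z) has_derivative (\<lambda>h. a * fst h + b * snd h)) (at z within S)" by blast
qed

lemma holomorphic2_on_imp_continuous_on: "holomorphic2_on f S \<Longrightarrow> continuous_on S f"
  unfolding holomorphic2_on_def continuous_on_eq_continuous_within
  using has_derivative_continuous by blast

lemma holomorphic2_on_hartogs_borel: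
  assumes "holomorphic2_on f hartogs"
  shows "(\<lambda>z. if z \<in> hartogs then f z else 0) \<in> borel_measurable borel"
proof -
  have "(\<lambda>z. indicator hartogs z *\<^sub>R f z) \<in> borel_measurable borel"
    using holomorphic2_on_imp_continuous_on[OF assms] by (rule borel_measurable_continuous_on_indicator[rotated]) simp
  moreover have "(\<lambda>z. indicator hartogs z *\<^sub>R f z) = (\<lambda>z. if z \<in> hartogs then f z else 0)"
    by (auto simp: indicator_def)
  ultimately show ?thesis by simp
qed

lemma holomorphic2_on_compose_field:
  assumes f: "(f has_derivative (\<lambda>h. a * fst h + b * snd h)) (at (g x, k x))"
    and g: "(g has_field_derivative g') (at x)" and k: "(k has_field_derivative k') (at x)"
  shows "((\<lambda>x. f (g x, k x)) has_field_derivative (a * g' + b * k')) (at x)"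
proof -
  have "((\<lambda>x. (g x, k x)) has_derivative (\<lambda>h. (g' * h, k' * h))) (at x)"
    using g k unfolding has_field_derivative_def by (rule has_derivative_Pair)
  from has_derivative_compose[OF this f]
  have "((\<lambda>x. f (g x, k x)) has_derivative (\<lambda>h. a * (g' * h) + b * (k' * h))) (at x)" by simp
  moreover have "(\<lambda>h. a * (g' * h) + b * (k' * h)) = (*) (a * g' + b * k')"
    by (auto simp: fun_eq_iff algebra_simps)
  ultimately show ?thesis unfolding has_field_derivative_def by simp
qed

lemma powr_2_norm: "norm (x::complex) powr 2 = (norm x)\<^sup>2"
  by (cases "x = 0") simp_all

lemma holomorphic_bounded_deriv_on_cball:
  assumes "g holomorphic_on ball 0 1" "r < 1"
  shows "\<exists>B. \<forall>x. norm x \<le> r \<longrightarrow> norm (g x) \<le> B \<and> norm (deriv g x) \<le> B"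
proof -
  have sub: "cball 0 r \<subseteq> ball (0::complex) 1" using assms(2) by auto
  have "continuous_on (cball 0 r) g" "continuous_on (cball 0 r) (deriv g)"
    using assms(1) holomorphic_deriv[OF assms(1)] sub
    by (meson continuous_on_subset holomorphic_on_imp_continuous_on open_ball)+
  then have "bounded (g ` cball 0 r)" "bounded (deriv g ` cball 0 r)"
    by (intro compact_imp_bounded compact_continuous_image; simp)+
  then obtain B1 B2 where "\<And>x. norm x \<le> r \<Longrightarrow> norm (g x) \<le> B1" "\<And>x. norm x \<le> r \<Longrightarrow> norm (deriv g x) \<le> B2"
    unfolding bounded_iff by (metis imageI mem_cball_0)
  then show ?thesis by (intro exI[of _ "max B1 B2"]) (auto simp: le_max_iff_disj)
qed

context hartogs_bergman
begin

lemma G_holomorphic: "kernel_gen \<nu> 1 holomorphic_on ball 0 1" "kernel_gen \<nu> a holomorphic_on ball 0 1"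
  by (intro kernel_gen_holomorphic zero_less_one a_bounds(1) nu)+

text \<open>No restriction is put on \<open>x\<close>, so that both convergence and divergence of
  powers of the second coordinate can be read off.\<close>

lemma nn_integral_snd_powr:
  "(\<integral>\<^sup>+u. ennreal (norm (snd u) powr x) \<partial>H) = ennreal (hartogs_const \<nu>) *
     ((\<integral>\<^sup>+v. ennreal (disc_weight (\<nu> + 2 + x) \<nu> v) \<partial>lborel) * emeasure M1 UNIV)"
proof -
  note [measurable] = snd_borel
  have "(\<integral>\<^sup>+w. ennreal (norm (snd (hartogs_map w)) powr x) \<partial>hartogs_prod \<nu>)
     = (\<integral>\<^sup>+v. \<integral>\<^sup>+u. ennreal (norm v powr x * (1 - (norm v)\<^sup>2) powr 0) \<partial>M1 \<partial>M2)"
  proof (subst nn_integral_hartogs_prod, measurable, rule nn_integral_cong_AE, rule AE_mp[OF AE_disc_measure], intro AE_I2 impI)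
    fix v :: complex assume "v \<noteq> 0 \<and> norm v < 1"
    then have "(norm v)\<^sup>2 < 1" by (simp add: abs_square_less_1)
    then show "(\<integral>\<^sup>+u. ennreal (norm (snd (hartogs_map (u, v))) powr x) \<partial>M1)
      = (\<integral>\<^sup>+u. ennreal (norm v powr x * (1 - (norm v)\<^sup>2) powr 0) \<partial>M1)"
      by (simp add: hartogs_map_def)
  qed
  also have "\<dots> = (\<integral>\<^sup>+v. ennreal (norm v powr x * (1 - (norm v)\<^sup>2) powr 0) * emeasure M1 UNIV \<partial>M2)"
    by simp
  also have "\<dots> = (\<integral>\<^sup>+v. ennreal (norm v powr x * (1 - (norm v)\<^sup>2) powr 0) \<partial>M2) * emeasure M1 UNIV"
    by (rule nn_integral_multc) measurable
  also have "(\<integral>\<^sup>+v. ennreal (norm v powr x * (1 - (norm v)\<^sup>2) powr 0) \<partial>M2)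
      = (\<integral>\<^sup>+v. ennreal (disc_weight (\<nu> + 2 + x) \<nu> v) \<partial>lborel)"
    by (subst nn_integral_disc_measure_powr) simp
  finally have "(\<integral>\<^sup>+w. ennreal (norm (snd (hartogs_map w)) powr x) \<partial>hartogs_prod \<nu>)
     = (\<integral>\<^sup>+v. ennreal (disc_weight (\<nu> + 2 + x) \<nu> v) \<partial>lborel) * emeasure M1 UNIV" .
  moreover have "(\<integral>\<^sup>+u. ennreal (norm (snd u) powr x) \<partial>H)
     = ennreal (hartogs_const \<nu>) * (\<integral>\<^sup>+w. ennreal (norm (snd (hartogs_map w)) powr x) \<partial>hartogs_prod \<nu>)"
    by (rule nn_integral_hartogs[OF _ nu]) measurable
  ultimately show ?thesis by simp
qed

lemma emeasure_disc_0: "0 < emeasure M1 UNIV" "emeasure M1 UNIV < \<infinity>"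
proof -
  have "pi * Beta (0 / 2 + 1) (\<nu> + 1) > 0" using nu by (intro mult_pos_pos Beta_real_pos) auto
  then show "0 < emeasure M1 UNIV" "emeasure M1 UNIV < \<infinity>"
    using emeasure_disc_measure[of 0 \<nu>] nu by simp_all
qed

lemma integrable_snd_powr:
  assumes "x > - (\<nu> + 4)"
  shows "integrable H (\<lambda>u. norm (snd u) powr x)"
proof (rule integrableI_bounded)
  show "(\<lambda>u. norm (snd u) powr x) \<in> borel_measurable H" by measurable
  show "(\<integral>\<^sup>+u. ennreal (norm (norm (snd u) powr x)) \<partial>H) < \<infinity>"
    using nn_integral_snd_powr[of x] nn_integral_disc_weight_finite[of "\<nu> + 2 + x" \<nu>] assms nu emeasure_disc_0
    by (simp add: ennreal_mult_less_top)
qed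

lemma nn_integral_snd_powr_infinite:
  assumes "x \<le> - (\<nu> + 4)"
  shows "(\<integral>\<^sup>+u. ennreal (norm (snd u) powr x) \<partial>H) = \<infinity>"
proof -
  have "\<infinity> = (\<integral>\<^sup>+v\<in>ball 0 1. ennreal (disc_weight (\<nu> + 2 + x) \<nu> v) \<partial>lborel)"
    using assms by (intro nn_integral_disc_weight_infinite[symmetric]) auto
  also have "\<dots> \<le> (\<integral>\<^sup>+v. ennreal (disc_weight (\<nu> + 2 + x) \<nu> v) \<partial>lborel)"
    by (intro nn_integral_mono) (simp add: indicator_def)
  finally have "(\<integral>\<^sup>+v. ennreal (disc_weight (\<nu> + 2 + x) \<nu> v) \<partial>lborel) = \<infinity>" by (simp add: top_unique)
  then show ?thesis
    using nn_integral_snd_powr[of x] emeasure_disc_0 const_pos by (simp add: ennreal_mult_top ennreal_top_mult)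
qed

text \<open>The kernel separates: \<open>1 / snd z ^ s\<close> leaves the integral, and
  \<open>1 / cnj (snd u) ^ s\<close> joins \<open>f\<close>, giving an integrable \<open>F\<close>
  because both factors are square integrable. What remains, \<Psi>, is differentiated under the
  integral on the bidisc and composed with the map to \<open>(fst z / snd z, snd z)\<close>.\<close>

lemma op_holomorphic:
  assumes f: "f \<in> Lp \<nu> 2"
  shows "holomorphic2_on (T f) hartogs"
proof (rule holomorphic2_onI_open[OF hartogs_open])
  fix z0 :: "complex \<times> complex" assume z0: "z0 \<in> hartogs"
  have [measurable]: "f \<in> borel_measurable H" using f by (simp add: Lp_def)
  define F where "F u = f u * (1 / cnj (snd u) ^ s)" for u
  have intF: "integrable H F"
    unfolding F_def
  proof (rule integrable_mult_of_squares)
    show "integrable H (\<lambda>u. (norm (f u))\<^sup>2)" using f by (simp add: Lp_def powr_2_norm)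
    have "integrable H (\<lambda>u. norm (snd u) powr (- 2 * real s))"
      using s by (intro integrable_snd_powr) auto
    then show "integrable H (\<lambda>u. (norm (1 / cnj (snd u) ^ s))\<^sup>2)"
    proof (rule Bochner_Integration.integrable_cong[THEN iffD1, rotated 2])
      fix u assume "u \<in> space H"
      then have u: "snd u \<noteq> 0" using hartogsD(1)[of u] by simp
      have "norm (snd u) powr (- 2 * real s) = 1 / (norm (snd u) ^ s)\<^sup>2"
        using u powr_realpow[of "norm (snd u)" "2 * s"]
        by (simp add: powr_minus divide_inverse power_mult[symmetric] mult.commute)
      then show "norm (snd u) powr (- 2 * real s) = (norm (1 / cnj (snd u) ^ s))\<^sup>2"
        by (simp add: norm_divide norm_power power_divide)
    qed simp
  qed measurable
  have [measurable]: "F \<in> borel_measurable H" using intF by auto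
  define G1 where "G1 = kernel_gen \<nu> 1"
  define G2 where "G2 = kernel_gen \<nu> a"
  have hol: "G1 holomorphic_on ball 0 1" "G2 holomorphic_on ball 0 1" unfolding G1_def G2_def by (rule G_holomorphic)+
  have [measurable]: "G1 \<in> borel_measurable borel" "G2 \<in> borel_measurable borel" unfolding G1_def G2_def by measurable
  define x where "x u = cnj (fst u / snd u)" for u :: "complex \<times> complex"
  define y where "y u = cnj (snd u)" for u :: "complex \<times> complex"
  have [measurable]: "x \<in> borel_measurable H" "y \<in> borel_measurable H" unfolding x_def y_def by measurable
  have xy: "norm (x u) < 1" "norm (y u) < 1" if "u \<in> space H" for u
    unfolding x_def y_def complex_mod_cnj using hartogsD[of u] that by simp_all
  define \<Psi> where "\<Psi> w = (\<integral>u. G1 (fst w * x u) * G2 (snd w * y u) * F u \<partial>H)" for w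
  have d\<Psi>: "\<exists>\<alpha> \<beta>. (\<Psi> has_derivative (\<lambda>h. \<alpha> * fst h + \<beta> * snd h)) (at w0)"
    if w0: "norm (fst w0) < 1" "norm (snd w0) < 1" for w0
  proof -
    define R where "R = max (norm (fst w0)) (norm (snd w0))"
    \<comment> \<open>The radius \<open>R + r\<close> lies midway between \<open>R\<close> and 1, so
      every argument met by \<open>G1\<close> and \<open>G2\<close> stays in a compact disc where
      they and their derivatives are bounded.\<close>
    define r where "r = (1 - R) / 2"
    have R: "R < 1" using w0 by (simp add: R_def)
    then have r: "r > 0" by (simp add: r_def)
    have Rr: "R + r < 1" using R by (simp add: r_def field_simps)
    obtain B1 where B1: "\<And>x. norm x \<le> R + r \<Longrightarrow> norm (G1 x) \<le> B1 \<and> norm (deriv G1 x) \<le> B1"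
      using holomorphic_bounded_deriv_on_cball[OF hol(1) Rr] by blast
    obtain B2 where B2: "\<And>x. norm x \<le> R + r \<Longrightarrow> norm (G2 x) \<le> B2 \<and> norm (deriv G2 x) \<le> B2"
      using holomorphic_bounded_deriv_on_cball[OF hol(2) Rr] by blast
    have small: "norm (fst w * x u) \<le> R + r" "norm (snd w * y u) \<le> R + r"
      "norm (fst w * x u) < 1" "norm (snd w * y u) < 1" if w: "w \<in> ball w0 r" and u: "u \<in> space H" for w u
    proof -
      have "norm (fst w - fst w0) \<le> norm (w - w0)" "norm (snd w - snd w0) \<le> norm (w - w0)"
        using norm_fst_le[of "fst (w - w0)" "snd (w - w0)"] norm_snd_le[of "snd (w - w0)" "fst (w - w0)"]
        by (simp_all add: minus_prod_def)
      moreover have "norm (w - w0) < r" using w by (simp add: dist_norm norm_minus_commute)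
      moreover have "norm (fst w) \<le> norm (fst w0) + norm (fst w - fst w0)" "norm (snd w) \<le> norm (snd w0) + norm (snd w - snd w0)"
        by (rule norm_triangle_sub)+
      moreover have "norm (fst w0) \<le> R" "norm (snd w0) \<le> R" by (auto simp: R_def)
      ultimately have 1: "norm (fst w) \<le> R + r" "norm (snd w) \<le> R + r" by linarith+
      have "norm (fst w * x u) \<le> (R + r) * 1" "norm (snd w * y u) \<le> (R + r) * 1"
        unfolding norm_mult using 1 xy[OF u] by (intro mult_mono; simp add: order_trans[OF norm_ge_zero 1(1)])+
      then show "norm (fst w * x u) \<le> R + r" "norm (snd w * y u) \<le> R + r"
      "norm (fst w * x u) < 1" "norm (snd w * y u) < 1" using Rr by auto
    qed
    have w00: "w0 \<in> ball w0 r" using r by simp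
    have Bpos: "B1 \<ge> 0" "B2 \<ge> 0"
    proof -
      have "0 \<le> R" by (simp add: R_def le_max_iff_disj)
      then have "norm (0::complex) \<le> R + r" using r by simp
      then show "B1 \<ge> 0" "B2 \<ge> 0" using B1[of 0] B2[of 0] norm_ge_zero[of "G1 0"] norm_ge_zero[of "G2 0"] by linarith+
    qed
    define A where "A w u = x u * deriv G1 (fst w * x u) * G2 (snd w * y u) * F u" for w u
    define B where "B w u = y u * G1 (fst w * x u) * deriv G2 (snd w * y u) * F u" for w u
    \<comment> \<open>Nothing is known about \<open>deriv G\<close> outside the unit disc, so it is
      cut off there first; the arguments never leave the disc.\<close>
    have [measurable]: "(\<lambda>u. deriv G (c * X u)) \<in> borel_measurable H"
      if "G holomorphic_on ball 0 1" "X \<in> borel_measurable H" "\<And>u. u \<in> space H \<Longrightarrow> norm (c * X u) < 1" for G X c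
    proof -
      have "(\<lambda>v. indicator (ball 0 1) v *\<^sub>R deriv G v) \<in> borel_measurable borel"
        using holomorphic_deriv[OF that(1)] by (intro borel_measurable_continuous_on_indicator holomorphic_on_imp_continuous_on) auto
      then have "(\<lambda>u. indicator (ball 0 1) (c * X u) *\<^sub>R deriv G (c * X u)) \<in> borel_measurable H"
        using that(2) by measurable
      then show ?thesis
        by (rule measurable_cong[THEN iffD1, rotated]) (use that(3) in \<open>auto simp: indicator_def\<close>)
    qed
    have "((\<lambda>w. \<integral>u. G1 (fst w * x u) * G2 (snd w * y u) * F u \<partial>H) has_derivative
       (\<lambda>h. (\<integral>u. A w0 u \<partial>H) * fst h + (\<integral>u. B w0 u \<partial>H) * snd h)) (at w0)"
    proof (rule has_derivative_integral2[where w = "\<lambda>u. B1 * B2 * norm (F u)" and r = r and A = A and B = B])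
      fix u w assume u: "u \<in> space H" and w: "w \<in> ball w0 r"
      note sm = small[OF w u]
      have dG1: "(G1 has_field_derivative deriv G1 (fst w * x u)) (at (fst w * x u))"
        using hol(1) sm by (intro holomorphic_derivI[where S = "ball 0 1"]) auto
      have dG2: "(G2 has_field_derivative deriv G2 (snd w * y u)) (at (snd w * y u))"
        using hol(2) sm by (intro holomorphic_derivI[where S = "ball 0 1"]) auto
      have 1: "((\<lambda>w. G1 (fst w * x u)) has_derivative (\<lambda>h. deriv G1 (fst w * x u) * (fst h * x u))) (at w)"
      proof -
        have "((\<lambda>w. fst w * x u) has_derivative (\<lambda>h. fst h * x u)) (at w)"
          by (auto intro!: derivative_eq_intros)
        from has_derivative_compose[OF this, of G1 "(*) (deriv G1 (fst w * x u))"] show ?thesis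
          using dG1 by (simp add: has_field_derivative_def)
      qed
      have 2: "((\<lambda>w. G2 (snd w * y u)) has_derivative (\<lambda>h. deriv G2 (snd w * y u) * (snd h * y u))) (at w)"
      proof -
        have "((\<lambda>w. snd w * y u) has_derivative (\<lambda>h. snd h * y u)) (at w)"
          by (auto intro!: derivative_eq_intros)
        from has_derivative_compose[OF this, of G2 "(*) (deriv G2 (snd w * y u))"] show ?thesis
          using dG2 by (simp add: has_field_derivative_def)
      qed
      show "((\<lambda>w. G1 (fst w * x u) * G2 (snd w * y u) * F u) has_derivative (\<lambda>h. A w u * fst h + B w u * snd h)) (at w)"
        by (rule has_derivative_eq_rhs[OF has_derivative_mult_left[OF has_derivative_mult[OF 1 2]]])
          (simp add: A_def B_def fun_eq_iff algebra_simps)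
      have "norm (A w u) \<le> 1 * B1 * B2 * norm (F u)" unfolding A_def norm_mult
        using xy[OF u] B1[OF sm(1)] B2[OF sm(2)] Bpos by (intro mult_mono) auto
      then show "norm (A w u) \<le> B1 * B2 * norm (F u)" by simp
      have "norm (B w u) \<le> 1 * B1 * B2 * norm (F u)" unfolding B_def norm_mult
        using xy[OF u] B1[OF sm(1)] B2[OF sm(2)] Bpos by (intro mult_mono) auto
      then show "norm (B w u) \<le> B1 * B2 * norm (F u)" by simp
    next
      fix w assume w: "w \<in> ball w0 r"
      show "integrable H (\<lambda>u. G1 (fst w * x u) * G2 (snd w * y u) * F u)"
      proof (rule Bochner_Integration.integrable_bound[of _ "\<lambda>u. B1 * B2 * norm (F u)"])
        show "AE u in H. norm (G1 (fst w * x u) * G2 (snd w * y u) * F u) \<le> norm (B1 * B2 * norm (F u))"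
        proof (rule AE_I2)
          fix u assume u: "u \<in> space H"
          show "norm (G1 (fst w * x u) * G2 (snd w * y u) * F u) \<le> norm (B1 * B2 * norm (F u))"
            unfolding norm_mult using B1[OF small(1)[OF w u]] B2[OF small(2)[OF w u]] Bpos by (intro mult_mono) auto
        qed
      qed (use intF in auto)
    next
      show "A w0 \<in> borel_measurable H" "B w0 \<in> borel_measurable H"
        unfolding A_def B_def using hol small[OF w00] by measurable
    qed (use r intF in auto)
    then show ?thesis unfolding \<Psi>_def[abs_def] by blast
  qed
  define c where "c = complex_of_real (1 / hartogs_const \<nu>)"
  have T: "T f z = c * (1 / snd z ^ s) * \<Psi> (fst z / snd z, snd z)" for z
    unfolding bergman_op_def \<Psi>_def c_def
    by (subst integral_mult_right_zero[symmetric], rule Bochner_Integration.integral_cong)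
      (auto simp: bergman_kernel_def disc_kernel_def F_def x_def y_def G1_def G2_def power_mult_distrib)
  define w0 where "w0 = (fst z0 / snd z0, snd z0)"
  have "norm (fst w0) < 1" "norm (snd w0) < 1" using hartogsD[OF z0] by (auto simp: w0_def)
  then obtain \<alpha> \<beta> where \<Psi>: "(\<Psi> has_derivative (\<lambda>h. \<alpha> * fst h + \<beta> * snd h)) (at w0)" using d\<Psi> by blast
  have z2: "snd z0 \<noteq> 0" using hartogsD[OF z0] by simp
  have dm: "((\<lambda>z. (fst z / snd z, snd z)) has_derivative (\<lambda>h. (fst h / snd z0 - fst z0 * snd h / (snd z0)\<^sup>2, snd h))) (at z0)"
    using z2 by (auto intro!: derivative_eq_intros simp: fun_eq_iff divide_simps power2_eq_square algebra_simps)
  have d1: "((\<lambda>z. \<Psi> (fst z / snd z, snd z)) has_derivative (\<lambda>h. \<alpha> * (fst h / snd z0 - fst z0 * snd h / (snd z0)\<^sup>2) + \<beta> * snd h)) (at z0)"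
    using has_derivative_compose[OF dm \<Psi>[unfolded w0_def]] by simp
  obtain p' where "((\<lambda>x. c * (1 / x ^ s)) has_field_derivative p') (at (snd z0))"
  proof -
    have "(\<lambda>x. c * (1 / x ^ s)) field_differentiable at (snd z0)"
      using z2 by (intro derivative_intros) auto
    then show ?thesis using that field_differentiable_def by blast
  qed
  then have d2: "((\<lambda>z. c * (1 / snd z ^ s)) has_derivative (\<lambda>h. p' * snd h)) (at z0)"
    unfolding has_field_derivative_def
    by (rule has_derivative_compose[OF has_derivative_snd[OF has_derivative_ident]])
  define P where "P = c * (1 / snd z0 ^ s)"
  define Q where "Q = \<Psi> (fst z0 / snd z0, snd z0)"
  have "(T f has_derivative (\<lambda>h. P * (\<alpha> * (fst h / snd z0 - fst z0 * snd h / (snd z0)\<^sup>2) + \<beta> * snd h) + p' * snd h * Q)) (at z0)"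
    unfolding T[abs_def] P_def Q_def by (rule has_derivative_mult[OF d2 d1])
  also have "(\<lambda>h. P * (\<alpha> * (fst h / snd z0 - fst z0 * snd h / (snd z0)\<^sup>2) + \<beta> * snd h) + p' * snd h * Q)
    = (\<lambda>h. (P * \<alpha> / snd z0) * fst h + (P * \<beta> - P * \<alpha> * fst z0 / (snd z0)\<^sup>2 + p' * Q) * snd h)"
    by (simp add: fun_eq_iff algebra_simps)
  finally show "\<exists>a b. (T f has_derivative (\<lambda>h. a * fst h + b * snd h)) (at z0)" by blast
qed

section \<open>The projection and its necessary conditions\<close>

lemma slice_measurable: "F \<in> borel_measurable borel \<Longrightarrow> (\<lambda>u. F (hartogs_map (u, v))) \<in> borel_measurable borel"
proof -
  assume [measurable]: "F \<in> borel_measurable borel"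
  show ?thesis by measurable
qed

text \<open>The order of integration matters later: with \<open>v\<close> fixed, the inner integral
  reproduces a slice in the first variable.\<close>

lemma op_eq_iterated:
  assumes F [measurable]: "F \<in> borel_measurable borel" and int: "integrable H (\<lambda>u. K z u * F u)"
  shows "T F z = (\<integral>v. K2 (snd z) v *
      (\<integral>u. K1 (fst z / snd z) u * F (hartogs_map (u, v)) \<partial>M1) \<partial>M2)"
proof -
  let ?J = "\<lambda>v. \<integral>u. K z (hartogs_map (u, v)) * F (hartogs_map (u, v)) \<partial>M1"
  let ?I = "\<lambda>v. \<integral>u. K1 (fst z / snd z) u * F (hartogs_map (u, v)) \<partial>M1"
  interpret pair_sigma_finite M1 M2 by (rule pair_sigma_finite_disc)
  note [measurable] = kernel_borel
  define c where "c = complex_of_real (hartogs_const \<nu>)"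
  have c: "c \<noteq> 0" using const_pos by (simp add: c_def)
  have "integrable (hartogs_prod \<nu>) (\<lambda>w. K z (hartogs_map w) * F (hartogs_map w))"
    using int by (subst (asm) integrable_hartogs_iff[OF _ nu]) auto
  then have int': "integrable (M1 \<Otimes>\<^sub>M M2) (\<lambda>(u, v). K z (hartogs_map (u, v)) * F (hartogs_map (u, v)))"
    by (simp add: hartogs_prod_def case_prod_beta')
  have "T F z = hartogs_const \<nu> *\<^sub>R (\<integral>w. K z (hartogs_map w) * F (hartogs_map w) \<partial>hartogs_prod \<nu>)"
    unfolding bergman_op_def by (rule integral_hartogs[OF _ nu]) measurable
  also have "(\<integral>w. K z (hartogs_map w) * F (hartogs_map w) \<partial>hartogs_prod \<nu>)
    = (\<integral>v. ?J v \<partial>M2)"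
    using integral_snd[OF int'] by (simp add: hartogs_prod_def case_prod_beta')
  also have "\<dots> = (\<integral>v. (1 / c) * (K2 (snd z) v *
      ?I v) \<partial>M2)"
  proof (rule integral_cong_AE)
    show "AE v in M2. ?J v
      = (1 / c) * (K2 (snd z) v *
      ?I v)"
      using AE_disc_measure
    proof eventually_elim
      case (elim v)
      have "?J v
        = (\<integral>u. (1 / c * K2 (snd z) v) * (K1 (fst z / snd z) u * F (hartogs_map (u, v))) \<partial>M1)"
        using elim by (intro Bochner_Integration.integral_cong) (auto simp: bergman_kernel_def hartogs_map_def c_def)
      also have "\<dots> = (1 / c * K2 (snd z) v) * ?I v"
        by (rule integral_mult_right_zero)
      finally show ?case by (simp only: mult.assoc)
    qed
    show "(\<lambda>v. \<integral>u. K z (hartogs_map (u, v)) * F (hartogs_map (u, v)) \<partial>M1) \<in> borel_measurable M2"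
      by measurable
    show "(\<lambda>v. (1 / c) * (K2 (snd z) v *
      ?I v)) \<in> borel_measurable M2"
      by measurable
  qed
  also have "\<dots> = (1 / c) * (\<integral>v. K2 (snd z) v *
      ?I v \<partial>M2)"
    by (rule integral_mult_right_zero)
  finally show ?thesis using c by (simp add: scaleR_conv_of_real c_def)
qed

lemma op_cong: "(\<And>u. u \<in> hartogs \<Longrightarrow> f u = g u) \<Longrightarrow> T f = T g"
  unfolding bergman_op_def by (intro ext Bochner_Integration.integral_cong) auto

lemma disc_kernel_first_bound:
  assumes x: "norm x < 1"
  shows "\<exists>A\<ge>0. \<forall>u. norm u < 1 \<longrightarrow> norm (K1 x u) \<le> A"
proof -
  obtain B where B: "\<And>y. norm y \<le> norm x \<Longrightarrow> norm (kernel_gen \<nu> 1 y) \<le> B"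
    using holomorphic_bounded_deriv_on_cball[OF G_holomorphic(1) x] by blast
  have "norm (K1 x u) \<le> max B 0" if "norm u < 1" for u
  proof -
    have "norm (x * cnj u) \<le> norm x" using that by (simp add: norm_mult mult_left_le)
    then show ?thesis using B[of "x * cnj u"] by (simp add: disc_kernel_def le_max_iff_disj)
  qed
  then show ?thesis by (intro exI[of _ "max B 0"]) auto
qed

text \<open>The one-variable reproducing formula is used twice: first along
  \<open>u \<mapsto> h (u * v, v)\<close> for fixed \<open>v\<close>, giving the value at
  \<open>x\<close>, then along \<open>v \<mapsto> h (x * v, v)\<close>. Square integrability of the
  second function is not given, but follows from the first formula.\<close>

lemma op_reproducing_at:
  assumes h: "h \<in> Ap \<nu> 2" and z: "z \<in> hartogs" "fst z \<noteq> 0" and int: "integrable H (\<lambda>u. K z u * h u)"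
  shows "T h z = h z"
proof -
  have hol: "holomorphic2_on h hartogs" using h by (simp add: Ap_def)
  \<comment> \<open>Values of \<open>h\<close> off the triangle are arbitrary; cutting them off
    makes the function Borel on the whole space.\<close>
  define h0 where "h0 z = (if z \<in> hartogs then h z else 0)" for z
  have h0 [measurable]: "h0 \<in> borel_measurable borel"
    unfolding h0_def using holomorphic2_on_hartogs_borel[OF hol] .
  define x where "x = fst z / snd z"
  define y where "y = snd z"
  have x: "x \<noteq> 0" "norm x < 1" and y: "y \<noteq> 0" "norm y < 1" using hartogsD[OF z(1)] z(2) by (auto simp: x_def y_def)
  have zxy: "z = (x * y, y)" using y by (auto simp: x_def y_def prod_eq_iff)
  have hh0: "h0 u = h u" if "u \<in> hartogs" for u using that by (simp add: h0_def)
  have inH: "(u * v, v) \<in> hartogs" if "norm u < 1" "v \<noteq> 0" "norm v < 1" for u v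
    using that by (simp add: hartogs_def norm_mult)
  interpret m1: finite_measure M1 using nu by (intro finite_disc_measure) auto
  \<comment> \<open>The squared norm of a slice; by Tonelli it is finite for almost every
    \<open>v\<close>.\<close>
  define N where "N v = (\<integral>\<^sup>+u. ennreal ((norm (h0 (hartogs_map (u, v))))\<^sup>2) \<partial>M1)" for v
  have [measurable]: "N \<in> borel_measurable borel" unfolding N_def by measurable
  have Nfin: "(\<integral>\<^sup>+v. N v \<partial>M2) < \<infinity>"
  proof -
    have "integrable H (\<lambda>u. (norm (h u))\<^sup>2)" using h by (simp add: Ap_def Lp_def powr_2_norm)
    then have "(\<integral>\<^sup>+u. ennreal ((norm (h u))\<^sup>2) \<partial>H) < \<infinity>" by (simp add: integrable_iff_bounded)
    also have "(\<integral>\<^sup>+u. ennreal ((norm (h u))\<^sup>2) \<partial>H) = (\<integral>\<^sup>+u. ennreal ((norm (h0 u))\<^sup>2) \<partial>H)"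
      by (rule nn_integral_cong) (simp add: hh0)
    also have "\<dots> = ennreal (hartogs_const \<nu>) * (\<integral>\<^sup>+w. ennreal ((norm (h0 (hartogs_map w)))\<^sup>2) \<partial>hartogs_prod \<nu>)"
      by (rule nn_integral_hartogs[OF _ nu]) measurable
    also have "(\<integral>\<^sup>+w. ennreal ((norm (h0 (hartogs_map w)))\<^sup>2) \<partial>hartogs_prod \<nu>) = (\<integral>\<^sup>+v. N v \<partial>M2)"
      unfolding N_def by (rule nn_integral_hartogs_prod) measurable
    finally show ?thesis using const_pos by (auto simp: ennreal_mult_less_top)
  qed
  then have AEN: "AE v in M2. N v < \<infinity>"
    using nn_integral_PInf_AE[of N M2] by (auto simp: less_top)
  have slice: "(\<integral>u. K1 x u * h0 (hartogs_map (u, v)) \<partial>M1) = h0 (x * v, v)"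
    if v: "v \<noteq> 0" "norm v < 1" and N: "N v < \<infinity>" for v
  proof -
    have "(\<integral>u. K1 x u * h0 (hartogs_map (u, v)) \<partial>M1) = h0 (hartogs_map (x, v))"
    proof (rule disc_kernel_reproducing[where b = 0 and a = 1 and s = 0])
      have "(\<lambda>u. h (u * v, v)) holomorphic_on ball 0 1"
      proof (subst holomorphic_on_open[OF open_ball], intro ballI)
        fix u :: complex assume "u \<in> ball 0 1"
        then have "(u * v, v) \<in> hartogs" using v by (intro inH) auto
        then obtain \<alpha> \<beta> where d: "(h has_derivative (\<lambda>k. \<alpha> * fst k + \<beta> * snd k)) (at (u * v, v))"
          using holomorphic2_onD_open[OF hol hartogs_open] by blast
        have "((\<lambda>u. h (u * v, v)) has_field_derivative (\<alpha> * v + \<beta> * 0)) (at u)"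
          by (rule holomorphic2_on_compose_field[where g = "\<lambda>u. u * v" and k = "\<lambda>_. v" and x = u, OF d]) (auto intro!: derivative_eq_intros)
        then show "\<exists>f'. ((\<lambda>u. h (u * v, v)) has_field_derivative f') (at u)" by blast
      qed
      then have "(\<lambda>u. h0 (hartogs_map (u, v))) holomorphic_on ball 0 1"
        by (rule holomorphic_transform) (use v in \<open>simp add: hartogs_map_def hh0 inH\<close>)
      then show "(\<lambda>u. h0 (hartogs_map (u, v))) holomorphic_on ball 0 1 - {0}"
        by (rule holomorphic_on_subset) auto
    qed (use x nu N in \<open>auto simp: N_def slice_measurable\<close>)
    then show ?thesis by (simp add: hartogs_map_def)
  qed
  obtain A where A: "A \<ge> 0" "\<And>u. norm u < 1 \<Longrightarrow> norm (K1 x u) \<le> A"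
    using disc_kernel_first_bound[OF x(2)] by blast
  define m where "m = pi * Beta (0 / 2 + 1) (\<nu> + 1)"
  have m: "m > 0" unfolding m_def using nu by (intro mult_pos_pos Beta_real_pos) auto
  have m': "emeasure M1 (space M1) \<le> ennreal m" using emeasure_disc_measure[of 0 \<nu>] nu by (simp add: m_def)
  \<comment> \<open>Evaluation at the fixed point \<open>x\<close> is bounded on slices: the
    reproducing formula, the bound \<open>A\<close> for the kernel at \<open>x\<close>, and Jensen
    on the finite measure \<open>M1\<close>.\<close>
  have sq: "ennreal ((norm (h0 (x * v, v)))\<^sup>2) \<le> ennreal (A\<^sup>2 * m) * N v"
    if v: "v \<noteq> 0" "norm v < 1" and N: "N v < \<infinity>" for v
  proof -
    have [measurable]: "(\<lambda>u. h0 (hartogs_map (u, v))) \<in> borel_measurable borel" by (rule slice_measurable) simp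
    obtain B where B: "B \<ge> 0" "N v = ennreal B" using N by (cases "N v") auto
    let ?f = "\<lambda>u. K1 x u * h0 (hartogs_map (u, v))"
    have "ennreal (norm (\<integral>u. ?f u \<partial>M1)) \<le> (\<integral>\<^sup>+u. ennreal (norm (?f u)) \<partial>M1)"
      by (cases "integrable M1 ?f") (auto simp: not_integrable_integral_eq intro: integral_norm_bound_ennreal)
    also have "\<dots> \<le> (\<integral>\<^sup>+u. ennreal A * ennreal (norm (h0 (hartogs_map (u, v)))) \<partial>M1)"
    proof (rule nn_integral_mono_AE)
      show "AE u in M1. ennreal (norm (?f u)) \<le> ennreal A * ennreal (norm (h0 (hartogs_map (u, v))))"
        using AE_disc_measure
      proof eventually_elim
        case (elim u)
        then show ?case using A by (auto simp: norm_mult ennreal_mult[symmetric] intro!: ennreal_leI mult_right_mono)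
      qed
    qed
    also have "\<dots> = ennreal A * (\<integral>\<^sup>+u. ennreal (norm (h0 (hartogs_map (u, v)))) \<partial>M1)"
      by (rule nn_integral_cmult) measurable
    also have "\<dots> \<le> ennreal A * ennreal (m powr (1 - 1 / 2) * B powr (1 / 2))"
    proof (intro mult_left_mono nn_integral_Jensen_powr[OF _ _ m m' B(1)])
      show "(\<integral>\<^sup>+u. ennreal (norm (h0 (hartogs_map (u, v))) powr 2) \<partial>M1) \<le> ennreal B"
        using B(2) by (simp add: N_def powr_2_norm)
    qed auto
    also have "\<dots> = ennreal (A * (sqrt m * sqrt B))"
      using A m B by (simp add: ennreal_mult powr_half_sqrt)
    finally have "norm (h0 (x * v, v)) \<le> A * (sqrt m * sqrt B)"
      using slice[OF v N] A m B by simp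
    then have "(norm (h0 (x * v, v)))\<^sup>2 \<le> (A * (sqrt m * sqrt B))\<^sup>2" by (intro power_mono) auto
    also have "\<dots> = A\<^sup>2 * m * B" using m B by (simp add: power_mult_distrib)
    finally have "ennreal ((norm (h0 (x * v, v)))\<^sup>2) \<le> ennreal (A\<^sup>2 * m * B)" by (rule ennreal_leI)
    also have "\<dots> = ennreal (A\<^sup>2 * m) * N v" using m B by (simp add: ennreal_mult)
    finally show ?thesis .
  qed
  have [measurable]: "(\<lambda>v. h0 (x * v, v)) \<in> borel_measurable borel"
    using measurable_compose[of "\<lambda>v. hartogs_map (x, v)" borel borel h0 borel] h0 by (simp add: hartogs_map_def)
  have "(\<integral>v. K2 y v * h0 (x * v, v) \<partial>M2) = h0 (x * y, y)"
  proof (rule disc_kernel_reproducing[where g = "\<lambda>v. h0 (x * v, v)" and a = a])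
    have "(\<lambda>v. h (x * v, v)) holomorphic_on ball 0 1 - {0}"
    proof (subst holomorphic_on_open, simp add: open_delete, intro ballI)
      fix v :: complex assume "v \<in> ball 0 1 - {0}"
      then have "(x * v, v) \<in> hartogs" using x by (intro inH) auto
      then obtain \<alpha> \<beta> where d: "(h has_derivative (\<lambda>k. \<alpha> * fst k + \<beta> * snd k)) (at (x * v, v))"
        using holomorphic2_onD_open[OF hol hartogs_open] by blast
      have "((\<lambda>v. h (x * v, v)) has_field_derivative (\<alpha> * x + \<beta> * 1)) (at v)"
        by (rule holomorphic2_on_compose_field[where g = "\<lambda>v. x * v" and k = "\<lambda>v. v" and x = v, OF d]) (auto intro!: derivative_eq_intros)
      then show "\<exists>f'. ((\<lambda>v. h (x * v, v)) has_field_derivative f') (at v)" by blast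
    qed
    then show "(\<lambda>v. h0 (x * v, v)) holomorphic_on ball 0 1 - {0}"
      by (rule holomorphic_transform) (use x in \<open>auto simp: hh0 inH\<close>)
    have "(\<integral>\<^sup>+v. ennreal ((norm (h0 (x * v, v)))\<^sup>2) \<partial>M2) \<le> (\<integral>\<^sup>+v. ennreal (A\<^sup>2 * m) * N v \<partial>M2)"
    proof (rule nn_integral_mono_AE)
      show "AE v in M2. ennreal ((norm (h0 (x * v, v)))\<^sup>2) \<le> ennreal (A\<^sup>2 * m) * N v"
        using AEN AE_disc_measure by eventually_elim (auto intro: sq)
    qed
    also have "\<dots> = ennreal (A\<^sup>2 * m) * (\<integral>\<^sup>+v. N v \<partial>M2)" by (rule nn_integral_cmult) measurable
    also have "\<dots> < \<infinity>" using Nfin by (simp add: ennreal_mult_less_top)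
    finally show "(\<integral>\<^sup>+v. ennreal ((norm (h0 (x * v, v)))\<^sup>2) \<partial>M2) < \<infinity>" .
  qed (use a_bounds(1,2) nu y in \<open>auto simp: field_simps\<close>)
  moreover have "T h0 z = (\<integral>v. K2 y v * h0 (x * v, v) \<partial>M2)"
  proof -
    have "integrable H (\<lambda>u. K z u * h0 u)"
      by (rule Bochner_Integration.integrable_cong[THEN iffD1, OF refl _ int]) (simp add: hh0)
    from op_eq_iterated[OF h0 this]
    have "T h0 z = (\<integral>v. K2 y v * (\<integral>u. K1 x u * h0 (hartogs_map (u, v)) \<partial>M1) \<partial>M2)"
      by (simp add: x_def y_def)
    also have "\<dots> = (\<integral>v. K2 y v * h0 (x * v, v) \<partial>M2)"
    proof (rule integral_cong_AE)
      show "AE v in M2. K2 y v * (\<integral>u. K1 x u * h0 (hartogs_map (u, v)) \<partial>M1) = K2 y v * h0 (x * v, v)"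
        using AEN AE_disc_measure by eventually_elim (simp add: slice)
    qed measurable
    finally show ?thesis .
  qed
  moreover have "T h0 = T h" by (rule op_cong) (simp add: hh0)
  ultimately show ?thesis using zxy hh0[OF z(1)] by simp
qed

lemma op_reproducing: "h \<in> Ap \<nu> 2 \<Longrightarrow> AE z in H. T h z = h z"
proof -
  assume h: "h \<in> Ap \<nu> 2"
  then have "AE z in H. integrable H (\<lambda>u. K z u * h u)" using op_L2 by (auto simp: Ap_def)
  then show "AE z in H. T h z = h z"
    using AE_hartogs[OF nu] by eventually_elim (auto intro: op_reproducing_at[OF h])
qed

lemma L2_integrable:
  assumes "f \<in> Lp \<nu> 2" "g \<in> Lp \<nu> 2"
  shows "integrable H (\<lambda>z. f z * cnj (g z))"
  using assms by (intro integrable_mult_of_squares) (auto simp: Lp_def powr_2_norm)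

lemma L2_diff:
  assumes "f \<in> Lp \<nu> 2" "g \<in> Lp \<nu> 2"
  shows "(\<lambda>z. f z - g z) \<in> Lp \<nu> 2"
proof -
  have [measurable]: "f \<in> borel_measurable H" "g \<in> borel_measurable H" using assms by (auto simp: Lp_def)
  have "integrable H (\<lambda>z. (norm (f z - g z))\<^sup>2)"
  proof (rule Bochner_Integration.integrable_bound[of _ "\<lambda>z. 2 * (norm (f z))\<^sup>2 + 2 * (norm (g z))\<^sup>2"])
    show "AE z in H. norm ((norm (f z - g z))\<^sup>2) \<le> norm (2 * (norm (f z))\<^sup>2 + 2 * (norm (g z))\<^sup>2)"
    proof (rule AE_I2)
      fix z
      have "(norm (f z - g z))\<^sup>2 \<le> (norm (f z) + norm (g z))\<^sup>2"
        by (intro power_mono norm_triangle_ineq4) simp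
      also have "\<dots> \<le> 2 * (norm (f z))\<^sup>2 + 2 * (norm (g z))\<^sup>2"
        using sum_squares_bound[of "norm (f z)" "norm (g z)"] by (simp add: power2_sum)
      finally show "norm ((norm (f z - g z))\<^sup>2) \<le> norm (2 * (norm (f z))\<^sup>2 + 2 * (norm (g z))\<^sup>2)" by simp
    qed
  qed (use assms in \<open>auto simp: Lp_def powr_2_norm\<close>)
  then show ?thesis by (simp add: Lp_def powr_2_norm)
qed

lemma L2_inner_diff:
  assumes "f \<in> Lp \<nu> 2" "g \<in> Lp \<nu> 2" "h \<in> Lp \<nu> 2"
  shows "L2_inner \<nu> (\<lambda>z. f z - g z) h = L2_inner \<nu> f h - L2_inner \<nu> g h"
  unfolding L2_inner_def left_diff_distrib
  by (rule Bochner_Integration.integral_diff) (intro L2_integrable assms)+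

lemma op_Ap: "f \<in> Lp \<nu> 2 \<Longrightarrow> T f \<in> Ap \<nu> 2"
  using op_L2 op_holomorphic by (auto simp: Ap_def)

text \<open>Symmetry together with the reproducing property makes \<open>f - T f\<close> orthogonal
  to \<open>A\<^sup>2\<close>, so \<open>T f\<close> witnesses the description function in
  \<open>bergman_proj\<close>. The function it chooses differs from \<open>T f\<close> by an element
  of \<open>A\<^sup>2\<close> that is orthogonal to itself, hence null.\<close>

lemma bergman_proj_eq_op:
  assumes f: "f \<in> Lp \<nu> 2"
  shows "AE z in H. T f z = bergman_proj \<nu> f z"
proof -
  have orth: "L2_inner \<nu> (\<lambda>z. f z - T f z) h = 0" if h: "h \<in> Ap \<nu> 2" for h
  proof -
    have h2: "h \<in> Lp \<nu> 2" using h by (simp add: Ap_def)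
    have "L2_inner \<nu> f (T h) = L2_inner \<nu> f h"
      unfolding L2_inner_def
    proof (rule integral_cong_AE)
      show "AE z in H. f z * cnj (T h z) = f z * cnj (h z)"
        using op_reproducing[OF h] by eventually_elim simp
    qed (use f h2 op_Ap[OF h2] in \<open>auto simp: Lp_def Ap_def\<close>)
    then show ?thesis
      using L2_inner_diff[OF f _ h2] op_Ap[OF f] op_symmetric[OF f h2] by (simp add: Ap_def)
  qed
  define g where "g = bergman_proj \<nu> f"
  have g: "g \<in> Ap \<nu> 2 \<and> (\<forall>h\<in>Ap \<nu> 2. L2_inner \<nu> (\<lambda>z. f z - g z) h = 0)"
    unfolding g_def bergman_proj_def
    by (rule someI[of _ "T f"]) (use op_Ap[OF f] orth in auto)
  define d where "d z = T f z - g z" for z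
  have Tf2: "T f \<in> Lp \<nu> 2" and g2: "g \<in> Lp \<nu> 2" using op_Ap[OF f] g by (auto simp: Ap_def)
  have d2: "d \<in> Lp \<nu> 2" unfolding d_def by (rule L2_diff[OF Tf2 g2])
  have dA: "d \<in> Ap \<nu> 2"
    using d2 op_Ap[OF f] g unfolding Ap_def d_def by (auto intro: holomorphic2_on_diff)
  have eqs: "L2_inner \<nu> f d - L2_inner \<nu> (T f) d = 0" "L2_inner \<nu> f d - L2_inner \<nu> g d = 0"
    using orth[OF dA] g dA L2_inner_diff[OF f Tf2 d2] L2_inner_diff[OF f g2 d2] by auto
  have "L2_inner \<nu> d d = 0"
  proof -
    have "(\<lambda>z. T f z - g z) = d" by (simp add: d_def fun_eq_iff)
    then show ?thesis using L2_inner_diff[OF Tf2 g2 d2] eqs by simp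
  qed
  then have "(\<integral>z. complex_of_real ((norm (d z))\<^sup>2) \<partial>H) = 0"
    unfolding L2_inner_def by (simp only: complex_norm_square)
  then have 0: "(\<integral>z. (norm (d z))\<^sup>2 \<partial>H) = 0" by (simp only: integral_complex_of_real of_real_eq_0_iff)
  have "integrable H (\<lambda>z. (norm (d z))\<^sup>2)" using d2 by (simp add: Lp_def powr_2_norm)
  then have "AE z in H. (norm (d z))\<^sup>2 = 0"
    using 0 by (subst (asm) integral_nonneg_eq_0_iff_AE) auto
  then show ?thesis unfolding g_def[symmetric] by eventually_elim (simp add: d_def)
qed

lemma extends_if:
  assumes p: "p > 1" and sp: "real s * p < \<nu> + 4" "real s * (p / (p - 1)) < \<nu> + 4"
  shows "extends_to_bounded_Lp \<nu> p (bergman_proj \<nu>)"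
  unfolding extends_to_bounded_Lp_def
  using Lp_bounded_operator_op[OF assms] bergman_proj_eq_op by blast

lemma bounded_Lp:
  assumes "f \<in> borel_measurable H" "\<And>z. z \<in> hartogs \<Longrightarrow> norm (f z) \<le> B" "p > 0"
  shows "f \<in> Lp \<nu> p"
proof -
  interpret finite_measure H by (rule finite_hartogs_measure[OF nu])
  have "integrable H (\<lambda>z. norm (f z) powr p)"
  proof (rule integrable_const_bound[where B = "B powr p"])
    show "AE z in H. norm (norm (f z) powr p) \<le> B powr p"
      using assms by (intro AE_I2) (auto intro!: powr_mono2)
  qed (use assms in measurable)
  then show ?thesis using assms by (simp add: Lp_def)
qed

section \<open>Test functions and necessity of both exponent conditions\<close>

definition test_fun :: "complex \<times> complex \<Rightarrow> complex" where
  "test_fun z = cnj (snd z) ^ s"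

lemma test_fun_borel: "test_fun \<in> borel_measurable borel"
proof -
  note [measurable] = snd_borel
  show ?thesis unfolding test_fun_def[abs_def] by measurable
qed

lemma test_fun_bound: "z \<in> hartogs \<Longrightarrow> norm (test_fun z) \<le> 1"
  using hartogsD[of z] by (simp add: test_fun_def norm_power power_le_one)

lemma test_fun_Lp: "p > 0 \<Longrightarrow> test_fun \<in> Lp \<nu> p"
  by (rule bounded_Lp[where B = 1]) (auto intro: borel_measurable_hartogs test_fun_borel test_fun_bound)

text \<open>The test function is constant in the first disc variable, so the inner integral is
  \<open>c1\<close>; the outer one is the conjugate power formula of order \<open>s\<close>.
  Positivity of the factor comes from positive kernel coefficients and total masses.\<close>

lemma op_test_fun: "\<exists>c>0. AE z in H. T test_fun z = of_real c / snd z ^ s"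
proof -
  define c1 where "c1 = kernel_coeff \<nu> 1 0 * measure M1 UNIV"
  define c2 where "c2 = kernel_coeff \<nu> a 0 * measure M2 UNIV"
  have m: "measure (disc_measure b \<nu>) UNIV > 0" if "b > -2" for b
  proof -
    have "pi * Beta (b / 2 + 1) (\<nu> + 1) > 0" using that nu by (intro mult_pos_pos Beta_real_pos) auto
    then show ?thesis using emeasure_disc_measure[OF that nu] by (simp add: measure_def)
  qed
  have c: "c1 > 0" "c2 > 0"
    unfolding c1_def c2_def using nu a_bounds(1) by (auto intro!: mult_pos_pos m kernel_coeff_pos)
  have "AE z in H. integrable H (\<lambda>u. K z u * test_fun u)" using op_L2 test_fun_Lp[of 2] by auto
  then have "AE z in H. T test_fun z = of_real (c1 * c2) / snd z ^ s"
    using AE_hartogs[OF nu]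
  proof eventually_elim
    case (elim z)
    have z: "fst z / snd z \<noteq> 0" "norm (fst z / snd z) < 1" "snd z \<noteq> 0" "norm (snd z) < 1" using hartogsD[of z] elim by auto
    have "T test_fun z = (\<integral>v. K2 (snd z) v *
      (\<integral>u. K1 (fst z / snd z) u * test_fun (hartogs_map (u, v)) \<partial>M1) \<partial>M2)"
      by (rule op_eq_iterated[OF test_fun_borel elim(1)])
    also have "\<dots> = (\<integral>v. of_real c1 * (K2 (snd z) v * cnj v ^ s) \<partial>M2)"
    proof (rule Bochner_Integration.integral_cong[OF refl])
      fix v
      have "(\<integral>u. K1 (fst z / snd z) u * test_fun (hartogs_map (u, v)) \<partial>M1)
        = (\<integral>u. K1 (fst z / snd z) u * cnj v ^ s \<partial>M1)"
        by (simp add: test_fun_def hartogs_map_def)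
      also have "\<dots> = (\<integral>u. K1 (fst z / snd z) u \<partial>M1) * cnj v ^ s"
        by (rule integral_mult_left_zero)
      also have "(\<integral>u. K1 (fst z / snd z) u \<partial>M1) = of_real c1"
        using disc_kernel_cnj_power[of 1 0 \<nu> "fst z / snd z" 0] z nu by (simp add: c1_def)
      finally show "K2 (snd z) v * (\<integral>u. K1 (fst z / snd z) u * test_fun (hartogs_map (u, v)) \<partial>M1)
        = of_real c1 * (K2 (snd z) v * cnj v ^ s)" by simp
    qed
    also have "\<dots> = of_real c1 * (\<integral>v. K2 (snd z) v * cnj v ^ s \<partial>M2)"
      by (rule integral_mult_right_zero)
    also have "(\<integral>v. K2 (snd z) v * cnj v ^ s \<partial>M2) = of_real c2 / snd z ^ s"
      using disc_kernel_cnj_power[of a "\<nu> + 2" \<nu> "snd z" s] z nu a_bounds(1) by (simp add: c2_def)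
    finally show ?case by simp
  qed
  then show ?thesis using c by (intro exI[of _ "c1 * c2"]) auto
qed

lemma norm_power_inverse: "w \<noteq> 0 \<Longrightarrow> norm (1 / (w::complex) ^ s) = norm w powr (- real s)"
  by (simp add: norm_inverse norm_power powr_minus powr_realpow divide_inverse)

lemma extends_upper:
  assumes ext: "extends_to_bounded_Lp \<nu> p (bergman_proj \<nu>)" and p: "p > 1"
  shows "real s * p < \<nu> + 4"
proof (rule ccontr)
  assume n: "\<not> real s * p < \<nu> + 4"
  obtain T' where T': "Lp_bounded_operator \<nu> p T'" "\<And>f. f \<in> Lp \<nu> 2 \<inter> Lp \<nu> p \<Longrightarrow> AE z in H. T' f z = bergman_proj \<nu> f z"
    using ext unfolding extends_to_bounded_Lp_def by blast
  obtain c where c: "c > 0" "AE z in H. T test_fun z = of_real c / snd z ^ s" using op_test_fun by blast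
  have tp: "test_fun \<in> Lp \<nu> p" "test_fun \<in> Lp \<nu> 2" using p by (auto intro: test_fun_Lp)
  have "T' test_fun \<in> Lp \<nu> p" using T'(1) tp unfolding Lp_bounded_operator_def by blast
  then have "integrable H (\<lambda>z. norm (T' test_fun z) powr p)" by (simp add: Lp_def)
  then have fin: "(\<integral>\<^sup>+z. ennreal (norm (T' test_fun z) powr p) \<partial>H) < \<infinity>" by (simp add: integrable_iff_bounded)
  have "AE z in H. T' test_fun z = bergman_proj \<nu> test_fun z" using T'(2) tp by auto
  then have eq: "AE z in H. ennreal (norm (T' test_fun z) powr p) = ennreal (c powr p) * ennreal (norm (snd z) powr (- real s * p))"
    using bergman_proj_eq_op[OF tp(2)] c(2) AE_space
  proof eventually_elim
    case (elim z)
    have z: "snd z \<noteq> 0" using hartogsD[of z] elim(4) by simp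
    have "T' test_fun z = of_real c * (1 / snd z ^ s)" using elim by simp
    then have "norm (T' test_fun z) = c * norm (1 / snd z ^ s)"
      using c(1) by (simp only: norm_mult norm_of_real abs_of_pos)
    also have "\<dots> = c * norm (snd z) powr (- real s)" by (simp only: norm_power_inverse[OF z])
    finally show ?case using c(1) by (simp add: powr_mult powr_powr ennreal_mult)
  qed
  have "(\<integral>\<^sup>+z. ennreal (norm (T' test_fun z) powr p) \<partial>H) = (\<integral>\<^sup>+z. ennreal (c powr p) * ennreal (norm (snd z) powr (- real s * p)) \<partial>H)"
    by (rule nn_integral_cong_AE[OF eq])
  also have "\<dots> = ennreal (c powr p) * (\<integral>\<^sup>+z. ennreal (norm (snd z) powr (- real s * p)) \<partial>H)"
    by (rule nn_integral_cmult) measurable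
  also have "(\<integral>\<^sup>+z. ennreal (norm (snd z) powr (- real s * p)) \<partial>H) = \<infinity>"
    using n by (intro nn_integral_snd_powr_infinite) auto
  finally show False using fin c(1) by (simp add: ennreal_mult_top)
qed

text \<open>Duality: testing boundedness on truncations of \<open>\<bar>w\<bar> powr (- s (q - 2)) / w ^ s\<close>, \<open>w = snd z\<close>,
  against the conjugate power whose projection is a multiple of \<open>1 / w ^ s\<close> forces the latter into \<open>L\<^sup>q\<close>.\<close>

lemma extends_lower:
  assumes ext: "extends_to_bounded_Lp \<nu> p (bergman_proj \<nu>)" and p: "p > 1"
  shows "real s * (p / (p - 1)) < \<nu> + 4"
proof (rule ccontr)
  define q where "q = p / (p - 1)"
  assume "\<not> real s * (p / (p - 1)) < \<nu> + 4"
  then have n: "real s * q \<ge> \<nu> + 4" by (simp add: q_def)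
  have q: "q > 1" "(q - 1) * p = q" "1 - 1 / p = 1 / q" using p by (auto simp: q_def field_simps)
  interpret finite_measure H by (rule finite_hartogs_measure[OF nu])
  obtain T' where T': "Lp_bounded_operator \<nu> p T'" "\<And>f. f \<in> Lp \<nu> 2 \<inter> Lp \<nu> p \<Longrightarrow> AE z in H. T' f z = bergman_proj \<nu> f z"
    using ext unfolding extends_to_bounded_Lp_def by blast
  obtain C0 where C0: "\<And>f. f \<in> Lp \<nu> p \<Longrightarrow> Lp_norm \<nu> p (T' f) \<le> C0 * Lp_norm \<nu> p f"
    and T'Lp: "\<And>f. f \<in> Lp \<nu> p \<Longrightarrow> T' f \<in> Lp \<nu> p"
    using T'(1) unfolding Lp_bounded_operator_def by blast
  define C where "C = max C0 0"
  have C: "C \<ge> 0" "Lp_norm \<nu> p (T' f) \<le> C * Lp_norm \<nu> p f" if "f \<in> Lp \<nu> p" for f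
  proof -
    have "C0 * Lp_norm \<nu> p f \<le> C * Lp_norm \<nu> p f"
      by (rule mult_right_mono) (simp_all add: C_def Lp_norm_def)
    then show "C \<ge> 0" "Lp_norm \<nu> p (T' f) \<le> C * Lp_norm \<nu> p f" using C0[OF that] by (auto simp: C_def)
  qed
  obtain c where c: "c > 0" "AE z in H. T test_fun z = of_real c / snd z ^ s" using op_test_fun by blast
  have t2: "test_fun \<in> Lp \<nu> 2" by (rule test_fun_Lp) simp
  define m where "m = measure H hartogs + 1"
  have m: "m > 0" by (simp add: m_def add_nonneg_pos)
  have mm: "emeasure H (space H) \<le> ennreal m" by (simp add: emeasure_eq_measure m_def)
  \<comment> \<open>Truncation away from \<open>snd z = 0\<close> makes this finite for each
    \<open>e\<close>, so it may be divided by; the aim is a bound independent of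
    \<open>e\<close>.\<close>
  define J where "J e = (\<integral>z. indicator {z. norm (snd z) > e} z * norm (snd z) powr (- real s * q) \<partial>H)" for e :: real
  \<comment> \<open>Solves \<open>c * J \<le> m powr (1 - 1 / p) * C * J powr (1 / p)\<close> for
    \<open>J\<close>, using \<open>1 - 1 / p = 1 / q\<close>.\<close>
  define Bd where "Bd = (m powr (1 - 1 / p) * C / c) powr q"
  have [measurable]: "(\<lambda>z. indicator {z. norm (snd z) > e} z :: real) \<in> borel_measurable H" for e
  proof -
    have "{z :: complex \<times> complex. norm (snd z) > e} \<in> sets borel"
      by (intro borel_open open_Collect_less continuous_intros)
    then have "(\<lambda>z. indicator {z :: complex \<times> complex. norm (snd z) > e} z :: real) \<in> borel_measurable borel" by simp
    then show ?thesis by (rule borel_measurable_hartogs)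
  qed
  have J: "integrable H (\<lambda>z. indicator {z. norm (snd z) > e} z * norm (snd z) powr (- real s * q)) \<and> J e \<le> Bd"
    if e: "0 < e" for e
  proof -
    \<comment> \<open>The exponent makes two integrals coincide: \<open>norm (f z) powr p\<close>
      integrates to \<open>J e\<close>, since \<open>(q - 1) * p = q\<close>, and the pairing of
      \<open>f\<close> with \<open>T test_fun\<close> is \<open>c * J e\<close>. The phase of
      \<open>1 / snd z ^ s\<close> makes that pairing positive.\<close>
    define f where "f z = of_real (indicator {z. norm (snd z) > e} z * norm (snd z) powr (- real s * (q - 2))) * (1 / snd z ^ s)" for z :: "complex \<times> complex"
    have [measurable]: "f \<in> borel_measurable H" unfolding f_def by measurable
    have nf: "norm (f z) = indicator {z. norm (snd z) > e} z * norm (snd z) powr (- real s * (q - 1))" if "z \<in> hartogs" for z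
    proof -
      have z: "snd z \<noteq> 0" using hartogsD[OF that] by simp
      have "norm (f z) = indicator {z. norm (snd z) > e} z * (norm (snd z) powr (- real s * (q - 2)) * norm (snd z) powr (- real s))"
        unfolding f_def norm_mult norm_power_inverse[OF z] by (simp add: indicator_def)
      also have "norm (snd z) powr (- real s * (q - 2)) * norm (snd z) powr (- real s) = norm (snd z) powr (- real s * (q - 1))"
        unfolding powr_add[symmetric] by (rule arg_cong[of _ _ "\<lambda>t. norm (snd z) powr t"]) (simp add: algebra_simps)
      finally show ?thesis .
    qed
    have fb: "norm (f z) \<le> e powr (- real s * (q - 1))" if "z \<in> hartogs" for z
      unfolding nf[OF that] using e q by (auto simp: indicator_def intro!: powr_mono2')
    have fp: "f \<in> Lp \<nu> p" and f2: "f \<in> Lp \<nu> 2" using p by (auto intro!: bounded_Lp[OF _ fb])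
    have nfp: "norm (f z) powr p = indicator {z. norm (snd z) > e} z * norm (snd z) powr (- real s * q)" if "z \<in> hartogs" for z
    proof -
      have "norm (f z) powr p = indicator {z. norm (snd z) > e} z * norm (snd z) powr (- real s * (q - 1) * p)"
        unfolding nf[OF that] using p by (simp add: indicator_def powr_powr)
      also have "- real s * (q - 1) * p = - real s * q" using q(2) by (simp only: mult.assoc)
      finally show ?thesis .
    qed
    have intJ: "integrable H (\<lambda>z. indicator {z. norm (snd z) > e} z * norm (snd z) powr (- real s * q))"
      using fp by (subst Bochner_Integration.integrable_cong[OF refl nfp[symmetric]]) (auto simp: Lp_def)
    have Jf: "(\<integral>z. norm (f z) powr p \<partial>H) = J e"
      unfolding J_def by (rule Bochner_Integration.integral_cong) (auto simp: nfp)
    have J0: "J e \<ge> 0" unfolding J_def by (intro Bochner_Integration.integral_nonneg) auto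
    have "L2_inner \<nu> f (T test_fun) = of_real (c * J e)"
    proof -
      have "L2_inner \<nu> f (T test_fun) = (\<integral>z. of_real (c * (indicator {z. norm (snd z) > e} z * norm (snd z) powr (- real s * q))) \<partial>H)"
        unfolding L2_inner_def
      proof (rule integral_cong_AE)
        show "AE z in H. f z * cnj (T test_fun z) = of_real (c * (indicator {z. norm (snd z) > e} z * norm (snd z) powr (- real s * q)))"
          using c(2) AE_space
        proof eventually_elim
          case (elim z)
          have z: "snd z \<noteq> 0" using hartogsD[of z] elim(2) by simp
          have "(1 / snd z ^ s) * cnj (1 / snd z ^ s) = of_real ((norm (1 / snd z ^ s))\<^sup>2)"
            by (simp only: complex_norm_square)
          also have "norm (1 / snd z ^ s) = norm (snd z) powr (- real s)" by (rule norm_power_inverse[OF z])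
          also have "(norm (snd z) powr (- real s))\<^sup>2 = norm (snd z) powr (- real s * 2)"
            by (simp add: power2_eq_square powr_add[symmetric] mult.commute)
          finally have 1: "(1 / snd z ^ s) * cnj (1 / snd z ^ s) = of_real (norm (snd z) powr (- real s * 2))" .
          have 2: "norm (snd z) powr (- real s * (q - 2)) * norm (snd z) powr (- real s * 2) = norm (snd z) powr (- real s * q)"
            unfolding powr_add[symmetric] by (rule arg_cong[of _ _ "\<lambda>t. norm (snd z) powr t"]) (simp add: algebra_simps)
          have "f z * cnj (T test_fun z) = of_real (indicator {z. norm (snd z) > e} z * norm (snd z) powr (- real s * (q - 2))) * of_real c * ((1 / snd z ^ s) * cnj (1 / snd z ^ s))"
            using elim(1) by (simp add: f_def)
          also have "\<dots> = of_real (c * (indicator {z. norm (snd z) > e} z * (norm (snd z) powr (- real s * (q - 2)) * norm (snd z) powr (- real s * 2))))"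
            unfolding 1 by simp
          finally show ?case unfolding 2 .
        qed
        show "(\<lambda>z. f z * cnj (T test_fun z)) \<in> borel_measurable H"
          using op_Ap[OF t2] by (auto simp: Ap_def Lp_def)
      qed measurable
      also have "\<dots> = of_real (\<integral>z. c * (indicator {z. norm (snd z) > e} z * norm (snd z) powr (- real s * q)) \<partial>H)"
        by (rule integral_complex_of_real)
      also have "(\<integral>z. c * (indicator {z. norm (snd z) > e} z * norm (snd z) powr (- real s * q)) \<partial>H) = c * J e"
        unfolding J_def by (rule integral_mult_right_zero)
      finally show ?thesis .
    qed
    \<comment> \<open>Symmetry moves the operator onto \<open>f\<close>. The test function is
      bounded by 1, so the pairing is at most the \<open>L\<^sup>1\<close> norm of
      \<open>T' f\<close>, which Jensen bounds by its \<open>L\<^sup>p\<close> norm.\<close>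
    then have "c * J e = norm (L2_inner \<nu> (T f) test_fun)"
      unfolding op_symmetric[OF f2 t2] using c(1) J0 by (simp add: norm_mult)
    also have "ennreal \<dots> \<le> (\<integral>\<^sup>+z. ennreal (norm (T f z * cnj (test_fun z))) \<partial>H)"
      unfolding L2_inner_def using op_Ap[OF f2] t2 by (intro integral_norm_bound_ennreal L2_integrable) (auto simp: Ap_def)
    also have "\<dots> \<le> (\<integral>\<^sup>+z. ennreal (norm (T' f z)) \<partial>H)"
    proof (rule nn_integral_mono_AE)
      have "AE z in H. T' f z = bergman_proj \<nu> f z" using T'(2) fp f2 by auto
      then show "AE z in H. ennreal (norm (T f z * cnj (test_fun z))) \<le> ennreal (norm (T' f z))"
        using bergman_proj_eq_op[OF f2] AE_space
      proof eventually_elim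
        case (elim z)
        then show ?case using test_fun_bound[of z] by (auto simp: norm_mult intro!: ennreal_leI mult_left_le)
      qed
    qed
    also have "\<dots> \<le> ennreal (m powr (1 - 1 / p) * (\<integral>z. norm (T' f z) powr p \<partial>H) powr (1 / p))"
    proof (rule nn_integral_Jensen_powr[OF _ _ m mm _ _ p])
      show "(\<lambda>z. norm (T' f z)) \<in> borel_measurable H" using T'Lp[OF fp] by (auto simp: Lp_def)
      have "integrable H (\<lambda>z. norm (T' f z) powr p)" using T'Lp[OF fp] by (simp add: Lp_def)
      then show "(\<integral>\<^sup>+z. ennreal (norm (T' f z) powr p) \<partial>H) \<le> ennreal (\<integral>z. norm (T' f z) powr p \<partial>H)"
        by (subst nn_integral_eq_integral) auto
    qed auto
    also have "\<dots> = ennreal (m powr (1 - 1 / p) * Lp_norm \<nu> p (T' f))" by (simp add: Lp_norm_def)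
    also have "\<dots> \<le> ennreal (m powr (1 - 1 / p) * (C * Lp_norm \<nu> p f))"
      by (intro ennreal_leI mult_left_mono C fp) auto
    also have "Lp_norm \<nu> p f = J e powr (1 / p)" by (simp add: Lp_norm_def Jf)
    finally have main: "c * J e \<le> m powr (1 - 1 / p) * (C * J e powr (1 / p))"
      using C(1)[OF fp] by (subst (asm) ennreal_le_iff) auto
    have "J e \<le> Bd"
    proof (cases "J e = 0")
      case True
      then show ?thesis by (simp add: Bd_def)
    next
      case False
      with J0 have Jp: "J e > 0" by simp
      have "J e = J e powr (1 / q) * J e powr (1 / p)"
        using Jp q(3) by (simp add: powr_add[symmetric] flip: q(3))
      with main have "c * J e powr (1 / q) * J e powr (1 / p) \<le> m powr (1 - 1 / p) * C * J e powr (1 / p)"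
        by (simp add: mult.assoc)
      then have "c * J e powr (1 / q) \<le> m powr (1 - 1 / p) * C"
        using Jp by (simp add: mult_le_cancel_right)
      then have "J e powr (1 / q) \<le> m powr (1 - 1 / p) * C / c"
        using c(1) by (simp add: field_simps)
      then have "(J e powr (1 / q)) powr q \<le> Bd"
        unfolding Bd_def using q by (intro powr_mono2) auto
      then show ?thesis using Jp q by (simp add: powr_powr)
    qed
    with intJ show ?thesis by simp
  qed
  define F where "F n z = ennreal (indicator {z. norm (snd z) > 1 / real (Suc n)} z * norm (snd z) powr (- real s * q))" for n and z :: "complex \<times> complex"
  have [measurable]: "F n \<in> borel_measurable H" for n unfolding F_def by measurable
  \<comment> \<open>Fatou along \<open>e = 1 / Suc n\<close> carries the uniform bound to the
    untruncated integral, which is infinite when \<open>s * q \<ge> \<nu> + 4\<close>.\<close>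
  have "(\<integral>\<^sup>+z. ennreal (norm (snd z) powr (- real s * q)) \<partial>H) \<le> (\<integral>\<^sup>+z. liminf (\<lambda>n. F n z) \<partial>H)"
  proof (rule nn_integral_mono)
    fix z assume "z \<in> space H"
    then have z: "norm (snd z) > 0" using hartogsD[of z] by simp
    have "(\<lambda>n. 1 / real (Suc n)) \<longlonglongrightarrow> 0" by real_asymp
    then have "eventually (\<lambda>n. 1 / real (Suc n) < norm (snd z)) sequentially" using z by (rule order_tendstoD)
    then have "eventually (\<lambda>n. ennreal (norm (snd z) powr (- real s * q)) \<le> F n z) sequentially"
      by eventually_elim (simp add: F_def)
    then show "ennreal (norm (snd z) powr (- real s * q)) \<le> liminf (\<lambda>n. F n z)"
      by (rule Liminf_bounded)
  qed
  also have "\<dots> \<le> liminf (\<lambda>n. \<integral>\<^sup>+z. F n z \<partial>H)" by (rule nn_integral_liminf) measurable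
  also have "\<dots> \<le> limsup (\<lambda>n. \<integral>\<^sup>+z. F n z \<partial>H)" by (rule Liminf_le_Limsup) simp
  also have "\<dots> \<le> ennreal Bd"
  proof (rule Limsup_bounded, rule always_eventually, rule allI)
    fix n
    have "(\<integral>\<^sup>+z. F n z \<partial>H) = ennreal (J (1 / real (Suc n)))"
      unfolding F_def J_def using J[of "1 / real (Suc n)"] by (intro nn_integral_eq_integral) auto
    also have "\<dots> \<le> ennreal Bd" using J[of "1 / real (Suc n)"] by (intro ennreal_leI) auto
    finally show "(\<integral>\<^sup>+z. F n z \<partial>H) \<le> ennreal Bd" .
  qed
  finally have "(\<integral>\<^sup>+z. ennreal (norm (snd z) powr (- real s * q)) \<partial>H) \<le> ennreal Bd" .
  moreover have "(\<integral>\<^sup>+z. ennreal (norm (snd z) powr (- real s * q)) \<partial>H) = \<infinity>"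
    using n by (intro nn_integral_snd_powr_infinite) auto
  ultimately show False by (simp add: top_unique)
qed

section \<open>The exact interval of exponents\<close>

text \<open>The condition on the conjugate exponent is linear in \<open>p\<close> once multiplied by
  \<open>p - 1\<close>. Both \<open>s\<close> and \<open>\<nu> + 4 - s\<close> are positive, so the
  two conditions solve to the two endpoints.\<close>

lemma extends_iff:
  assumes p: "p > 1"
  shows "extends_to_bounded_Lp \<nu> p (bergman_proj \<nu>)
    \<longleftrightarrow> p \<in> {(\<nu> + 4) / (\<nu> + 4 - real s) <..< (\<nu> + 4) / real s}"
proof -
  have "real s > 0" using s nu by (cases s) auto
  moreover have "\<nu> + 4 - real s > 0" using s nu by auto
  moreover have "real s * (p / (p - 1)) < \<nu> + 4 \<longleftrightarrow> \<nu> + 4 < p * (\<nu> + 4 - real s)"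
    using p by (simp add: field_simps)
  ultimately have "p \<in> {(\<nu> + 4) / (\<nu> + 4 - real s) <..< (\<nu> + 4) / real s}
    \<longleftrightarrow> real s * p < \<nu> + 4 \<and> real s * (p / (p - 1)) < \<nu> + 4"
    by (auto simp: divide_less_eq less_divide_eq mult.commute)
  then show ?thesis using extends_if[OF p] extends_upper[OF _ p] extends_lower[OF _ p] by blast
qed

end

theorem theorem1:
  fixes \<nu> p :: real
  assumes "\<nu> > -1" and "1 < p"
  shows
    "(\<nu> > 0 \<and> (\<forall>n::nat. \<nu> \<noteq> 2 * real n) \<longrightarrow>
        (extends_to_bounded_Lp \<nu> p (bergman_proj \<nu>) \<longleftrightarrow>
          p \<in> {2 - (\<nu> - 2 * real_of_int \<lfloor>\<nu> / 2\<rfloor>) / (2 + \<nu> - real_of_int \<lfloor>\<nu> / 2\<rfloor>)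
               <..< 2 + (\<nu> - 2 * real_of_int \<lfloor>\<nu> / 2\<rfloor>) / (2 + real_of_int \<lfloor>\<nu> / 2\<rfloor>)})) \<and>
     (\<forall>n::nat. \<nu> = 2 * real n \<longrightarrow>
        (extends_to_bounded_Lp \<nu> p (bergman_proj \<nu>) \<longleftrightarrow>
          p \<in> {2 - 2 / (3 + real n) <..< 2 + 2 / (1 + real n)})) \<and>
     (-1 < \<nu> \<and> \<nu> < 0 \<longrightarrow>
        (extends_to_bounded_Lp \<nu> p (bergman_proj \<nu>) \<longleftrightarrow>
          p \<in> {2 - (2 + \<nu>) / (3 + \<nu>) <..< 4 + \<nu>}))"
proof (intro conjI impI allI)
  assume nu: "\<nu> > 0 \<and> (\<forall>n::nat. \<nu> \<noteq> 2 * real n)"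
  define k where "k = nat \<lfloor>\<nu> / 2\<rfloor>"
  have k: "real_of_int \<lfloor>\<nu> / 2\<rfloor> = real k" using nu by (simp add: k_def)
  have "real k \<le> \<nu> / 2" "\<nu> / 2 < real k + 1" unfolding k[symmetric] by linarith+
  moreover have "\<nu> \<noteq> 2 * real k" using nu by blast
  \<comment> \<open>Here \<open>s = \<lfloor>\<nu> / 2\<rfloor> + 2\<close>; it lies strictly below
    \<open>2 + \<nu> / 2\<close> because \<open>\<nu> / 2\<close> is not an integer.\<close>
  ultimately interpret hartogs_bergman \<nu> "k + 2" using assms by unfold_locales auto
  have "2 - (\<nu> - 2 * real k) / (2 + \<nu> - real k) = (\<nu> + 4) / (\<nu> + 4 - real (k + 2))"
    "2 + (\<nu> - 2 * real k) / (2 + real k) = (\<nu> + 4) / real (k + 2)"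
    using \<open>real k \<le> \<nu> / 2\<close> nu by (simp_all add: field_simps)
  then show "extends_to_bounded_Lp \<nu> p (bergman_proj \<nu>) \<longleftrightarrow>
          p \<in> {2 - (\<nu> - 2 * real_of_int \<lfloor>\<nu> / 2\<rfloor>) / (2 + \<nu> - real_of_int \<lfloor>\<nu> / 2\<rfloor>)
               <..< 2 + (\<nu> - 2 * real_of_int \<lfloor>\<nu> / 2\<rfloor>) / (2 + real_of_int \<lfloor>\<nu> / 2\<rfloor>)}"
    unfolding k using extends_iff[OF assms(2)] by (simp only:)
next
  fix n :: nat assume n: "\<nu> = 2 * real n"
  \<comment> \<open>Now \<open>2 + \<nu> / 2\<close> is the integer \<open>n + 2\<close>, and the
    largest integer strictly below it is one less.\<close>
  interpret hartogs_bergman \<nu> "n + 1" using assms n by unfold_locales auto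
  have "2 - 2 / (3 + real n) = (\<nu> + 4) / (\<nu> + 4 - real (n + 1))"
    "2 + 2 / (1 + real n) = (\<nu> + 4) / real (n + 1)"
    using n by (simp_all add: field_simps)
  then show "extends_to_bounded_Lp \<nu> p (bergman_proj \<nu>) \<longleftrightarrow> p \<in> {2 - 2 / (3 + real n) <..< 2 + 2 / (1 + real n)}"
    using extends_iff[OF assms(2)] by (simp only:)
next
  assume nu: "-1 < \<nu> \<and> \<nu> < 0"
  \<comment> \<open>For these weights \<open>2 + \<nu> / 2\<close> lies between 3/2 and 2, so
    \<open>s = 1\<close>.\<close>
  interpret hartogs_bergman \<nu> 1 using nu by unfold_locales auto
  have "2 - (2 + \<nu>) / (3 + \<nu>) = (\<nu> + 4) / (\<nu> + 4 - real 1)" "4 + \<nu> = (\<nu> + 4) / real 1"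
    using nu by (simp_all add: field_simps)
  then show "extends_to_bounded_Lp \<nu> p (bergman_proj \<nu>) \<longleftrightarrow> p \<in> {2 - (2 + \<nu>) / (3 + \<nu>) <..< 4 + \<nu>}"
    using extends_iff[OF assms(2)] by (simp only:)
qed

end
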